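(* Let $k\ge 1$ be a natural number and let $m$ be a non-zero integer. For any real $\alpha,\beta>0$ satisfying $\alpha\beta=\pi^2$, \begin{align*} &(\alpha^k)^{-m}\left[\sum_{n=1}^{\infty}\frac{d_k(n)}{n^{2m+1}}\Psi_{(2\alpha)^k,k}(n)-\frac{1}{(k-1)!}\frac{d^{k-1}}{ds^{k-1}}\left(\zeta^k(2m+1+s)\zeta^k(s)\Gamma^k(s+1)\cos^{k-1}\left(\frac{\pi s}{2}\right)(2\alpha)^{-ks}\right)\bigg|_{s=0}\right]\\ &=(-\beta^k)^{-m}\left[\sum_{n=1}^{\infty}\frac{d_k(n)}{n^{2m+1}}\Psi_{(2\beta)^k,k}(n)-\frac{1}{(k-1)!}\frac{d^{k-1}}{ds^{k-1}}\left(\zeta^k(2m+1+s)\zeta^k(s)\Gamma^k(s+1)\cos^{k-1}\left(\frac{\pi s}{2}\right)(2\beta)^{-ks}\right)\bigg|_{s=0}\right]\\ &\quad+(-1)^{km+k+m}\left(\frac{\pi}{2}\right)^{k-1}2^{2km}\sum_{j=0}^{m+1}(-1)^j\frac{B_{2m-2j+2}^k\,B_{2j}^k}{(2m-2j+2)!^k\,(2j)!^k}\,\alpha^{k(m+1-j)}\beta^{kj}. \end{align*}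
   Context: $\zeta$ is the (analytically continued) Riemann zeta function, $\Gamma$ the Gamma function, $B_n$ the $n$-th Bernoulli number, and $f^k(s)$ denotes $(f(s))^k$; likewise $B_n^k=(B_n)^k$ and $n!^k=(n!)^k$. A finite sum $\sum_{j=0}^{m+1}$ with $m+1<0$ is empty, i.e. equal to $0$. $d_k(n)$ is the Piltz divisor function: the number of ordered $k$-tuples of positive integers with product $n$ (so $\sum_{n\ge1} d_k(n)n^{-s}=\zeta^k(s)$ for $\mathrm{Re}(s)>1$). For $\rho>0$, $x>0$ and a natural number $k$, $$\Psi_{\rho,k}(x):=\frac{\pi^{k/2-1}}{2^{k-1}}\sum_{j=1}^\infty d_k(j)\,G^{k+1,0}_{0,2k}\left(\begin{matrix}\text{---}\\ (0)_k,\tfrac12;(\tfrac12)_{k-1}\end{matrix}\ \bigg|\ \frac{\rho^2j^2x^2}{2^{2k}}\right),$$ where $(a)_r$ means the parameter $a$ repeated $r$ times and the Meijer $G$-function occurring here is, for $z>0$ and any $\mu<0$, $$G^{k+1,0}_{0,2k}\left(\begin{matrix}\text{---}\\ (0)_k,\tfrac12;(\tfrac12)_{k-1}\end{matrix}\ \bigg|\ z\right)=\frac{1}{2\pi i}\int_{\mu-i\infty}^{\mu+i\infty}\frac{\Gamma(-s)^k\,\Gamma(\tfrac12-s)}{\Gamma(\tfrac12+s)^{k-1}}\,z^s\,ds.$$ *)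

theory Defs
  imports "HOL-Complex_Analysis.Complex_Analysis"
begin

text \<open>
  The condition \<open>f 1 = 0\<close> only fixes the junk value at the pole, so that the analytic
  continuation is unique as a total function.
\<close>
definition riemann_zeta :: "complex \<Rightarrow> complex" where
  "riemann_zeta = (THE f. f holomorphic_on (- {1}) \<and>
      (\<forall>s. Re s > 1 \<longrightarrow> (\<lambda>n. 1 / of_nat (Suc n) powr s) sums f s) \<and>
      f 1 = 0)"

text \<open>Generating function \<open>x / (e\<^sup>x - 1) = (\<Sum>n. B\<^sub>n x\<^sup>n / n!)\<close>.\<close>
definition bernoulli :: "nat \<Rightarrow> real" where
  "bernoulli n = fact n * fps_nth (fps_X / (fps_exp 1 - 1)) n"

definition piltz :: "nat \<Rightarrow> nat \<Rightarrow> nat" where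
  "piltz k n = card {xs :: nat list. length xs = k \<and> (\<forall>x\<in>set xs. x > 0) \<and> prod_list xs = n}"

text \<open>
  The Meijer function with upper index \<open>(k+1, 0)\<close>, lower index \<open>(0, 2k)\<close> and parameters
  \<open>0\<close> (\<open>k\<close> times), \<open>1/2\<close>; \<open>1/2\<close> (\<open>k - 1\<close> times), as the Mellin-Barnes integral over the upward
  vertical line \<open>Re s = \<mu>\<close>, parametrised by \<open>s = \<mu> + i t\<close>. For \<open>\<mu> < 0\<close> the value does not
  depend on \<open>\<mu>\<close>. Since \<open>Gamma\<close> is \<open>0\<close> at its poles and \<open>x / 0 = 0\<close>, the quotient is the
  usual (entire) reciprocal Gamma function also where \<open>1/2 + s\<close> is a pole of Gamma.
\<close>
definition meijer_G :: "real \<Rightarrow> nat \<Rightarrow> real \<Rightarrow> complex" where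
  "meijer_G \<mu> k z =
     1 / (2 * of_real pi * \<i>) *
     (\<integral>t. (let s = Complex \<mu> t in
            Gamma (- s) ^ k * Gamma (1/2 - s) / Gamma (1/2 + s) ^ (k - 1) * of_real z powr s) * \<i>
      \<partial>lborel)"

definition Psi :: "real \<Rightarrow> real \<Rightarrow> nat \<Rightarrow> real \<Rightarrow> complex" where
  "Psi \<mu> \<rho> k x =
     of_real (pi powr (real k / 2 - 1) / 2 ^ (k - 1)) *
     (\<Sum>i. let j = Suc i in
        of_nat (piltz k j) * meijer_G \<mu> k (\<rho>\<^sup>2 * (real j)\<^sup>2 * x\<^sup>2 / 2 ^ (2 * k)))"

text \<open>The bracketed expression of the transformation formula, with \<open>a\<close> for \<open>\<alpha>\<close> or \<open>\<beta>\<close>.\<close>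
definition bracket :: "real \<Rightarrow> nat \<Rightarrow> int \<Rightarrow> real \<Rightarrow> complex" where
  "bracket \<mu> k m a =
     (\<Sum>i. let n = Suc i in
        of_nat (piltz k n) / of_nat n powi (2 * m + 1) * Psi \<mu> ((2 * a) ^ k) k (real n))
     - 1 / fact (k - 1) *
       (deriv ^^ (k - 1))
         (\<lambda>s. riemann_zeta (of_int (2 * m + 1) + s) ^ k * riemann_zeta s ^ k * Gamma (s + 1) ^ k *
              cos (of_real pi * s / 2) ^ (k - 1) * of_real (2 * a) powr (- (of_nat k * s))) 0"

end

theory Submission
  imports Defs "HOL-Probability.Sinc_Integral"
begin

text \<open>
  Both brackets are one and the same Mellin--Barnes integral, taken along two lines that are mirror
  images of each other. Let \<open>V\<^sub>c(f)\<close> be the integral of \<open>f\<close> along the upward line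
  \<open>Re w = c\<close>, divided by \<open>2\<pi>i\<close>. After the substitution \<open>w = - 2 s\<close>, the duplication and reflection
  formulas reduce the quotient of Gamma functions in the Meijer function to
  \<open>\<Gamma>(w)\<^sup>k cos(\<pi>w/2)\<^sup>k\<^sup>-\<^sup>1\<close> (\<open>meijer_G_eq_vertical_integral\<close>). For large \<open>c\<close> all sums may be
  interchanged with the integral, and they are Dirichlet series of \<open>d\<^sub>k\<close>, that is, powers of \<open>\<zeta>\<close>. So the
  series in the bracket of \<open>a\<close> is \<open>V\<^sub>c(F\<^sub>a)\<close> (\<open>series_eq_vertical_integral\<close>) for
  \<open>F\<^sub>a(w) = \<Gamma>(w)\<^sup>k cos(\<pi>w/2)\<^sup>k\<^sup>-\<^sup>1 \<zeta>(w)\<^sup>k \<zeta>(2m+1+w)\<^sup>k (2a)\<^sup>-\<^sup>k\<^sup>w\<close>.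

  The functional equation of \<open>\<zeta>\<close> turns this into
  \<open>F\<^sub>a(w) = 2\<^sup>-\<^sup>k (\<pi>/a)\<^sup>k\<^sup>w \<zeta>(1-w)\<^sup>k \<zeta>(2m+1+w)\<^sup>k / cos(\<pi>w/2)\<close>, which shows three things. \<open>F\<^sub>a\<close> decays
  exponentially along vertical lines, because \<open>\<zeta>\<close> grows polynomially there. Its only singularities are
  \<open>0\<close> and \<open>-2m\<close> and at most simple poles at the odd integers. And for \<open>\<alpha>\<beta> = \<pi>\<^sup>2\<close> the reflection
  \<open>w \<mapsto> -2m-w\<close> exchanges \<open>F\<^sub>\<alpha>\<close> and \<open>F\<^sub>\<beta>\<close> up to a constant (\<open>mellin_integrand_reflect\<close>).
  The derivative in the bracket is the residue of \<open>F\<^sub>a\<close> at \<open>0\<close>, a pole of order at most \<open>k\<close>. Now shift the line of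
  integration from \<open>c\<close> to \<open>-2m-c\<close>. The integral on the new line and the residue at \<open>-2m\<close> are, by the
  reflection, the integral and the residue at \<open>0\<close> that form the bracket of \<open>\<beta>\<close>. The residue at
  \<open>1-2j\<close> is a multiple of \<open>\<zeta>(2j)\<^sup>k \<zeta>(2m+2-2j)\<^sup>k\<close>; it vanishes unless \<open>0 \<le> j \<le> m+1\<close> and yields the
  finite sum of Bernoulli numbers.

  The rest is the theory of \<open>\<zeta>\<close> that this uses. Comparison of the series with an integral continues
  \<open>(s-1)\<zeta>(s)\<close> to \<open>Re s > 0\<close> with polynomial bounds. The Mellin transform of \<open>1/(e\<^sup>x-1)\<close>, with the first
  terms of its expansion at \<open>0\<close> removed, continues it to \<open>Re s > -1\<close>. On \<open>-1 < Re s < 0\<close> this is the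
  transform of \<open>1/(e\<^sup>x-1) - 1/x + 1/2 = \<Sum>\<^sub>n 2x/(x\<^sup>2+4\<pi>\<^sup>2n\<^sup>2)\<close>, and integration term by term is the
  functional equation, which in turn defines \<open>\<zeta>\<close> further to the left. The same partial fractions,
  expanded in powers of \<open>x\<close>, give \<open>\<zeta>(2j)\<close>. The decay of \<open>\<Gamma>\<close> comes from its product formula and
  from its exact modulus on the line \<open>Re w = 1/2\<close>.
\<close>

section \<open>Partial fractions of the exponential kernel\<close>

text \<open>
  The logarithmic derivative of Euler's reflection formula \<open>\<Gamma>(z) \<Gamma>(1 - z) = \<pi> / sin (\<pi>z)\<close>.
\<close>
lemma Digamma_reflection:
  fixes z :: complex
  assumes "z \<notin> \<int>"
  shows "Digamma (1 - z) - Digamma z = of_real pi * cot (of_real pi * z)"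
proof -
  have z: "z \<notin> \<int>\<^sub>\<le>\<^sub>0" "1 - z \<notin> \<int>\<^sub>\<le>\<^sub>0"
    using assms nonpos_Ints_subset_Ints minus_in_Ints_iff[of "1 - z"] Ints_diff[of 1 "1 - z"]
    by (auto simp: nonpos_Ints_Int)
  have s: "sin (of_real pi * z) \<noteq> 0"
    using assms by (auto simp: sin_eq_0)
  have 1: "((\<lambda>z. Gamma z * Gamma (1 - z)) has_field_derivative
      Gamma z * Gamma (1 - z) * (Digamma z - Digamma (1 - z))) (at z)"
    using z by (auto intro!: derivative_eq_intros simp: algebra_simps)
  have 2: "((\<lambda>z::complex. of_real pi / sin (of_real pi * z)) has_field_derivative
      - (of_real pi / sin (of_real pi * z) * (of_real pi * cot (of_real pi * z)))) (at z)"
    using s by (auto intro!: derivative_eq_intros simp: cot_def field_simps)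
  have "Gamma z * Gamma (1 - z) * (Digamma z - Digamma (1 - z)) =
      - (of_real pi / sin (of_real pi * z) * (of_real pi * cot (of_real pi * z)))"
    using DERIV_unique[OF 1] 2 unfolding Gamma_reflection_complex by blast
  then have "(of_real pi / sin (of_real pi * z)) * (Digamma z - Digamma (1 - z)) =
      (of_real pi / sin (of_real pi * z)) * (- (of_real pi * cot (of_real pi * z)))"
    by (simp add: Gamma_reflection_complex)
  moreover have "of_real pi / sin (of_real pi * z) \<noteq> 0" using s by simp
  ultimately have "Digamma z - Digamma (1 - z) = - (of_real pi * cot (of_real pi * z))"
    by (simp only: mult_cancel_left) simp
  then show ?thesis by (simp add: algebra_simps)
qed

text \<open>
  The partial fractions of the cotangent: insert the series of the Digamma function into its
  reflection formula. The two poles \<open>-k\<close> and \<open>k + 1\<close> that come with index \<open>k\<close> are not opposite to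
  each other; a telescoping series moves the first one to \<open>-(k + 1)\<close>.
\<close>
lemma Digamma_reflection_sums:
  fixes z :: complex
  assumes "z \<notin> \<int>"
  shows "(\<lambda>n. 2 * z / (z\<^sup>2 - of_nat (Suc n) ^ 2)) sums (of_real pi * cot (of_real pi * z) - 1 / z)"
proof -
  have z: "z \<noteq> 0" "1 - z \<noteq> 0" using assms by auto
  have ne: "z + of_nat n \<noteq> 0" "of_nat n - z \<noteq> 0" "z - of_nat n \<noteq> 0" for n
    using assms Ints_of_nat[of n] minus_in_Ints_iff[of z]
    by (metis add_eq_0_iff minus_minus Ints_minus, metis eq_iff_diff_eq_0 , metis eq_iff_diff_eq_0)
  have "(\<lambda>k. (inverse (of_nat (Suc k)) - inverse (1 - z + of_nat k)) -
        (inverse (of_nat (Suc k)) - inverse (z + of_nat k))) sums (Digamma (1 - z) - Digamma z)"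
    using sums_diff[OF summable_sums[OF summable_Digamma[OF z(2)]] summable_sums[OF summable_Digamma[OF z(1)]]]
    by (simp add: Digamma_def)
  then have 1: "(\<lambda>k. inverse (z + of_nat k) - inverse (1 - z + of_nat k)) sums
      (of_real pi * cot (of_real pi * z))"
    using Digamma_reflection[OF assms] by simp
  have 2: "(\<lambda>n. inverse (z + of_nat (Suc n)) - inverse (z + of_nat n)) sums
                       (0 - inverse (z + of_nat 0))"
    by (intro telescope_sums filterlim_compose[OF tendsto_inverse_0]
              tendsto_add_filterlim_at_infinity[OF tendsto_const] tendsto_of_nat)
  have "inverse (z + of_nat k) - inverse (1 - z + of_nat k) +
     (inverse (z + of_nat (Suc k)) - inverse (z + of_nat k)) = 2 * z / (z\<^sup>2 - of_nat (Suc k) ^ 2)" for k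
  proof -
    have "z\<^sup>2 - of_nat (Suc k) ^ 2 = (z + of_nat (Suc k)) * (z - of_nat (Suc k))"
      by (simp add: algebra_simps power2_eq_square)
    moreover have "1 - z + of_nat k = - (z - of_nat (Suc k))" by simp
    ultimately have "2 * z / (z\<^sup>2 - of_nat (Suc k) ^ 2) =
      inverse (z + of_nat (Suc k)) - inverse (1 - z + of_nat k)"
      using ne[of "Suc k"] by (simp only: inverse_minus_eq) (simp add: divide_simps del: of_nat_Suc)
    then show ?thesis by simp
  qed
  with sums_add[OF 1 2] show ?thesis
    by (simp add: inverse_eq_divide)
qed

text \<open>
  The cotangent at the purely imaginary point \<open>z = ix/2\<pi>\<close>.
\<close>
lemma exp_partial_fractions:
  fixes x :: real
  assumes "x \<noteq> 0"
  shows "(\<lambda>n. 2 * x / (x\<^sup>2 + (2 * pi * real (Suc n))\<^sup>2)) sums (1 / (exp x - 1) - 1 / x + 1 / 2)"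
proof -
  define z where "z = \<i> * of_real (x / (2 * pi))"
  have z: "z \<notin> \<int>" using assms by (auto simp: z_def elim!: Ints_cases simp: complex_eq_iff)
  have e: "exp x - 1 \<noteq> 0" using assms by simp
  have pz: "of_real pi * z = \<i> * of_real (x / 2)" by (simp add: z_def field_simps)
  have "cot (of_real pi * z) = - \<i> * of_real ((exp x + 1) / (exp x - 1))"
  proof -
    have a: "exp (\<i> * (\<i> * complex_of_real (x/2))) = of_real (exp (- x / 2))"
      by (simp flip: mult.assoc exp_of_real)
    have b: "exp (- (\<i> * (\<i> * complex_of_real (x/2)))) = of_real (exp (x / 2))"
      by (simp flip: mult.assoc exp_of_real)
    have x: "exp x = exp (x/2) * exp (x/2)" "exp (-x/2) = 1 / exp (x/2)"
      by (simp_all add: exp_minus field_simps flip: exp_add)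
    have ne: "exp (x/2) * exp (x/2) - 1 \<noteq> 0" using e x by simp
    show ?thesis
      unfolding cot_def pz sin_exp_eq cos_exp_eq a b x using ne
      by (auto simp: complex_eq_iff field_simps)
  qed
  then have 1: "of_real pi * cot (of_real pi * z) - 1 / z =
     (- \<i> * of_real (2 * pi)) * of_real (1 / (exp x - 1) - 1 / x + 1 / 2)"
    using e assms by (simp add: z_def complex_eq_iff Re_divide Im_divide)
      (simp add: divide_simps power2_eq_square, simp add: algebra_simps)
  have 2: "2 * z / (z\<^sup>2 - of_nat (Suc n) ^ 2) =
     (- \<i> * of_real (2 * pi)) * of_real (2 * x / (x\<^sup>2 + (2 * pi * real (Suc n))\<^sup>2))" for n
  proof -
    define q where "q = x\<^sup>2 + (2 * pi * real (Suc n))\<^sup>2"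
    have "q \<noteq> 0" using assms by (simp add: sum_power2_eq_zero_iff q_def)
    have w: "z\<^sup>2 - of_nat (Suc n) ^ 2 = - of_real (q / (2 * pi)\<^sup>2)"
      by (simp add: q_def z_def field_simps power_mult_distrib)
         (simp add: algebra_simps power2_eq_square power4_eq_xxxx)
    show ?thesis unfolding q_def [symmetric] w using \<open>q \<noteq> 0\<close>
      by (simp add: z_def field_simps power2_eq_square)
  qed
  have "(\<lambda>n. (- \<i> * of_real (2 * pi)) * of_real (2 * x / (x\<^sup>2 + (2 * pi * real (Suc n))\<^sup>2))) sums
     ((- \<i> * of_real (2 * pi)) * complex_of_real (1 / (exp x - 1) - 1 / x + 1 / 2))"
    using Digamma_reflection_sums[OF z] unfolding 1 2 .
  then have "(\<lambda>n. complex_of_real (2 * x / (x\<^sup>2 + (2 * pi * real (Suc n))\<^sup>2))) sums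
     complex_of_real (1 / (exp x - 1) - 1 / x + 1 / 2)" by (rule iffD1[OF sums_mult_iff, rotated]) simp
  then show ?thesis by (simp only: sums_of_real_iff)
qed

section \<open>Growth on vertical strips and the decay of the Gamma function\<close>

text \<open>
  Polynomial factors are absorbed by the exponent \<open>N\<close>, so only the exponential rate \<open>\<kappa>\<close> is
  recorded, and rates add up in products. Near the real axis nothing is required: poles may lie there.
\<close>
definition vertical_growth :: "real \<Rightarrow> real set \<Rightarrow> (complex \<Rightarrow> complex) \<Rightarrow> bool" where
  "vertical_growth \<kappa> I f \<longleftrightarrow> (\<exists>C N. \<forall>s. Re s \<in> I \<and> 1 \<le> \<bar>Im s\<bar> \<longrightarrow>
      norm (f s) \<le> C * \<bar>Im s\<bar> ^ N * exp (\<kappa> * \<bar>Im s\<bar>))"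

lemma vertical_growthI:
  assumes "\<And>s. Re s \<in> I \<Longrightarrow> 1 \<le> \<bar>Im s\<bar> \<Longrightarrow> norm (f s) \<le> C * \<bar>Im s\<bar> ^ N * exp (\<kappa> * \<bar>Im s\<bar>)"
  shows "vertical_growth \<kappa> I f"
  using assms unfolding vertical_growth_def by blast

lemma vertical_growthE:
  assumes "vertical_growth \<kappa> I f"
  obtains C N where "C \<ge> 0"
    "\<And>s. Re s \<in> I \<Longrightarrow> 1 \<le> \<bar>Im s\<bar> \<Longrightarrow> norm (f s) \<le> C * \<bar>Im s\<bar> ^ N * exp (\<kappa> * \<bar>Im s\<bar>)"
proof -
  obtain C N where CN: "\<And>s. Re s \<in> I \<Longrightarrow> 1 \<le> \<bar>Im s\<bar> \<Longrightarrow>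
      norm (f s) \<le> C * \<bar>Im s\<bar> ^ N * exp (\<kappa> * \<bar>Im s\<bar>)"
    using assms unfolding vertical_growth_def by blast
  have "norm (f s) \<le> \<bar>C\<bar> * \<bar>Im s\<bar> ^ N * exp (\<kappa> * \<bar>Im s\<bar>)"
    if "Re s \<in> I" "1 \<le> \<bar>Im s\<bar>" for s
    by (rule order.trans[OF CN[OF that]]) (intro mult_right_mono, auto)
  then show ?thesis using that[of "\<bar>C\<bar>" N] by auto
qed

lemma vertical_growth_cong:
  assumes "\<And>s. Re s \<in> I \<Longrightarrow> 1 \<le> \<bar>Im s\<bar> \<Longrightarrow> norm (f s) \<le> norm (g s)" "vertical_growth \<kappa> I g"
  shows "vertical_growth \<kappa> I f"
proof -
  from assms(2) obtain C N where g:
    "\<And>s. Re s \<in> I \<Longrightarrow> 1 \<le> \<bar>Im s\<bar> \<Longrightarrow> norm (g s) \<le> C * \<bar>Im s\<bar> ^ N * exp (\<kappa> * \<bar>Im s\<bar>)"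
    by (rule vertical_growthE) blast
  show ?thesis
    by (rule vertical_growthI) (rule order.trans[OF assms(1) g])
qed

lemma vertical_growth_mult:
  assumes "vertical_growth \<kappa> I f" "vertical_growth \<kappa>' I g"
  shows "vertical_growth (\<kappa> + \<kappa>') I (\<lambda>s. f s * g s)"
proof -
  from assms(1) obtain C N where f: "C \<ge> 0"
    "\<And>s. Re s \<in> I \<Longrightarrow> 1 \<le> \<bar>Im s\<bar> \<Longrightarrow> norm (f s) \<le> C * \<bar>Im s\<bar> ^ N * exp (\<kappa> * \<bar>Im s\<bar>)"
    by (rule vertical_growthE) blast
  from assms(2) obtain C' N' where g: "C' \<ge> 0" 
    "\<And>s. Re s \<in> I \<Longrightarrow> 1 \<le> \<bar>Im s\<bar> \<Longrightarrow> norm (g s) \<le> C' * \<bar>Im s\<bar> ^ N' * exp (\<kappa>' * \<bar>Im s\<bar>)"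
    by (rule vertical_growthE) blast
  show ?thesis
  proof (rule vertical_growthI)
    fix s assume s: "Re s \<in> I" "1 \<le> \<bar>Im s\<bar>"
    have "norm (f s * g s) \<le> (C * \<bar>Im s\<bar> ^ N * exp (\<kappa> * \<bar>Im s\<bar>)) * (C' * \<bar>Im s\<bar> ^ N' * exp (\<kappa>' * \<bar>Im s\<bar>))"
      unfolding norm_mult by (intro mult_mono f g s mult_nonneg_nonneg) (use f(1) in auto)
    also have "\<dots> = (C * C') * \<bar>Im s\<bar> ^ (N + N') * exp ((\<kappa> + \<kappa>') * \<bar>Im s\<bar>)"
      by (simp add: power_add exp_add algebra_simps)
    finally show "norm (f s * g s) \<le> \<dots>" .
  qed
qed

lemma vertical_growth_bounded:
  assumes "\<And>s. Re s \<in> I \<Longrightarrow> 1 \<le> \<bar>Im s\<bar> \<Longrightarrow> norm (f s) \<le> C"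
  shows "vertical_growth 0 I f"
  using assms by (intro vertical_growthI[of I f C 0]) auto

lemma vertical_growth_power:
  assumes "vertical_growth \<kappa> I f"
  shows "vertical_growth (of_nat n * \<kappa>) I (\<lambda>s. f s ^ n)"
proof (induction n)
  case 0
  show ?case using vertical_growth_bounded[of I "\<lambda>_. 1" 1] by simp
next
  case (Suc n)
  with vertical_growth_mult[OF assms Suc] show ?case by (simp add: algebra_simps)
qed

lemma vertical_growth_compose:
  assumes "vertical_growth \<kappa> J f" "\<And>s. Re s \<in> I \<Longrightarrow> Re (h s) \<in> J" "\<And>s. \<bar>Im (h s)\<bar> = \<bar>Im s\<bar>"
  shows "vertical_growth \<kappa> I (\<lambda>s. f (h s))"
proof -
  from assms(1) obtain C N where
    f: "\<And>s. Re s \<in> J \<Longrightarrow> 1 \<le> \<bar>Im s\<bar> \<Longrightarrow> norm (f s) \<le> C * \<bar>Im s\<bar> ^ N * exp (\<kappa> * \<bar>Im s\<bar>)"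
    by (rule vertical_growthE) blast
  show ?thesis
  proof (rule vertical_growthI)
    fix s assume s: "Re s \<in> I" "1 \<le> \<bar>Im s\<bar>"
    show "norm (f (h s)) \<le> C * \<bar>Im s\<bar> ^ N * exp (\<kappa> * \<bar>Im s\<bar>)"
      using f[OF assms(2)[OF s(1)]] s(2) unfolding assms(3) .
  qed
qed

lemma vertical_growth_powr:
  assumes "a > (0::real)"
  shows "vertical_growth 0 {x..y} (\<lambda>s. of_real a powr (of_real r * s))"
proof -
  have "norm (of_real a powr (of_real r * s)) \<le> exp (\<bar>ln a\<bar> * \<bar>r\<bar> * (\<bar>x\<bar> + \<bar>y\<bar>))"
    if "Re s \<in> {x..y}" for s
  proof -
    have "norm (of_real a powr (of_real r * s)) = exp (ln a * (r * Re s))"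
      using assms by (simp add: norm_powr_real_powr powr_def mult_ac)
    also have "ln a * (r * Re s) \<le> \<bar>ln a * (r * Re s)\<bar>" by simp
    also have "\<dots> \<le> \<bar>ln a\<bar> * \<bar>r\<bar> * (\<bar>x\<bar> + \<bar>y\<bar>)"
      using that unfolding abs_mult mult.assoc by (intro mult_left_mono) auto
    finally show ?thesis by simp
  qed
  then show ?thesis by (rule vertical_growth_bounded)
qed

lemma norm_cos_le: "norm (cos z :: complex) \<le> exp \<bar>Im z\<bar>"
proof -
  have "norm (cos z) = norm (exp (\<i> * z) + exp (- (\<i> * z))) / 2"
    by (simp add: cos_exp_eq norm_divide)
  also have "\<dots> \<le> (exp (- Im z) + exp (Im z)) / 2"
    by (intro divide_right_mono order.trans[OF norm_triangle_ineq]) auto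
  also have "\<dots> \<le> exp \<bar>Im z\<bar>" by (auto simp: abs_if)
  finally show ?thesis .
qed

lemma norm_cos_ge: 
  assumes "\<bar>Im z\<bar> \<ge> 1"
  shows "norm (cos z :: complex) \<ge> exp \<bar>Im z\<bar> / 4"
proof -
  have "exp \<bar>Im z\<bar> \<ge> 2" using exp_ge_add_one_self[of "\<bar>Im z\<bar>"] assms by linarith
  moreover have "exp (- \<bar>Im z\<bar>) \<le> 1" by simp
  ultimately have "2 * exp (- \<bar>Im z\<bar>) \<le> exp \<bar>Im z\<bar>" by linarith
  then have "exp \<bar>Im z\<bar> / 4 \<le> (exp \<bar>Im z\<bar> - exp (- \<bar>Im z\<bar>)) / 2" by (simp add: field_simps)
  also have "\<dots> = \<bar>norm (exp (\<i> * z)) - norm (exp (- (\<i> * z)))\<bar> / 2"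
    by (auto simp: abs_if)
  also have "\<dots> \<le> norm (exp (\<i> * z) + exp (- (\<i> * z))) / 2"
    using norm_triangle_ineq3[of "exp (\<i> * z)" "- exp (- (\<i> * z))"] by simp
  also have "\<dots> = norm (cos z)"
    by (simp add: cos_exp_eq norm_divide)
  finally show ?thesis .
qed

lemma vertical_growth_cos: "vertical_growth (pi / 2) I (\<lambda>s. cos (of_real pi * s / 2))"
  using norm_cos_le[of "of_real pi * s / 2" for s]
  by (intro vertical_growthI[of I _ 1 0]) (auto simp: abs_mult)

lemma vertical_growth_inverse_cos: 
  "vertical_growth (- pi / 2) I (\<lambda>s. inverse (cos (of_real pi * s / 2)))"
proof (rule vertical_growthI[of I _ 4 0])
  fix s assume "1 \<le> \<bar>Im s\<bar>"
  then have "2 * 1 \<le> pi * \<bar>Im s\<bar>" using pi_gt3 by (intro mult_mono) auto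
  then have "exp (pi / 2 * \<bar>Im s\<bar>) / 4 \<le> norm (cos (of_real pi * s / 2))"
    using norm_cos_ge[of "of_real pi * s / 2"] by (simp add: abs_mult)
  then have "inverse (norm (cos (of_real pi * s / 2))) \<le> inverse (exp (pi / 2 * \<bar>Im s\<bar>) / 4)"
    by (intro le_imp_inverse_le) auto
  also have "\<dots> = 4 * exp (- pi / 2 * \<bar>Im s\<bar>)" by (simp add: exp_minus field_simps)
  finally show "norm (inverse (cos (of_real pi * s / 2))) \<le> 4 * \<bar>Im s\<bar> ^ 0 * exp (- pi / 2 * \<bar>Im s\<bar>)"
    by (simp add: norm_inverse)
qed

text \<open>
  In Gauss's product the quotient \<open>|\<Gamma>(x + it)| / \<Gamma>(x)\<close> is the limit of
  \<open>\<Prod>\<^sub>k\<^sub>\<le>\<^sub>n (x + k) / |x + k + it|\<close>, and every factor increases with \<open>x\<close>. So a bound on one line carries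
  over to all lines left of it.
\<close>
lemma norm_Gamma_ratio_mono:
  assumes "0 < a" "a \<le> b"
  shows "norm (Gamma (Complex a t)) / Gamma a \<le> norm (Gamma (Complex b t)) / Gamma b"
proof (rule tendsto_le)
  have ratio: "norm (Gamma_series (Complex x t) n) / Gamma_series x n =
      (\<Prod>k=0..n. (x + real k) / norm (Complex (x + real k) t))" if "x > 0" for x n
  proof -
    have p: "pochhammer x (n + 1) > 0" using that by (intro pochhammer_pos)
    have "Complex x t + of_nat k = Complex (x + real k) t" for k by (simp add: complex_eq_iff)
    then have "norm (pochhammer (Complex x t) (n + 1)) = (\<Prod>k=0..n. norm (Complex (x + real k) t))"
      by (simp add: pochhammer_prod prod_norm flip: atLeastLessThanSuc_atLeastAtMost)
    moreover have "pochhammer x (n + 1) = (\<Prod>k=0..n. x + real k)"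
      by (simp add: pochhammer_prod flip: atLeastLessThanSuc_atLeastAtMost)
    ultimately show ?thesis
      using p by (simp add: Gamma_series_def norm_divide norm_mult prod_dividef)
  qed
  have *: "(\<lambda>n. norm (Gamma_series (Complex x t) n) / Gamma_series x n) 
      \<longlonglongrightarrow> norm (Gamma (Complex x t)) / Gamma x" if "x > 0" for x
    using Gamma_real_pos[OF that] by (intro tendsto_intros) auto
  show "(\<lambda>n. norm (Gamma_series (Complex a t) n) / Gamma_series a n) 
      \<longlonglongrightarrow> norm (Gamma (Complex a t)) / Gamma a"
    and "(\<lambda>n. norm (Gamma_series (Complex b t) n) / Gamma_series b n) 
      \<longlonglongrightarrow> norm (Gamma (Complex b t)) / Gamma b"
    using assms by (auto intro!: *)
  have mono: "u / norm (Complex u t) \<le> v / norm (Complex v t)" if "0 < u" "u \<le> v" for u v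
  proof -
    have "u * sqrt (v\<^sup>2 + t\<^sup>2) = sqrt (u\<^sup>2 * v\<^sup>2 + u\<^sup>2 * t\<^sup>2)"
      using that by (simp add: real_sqrt_mult flip: distrib_left)
    also have "\<dots> \<le> sqrt (u\<^sup>2 * v\<^sup>2 + v\<^sup>2 * t\<^sup>2)"
      using that by (intro real_sqrt_le_mono add_left_mono mult_right_mono power_mono) auto
    also have "\<dots> = v * sqrt (u\<^sup>2 + t\<^sup>2)"
      using that by (simp add: real_sqrt_mult mult.commute flip: distrib_right distrib_left)
    finally have "u * sqrt (v\<^sup>2 + t\<^sup>2) \<le> v * sqrt (u\<^sup>2 + t\<^sup>2)" .
    moreover have "sqrt (u\<^sup>2 + t\<^sup>2) > 0" "sqrt (v\<^sup>2 + t\<^sup>2) > 0"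
      using that by (auto intro!: add_pos_nonneg)
    ultimately show ?thesis by (simp add: cmod_def field_simps)
  qed
  show "\<forall>\<^sub>F n in sequentially. norm (Gamma_series (Complex a t) n) / Gamma_series a n
      \<le> norm (Gamma_series (Complex b t) n) / Gamma_series b n"
    using assms by (intro always_eventually allI) 
      (auto simp: ratio intro!: prod_mono mono divide_nonneg_nonneg)
qed auto

text \<open>
  On this line \<open>1 - z\<close> is the conjugate of \<open>z\<close>, so the reflection formula gives
  \<open>|\<Gamma>(z)|\<^sup>2 = \<pi> / cosh (\<pi>t)\<close>.
\<close>
lemma norm_Gamma_half: "norm (Gamma (Complex (1/2) t)) \<le> sqrt (2 * pi) * exp (- pi / 2 * \<bar>t\<bar>)"
proof -
  define z where "z = Complex (1/2) t"
  have "norm (Gamma z) ^ 2 = norm (Gamma z * Gamma (1 - z))"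
  proof -
    have "1 - z = cnj z" by (simp add: z_def complex_eq_iff)
    then have "Gamma (1 - z) = cnj (Gamma z)" by (simp only: cnj_Gamma)
    then show ?thesis by (simp add: norm_mult power2_eq_square)
  qed
  also have "\<dots> = pi / norm (sin (of_real pi * z))"
    by (simp add: Gamma_reflection_complex norm_divide)
  also have "sin (of_real pi * z) = cos (of_real pi * (\<i> * of_real t))"
  proof -
    have "of_real pi * z = of_real pi * (\<i> * of_real t) + of_real (pi / 2)"
      by (simp add: z_def complex_eq_iff)
    then show ?thesis by (simp only: sin_add) (simp add: sin_of_real cos_of_real)
  qed
  also have "norm (cos (of_real pi * (\<i> * of_real t))) = cosh (pi * t)"
  proof -
    have "cos (of_real pi * (\<i> * of_real t)) = complex_of_real (cosh (pi * t))"
    proof -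
      have "\<i> * (of_real pi * (\<i> * of_real t)) = complex_of_real (- (pi * t))"
        by (simp add: complex_eq_iff)
      then show ?thesis
        by (simp only: cos_exp_eq exp_of_real flip: of_real_minus) (simp add: cosh_def)
    qed
    then show ?thesis by (simp add: abs_of_nonneg cosh_real_pos less_imp_le)
  qed
  also have "pi / cosh (pi * t) \<le> pi / (exp (pi * \<bar>t\<bar>) / 2)"
  proof (intro divide_left_mono)
    have "exp (pi * \<bar>t\<bar>) \<le> exp (pi * t) + exp (- (pi * t))" by (auto simp: abs_if)
    then show "exp (pi * \<bar>t\<bar>) / 2 \<le> cosh (pi * t)" by (simp add: cosh_def)
  qed (auto simp: cosh_real_pos)
  also have "\<dots> = (sqrt (2 * pi) * exp (- pi / 2 * \<bar>t\<bar>)) ^ 2"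
  proof -
    have "exp (- pi / 2 * \<bar>t\<bar>) ^ 2 = exp (- (pi * \<bar>t\<bar>))" by (simp flip: exp_double)
    then show ?thesis by (simp add: power_mult_distrib exp_minus field_simps)
  qed
  finally show ?thesis unfolding z_def by (rule power2_le_imp_le) auto
qed

text \<open>
  By monotonicity it suffices to bound \<open>\<Gamma>\<close> on a line \<open>Re s = N + 1/2\<close> to the right, and there the
  recurrence relates it to the line \<open>Re s = 1/2\<close> at the cost of \<open>N\<close> linear factors.
\<close>
lemma vertical_growth_Gamma:
  assumes "0 < a"
  shows "vertical_growth (- pi / 2) {a..b} Gamma"
proof (cases "a \<le> b")
  case True
  \<comment> \<open>\<open>B = N + 1/2\<close> is a half-integer right of the strip.\<close>
  define N where "N = nat \<lceil>b\<rceil>"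
  define B where "B = 1/2 + real N"
  have B: "b \<le> B" "B > 0" by (auto simp: B_def N_def) linarith
  have "continuous_on {a..b} (Gamma :: real \<Rightarrow> real)"
    using assms by (intro continuous_on_Gamma) (auto elim!: nonpos_Ints_cases)
  then have "bounded (Gamma ` {a..b})"
    by (intro compact_imp_bounded compact_continuous_image) auto
  then obtain M where "\<forall>y\<in>Gamma ` {a..b}. norm y \<le> M"
    unfolding bounded_iff by blast
  then have M: "\<And>x. x \<in> {a..b} \<Longrightarrow> Gamma x \<le> M" by (auto dest: abs_le_D1)
  have M0: "M > 0" using M[of a] Gamma_real_pos[OF assms] True by auto
  show ?thesis
  proof (rule vertical_growthI)
    fix s assume s: "Re s \<in> {a..b}" "1 \<le> \<bar>Im s\<bar>"
    define t where "t = Im s"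
    have G: "Gamma (Re s) > 0" "Gamma B > 0" using s assms B by (auto intro: Gamma_real_pos)
    have "norm (Gamma (Complex B t)) \<le> (\<bar>t\<bar> * (real N + 2)) ^ N * (sqrt (2 * pi) * exp (- pi / 2 * \<bar>t\<bar>))"
    proof -
      have "Complex (1/2) t \<notin> \<int>\<^sub>\<le>\<^sub>0" by (auto elim!: nonpos_Ints_cases simp: complex_eq_iff)
      then have "Gamma (Complex (1/2) t + of_nat N) = pochhammer (Complex (1/2) t) N * Gamma (Complex (1/2) t)"
        by (simp add: pochhammer_Gamma Gamma_eq_zero_iff)
      moreover have "Complex (1/2) t + of_nat N = Complex B t" by (simp add: B_def complex_eq_iff)
      moreover have "norm (pochhammer (Complex (1/2) t) N) \<le> (\<bar>t\<bar> * (real N + 2)) ^ N"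
      proof -
        have "norm (Complex (1/2) t + of_nat k) \<le> \<bar>t\<bar> * (real N + 2)" if "k < N" for k
        proof -
          have "norm (Complex (1/2) t + of_nat k) \<le> (1/2 + real k) + \<bar>t\<bar>"
            using cmod_le[of "Complex (1/2) t + of_nat k"] by simp
          also have "\<dots> \<le> 1 * (real N + 1) + \<bar>t\<bar>" using that by simp
          also have "\<dots> \<le> \<bar>t\<bar> * (real N + 1) + \<bar>t\<bar>"
            using s by (intro add_right_mono mult_right_mono) (auto simp: t_def)
          finally show ?thesis by (simp add: algebra_simps)
        qed
        then have "(\<Prod>k=0..<N. norm (Complex (1/2) t + of_nat k)) \<le> (\<Prod>k=0..<N. \<bar>t\<bar> * (real N + 2))"
          by (intro prod_mono) auto
        then show ?thesis by (simp add: pochhammer_prod prod_norm)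
      qed
      ultimately show ?thesis
        using norm_Gamma_half[of t] by (simp only: norm_mult) (intro mult_mono, auto)
    qed
    then have bound: "norm (Gamma (Complex B t)) / Gamma B \<le>
        (\<bar>t\<bar> ^ N * (real N + 2) ^ N * (sqrt (2 * pi) * exp (- pi / 2 * \<bar>t\<bar>))) / Gamma B"
      unfolding power_mult_distrib using G by (intro divide_right_mono) auto
    have "norm (Gamma s) / Gamma (Re s) \<le> norm (Gamma (Complex B t)) / Gamma B"
      using norm_Gamma_ratio_mono[of "Re s" B t] s assms B by (simp add: t_def)
    then have "norm (Gamma s) \<le> Gamma (Re s) * (norm (Gamma (Complex B t)) / Gamma B)"
      using G by (simp add: field_simps)
    also have "\<dots> \<le> M * ((\<bar>t\<bar> ^ N * (real N + 2) ^ N * (sqrt (2 * pi) * exp (- pi / 2 * \<bar>t\<bar>))) / Gamma B)"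
      using M0 G M s by (intro mult_mono bound) auto
    finally have "norm (Gamma s) \<le> \<dots>" .
    then show "norm (Gamma s) \<le> (M * (real N + 2) ^ N * sqrt (2 * pi) / Gamma B) * \<bar>Im s\<bar> ^ N * exp (- pi / 2 * \<bar>Im s\<bar>)"
      by (simp add: t_def mult_ac)
  qed
qed (auto intro!: vertical_growthI)

section \<open>Integrals along vertical lines and their shift across poles\<close>

lemma power_times_exp_bounded:
  assumes "\<kappa> < (0::real)"
  obtains K where "K \<ge> 0" "\<And>u. u \<ge> 0 \<Longrightarrow> u ^ m * exp (\<kappa> * u) \<le> K"
proof (rule that[of "fact m / (- \<kappa>) ^ m"])
  fix u :: real assume u: "u \<ge> 0"
  define v where "v = - \<kappa> * u"
  have v: "v \<ge> 0" using assms u by (simp add: v_def mult_nonpos_nonneg)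
  have "v ^ m / fact m \<le> exp v"
  proof -
    have "(\<Sum>n\<in>{m}. v ^ n /\<^sub>R fact n) \<le> (\<Sum>n. v ^ n /\<^sub>R fact n)"
      using v by (intro sum_le_suminf summable_exp_generic) auto
    then show ?thesis by (simp add: exp_def field_simps)
  qed
  then have "v ^ m * exp (- v) \<le> fact m"
    by (simp add: exp_minus field_simps)
  moreover have "v ^ m * exp (- v) = (u ^ m * exp (\<kappa> * u)) * (- \<kappa>) ^ m"
    by (simp only: v_def power_mult_distrib) simp
  ultimately show "u ^ m * exp (\<kappa> * u) \<le> fact m / (- \<kappa>) ^ m"
    using assms by (simp add: pos_le_divide_eq)
qed (use assms in auto)

lemma vertical_growth_decay:
  assumes "vertical_growth \<kappa> I f" "\<kappa> < 0"
  obtains K where "K \<ge> 0" "\<And>s. Re s \<in> I \<Longrightarrow> 1 \<le> \<bar>Im s\<bar> \<Longrightarrow> norm (f s) \<le> K / (1 + Im s ^ 2)"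
proof -
  obtain C N where C: "C \<ge> 0"
    and f: "\<And>s. Re s \<in> I \<Longrightarrow> 1 \<le> \<bar>Im s\<bar> \<Longrightarrow> norm (f s) \<le> C * \<bar>Im s\<bar> ^ N * exp (\<kappa> * \<bar>Im s\<bar>)"
    using assms(1) by (rule vertical_growthE) blast
  obtain K where K: "K \<ge> 0" "\<And>u. u \<ge> 0 \<Longrightarrow> u ^ (N + 2) * exp (\<kappa> * u) \<le> K"
    using assms(2) by (rule power_times_exp_bounded[of \<kappa> "N + 2"]) blast
  show ?thesis
  proof (rule that[of "2 * C * K"])
    fix s assume s: "Re s \<in> I" "1 \<le> \<bar>Im s\<bar>"
    define u where "u = \<bar>Im s\<bar>"
    have u: "u \<ge> 1" using s by (simp add: u_def)
    then have u2: "1 + u ^ 2 \<le> 2 * u ^ 2" by (simp add: one_le_power)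
    have "norm (f s) * (1 + u ^ 2) \<le> (C * u ^ N * exp (\<kappa> * u)) * (2 * u ^ 2)"
      using f[OF s] u2 C u by (intro mult_mono) (auto simp: u_def)
    also have "\<dots> = 2 * C * (u ^ (N + 2) * exp (\<kappa> * u))" by (simp add: power_add mult_ac power2_eq_square)
    also have "\<dots> \<le> 2 * C * K" using K(2)[of u] C u by (intro mult_left_mono) auto
    finally show "norm (f s) \<le> 2 * C * K / (1 + Im s ^ 2)"
      by (simp add: u_def pos_le_divide_eq add_pos_nonneg)
  qed (use C K in auto)
qed

lemma integrable_inverse_1_plus_square_lborel:
  "integrable lborel (\<lambda>t::real. 1 / (1 + t\<^sup>2))"
  using integrable_inverse_1_plus_square
  by (simp add: set_integrable_def inverse_eq_divide add.commute)

lemma integrable_vertical_line: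
  assumes "vertical_growth \<kappa> I f" "\<kappa> < 0" "c \<in> I"
    and "continuous_on {s. Re s = c} f"
  shows "integrable lborel (\<lambda>t. f (Complex c t))"
proof -
  obtain K where K: "K \<ge> 0" "\<And>s. Re s \<in> I \<Longrightarrow> 1 \<le> \<bar>Im s\<bar> \<Longrightarrow> norm (f s) \<le> K / (1 + Im s ^ 2)"
    using assms(1,2) by (rule vertical_growth_decay) blast
  have cont: "continuous_on UNIV (\<lambda>t. f (Complex c t))"
    by (rule continuous_on_compose2[OF assms(4)]) (auto intro!: continuous_intros simp: Complex_eq)
  have "compact ((\<lambda>t. f (Complex c t)) ` {-1..1})"
    by (intro compact_continuous_image continuous_on_subset[OF cont]) auto
  then obtain B where B: "B > 0" "\<And>t. t \<in> {-1..1} \<Longrightarrow> norm (f (Complex c t)) \<le> B"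
    by (auto dest!: compact_imp_bounded simp: bounded_pos)
  show ?thesis
  proof (rule Bochner_Integration.integrable_bound)
    show "integrable lborel (\<lambda>t. (K + 2 * B) * (1 / (1 + t\<^sup>2)))"
      by (intro integrable_mult_right integrable_inverse_1_plus_square_lborel)
    show "(\<lambda>t. f (Complex c t)) \<in> borel_measurable lborel"
      using borel_measurable_continuous_onI[OF cont] by simp
    have "norm (f (Complex c t)) \<le> (K + 2 * B) / (1 + t\<^sup>2)" for t
    proof (cases "\<bar>t\<bar> \<ge> 1")
      case True
      have "norm (f (Complex c t)) \<le> K / (1 + t\<^sup>2)" using K(2)[of "Complex c t"] True assms(3) by simp
      also have "\<dots> \<le> (K + 2 * B) / (1 + t\<^sup>2)" using B by (intro divide_right_mono) auto
      finally show ?thesis .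
    next
      case False
      then have t: "t\<^sup>2 \<le> 1" by (simp add: abs_square_le_1)
      have "norm (f (Complex c t)) \<le> B" using False by (intro B(2)) auto
      also have "\<dots> \<le> (K + 2 * B) / (1 + t\<^sup>2)"
      proof -
        have "B * (1 + t\<^sup>2) \<le> B * 2" using B t by (intro mult_left_mono) auto
        then show ?thesis using K by (simp add: pos_le_divide_eq add_pos_nonneg)
      qed
      finally show ?thesis .
    qed
    then show "AE t in lborel. norm (f (Complex c t)) \<le> norm ((K + 2 * B) * (1 / (1 + t\<^sup>2)))"
      using K B by (auto simp: abs_mult)
  qed
qed

text \<open>
  This is \<open>1/(2\<pi>i)\<close> times the contour integral along the upward line, in the parametrisation
  \<open>w = c + it\<close>.
\<close>
definition vertical_integral :: "real \<Rightarrow> (complex \<Rightarrow> complex) \<Rightarrow> complex" where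
  "vertical_integral c f = 1 / (2 * of_real pi) * (\<integral>t. f (Complex c t) \<partial>lborel)"

lemma vertical_integral_tendsto:
  fixes f :: "complex \<Rightarrow> complex"
  assumes "integrable lborel (\<lambda>t. f (Complex c t))"
  shows "((\<lambda>T. integral {-T..T} (\<lambda>t. f (Complex c t))) \<longlongrightarrow> (\<integral>t. f (Complex c t) \<partial>lborel)) at_top"
proof -
  let ?g = "\<lambda>t. f (Complex c t)"
  have "((\<lambda>T. \<integral>t. indicator {-T..T} t *\<^sub>R ?g t \<partial>lborel) \<longlongrightarrow> (\<integral>t. ?g t \<partial>lborel)) at_top"
  proof (rule Bochner_Integration.integral_dominated_convergence_at_top[where w = "\<lambda>t. norm (?g t)"])
    show "AE t in lborel. ((\<lambda>T. indicator {-T..T} t *\<^sub>R ?g t) \<longlongrightarrow> ?g t) at_top"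
    proof (intro AE_I2 tendsto_eventually)
      fix t :: real
      show "\<forall>\<^sub>F T in at_top. indicator {-T..T} t *\<^sub>R ?g t = ?g t"
        using eventually_ge_at_top[of "\<bar>t\<bar>"] by eventually_elim (auto simp: indicator_def)
    qed
    show "integrable lborel (\<lambda>t. norm (?g t))" using assms by simp
    show "\<forall>\<^sub>F T in at_top. AE t in lborel. norm (indicator {-T..T} t *\<^sub>R ?g t) \<le> norm (?g t)"
      by (auto simp: indicator_def)
  qed (use assms in auto)
  moreover have "(\<integral>t. indicator {-T..T} t *\<^sub>R ?g t \<partial>lborel) = integral {-T..T} ?g" for T
  proof -
    have "set_integrable lborel {-T..T} ?g" unfolding set_integrable_def
      by (rule integrable_mult_indicator) (use assms in auto)
    from set_borel_integral_eq_integral(2)[OF this] show ?thesis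
      by (simp add: set_lebesgue_integral_def)
  qed
  ultimately show ?thesis by simp
qed

lemma contour_integral_rectpath:
  assumes "continuous_on (path_image (rectpath (Complex a (-T)) (Complex b T))) f" "T > 0"
  shows "contour_integral (rectpath (Complex a (-T)) (Complex b T)) f =
    \<i> * integral {-T..T} (\<lambda>t. f (Complex b t)) - \<i> * integral {-T..T} (\<lambda>t. f (Complex a t)) +
    (contour_integral (linepath (Complex a (-T)) (Complex b (-T))) f -
     contour_integral (linepath (Complex a T) (Complex b T)) f)"
proof -
  let ?l1 = "linepath (Complex a (-T)) (Complex b (-T))"
  let ?l2 = "linepath (Complex b (-T)) (Complex b T)"
  let ?l3 = "linepath (Complex b T) (Complex a T)"
  let ?l4 = "linepath (Complex a T) (Complex a (-T))"
  have p: "path_image (rectpath (Complex a (-T)) (Complex b T)) =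
      path_image ?l1 \<union> path_image ?l2 \<union> path_image ?l3 \<union> path_image ?l4"
    by (simp add: rectpath_def Let_def path_image_join Un_assoc)
  have ci: "f contour_integrable_on l" if "l \<in> {?l1, ?l2, ?l3, ?l4}" for l
  proof -
    have "path_image l \<subseteq> path_image (rectpath (Complex a (-T)) (Complex b T))"
      using that unfolding p by blast
    then have "continuous_on (path_image l) f" by (rule continuous_on_subset[OF assms(1)])
    then show ?thesis using that by (auto intro!: contour_integrable_continuous_linepath)
  qed
  have "contour_integral (rectpath (Complex a (-T)) (Complex b T)) f =
      contour_integral ?l1 f + contour_integral ?l2 f + contour_integral ?l3 f + contour_integral ?l4 f"
    using ci by (simp add: rectpath_def Let_def contour_integrable_join)
  also have "contour_integral ?l2 f = \<i> * integral {-T..T} (\<lambda>t. f (Complex b t))"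
    using assms(2) by (subst contour_integral_linepath_same_Re) auto
  also have "contour_integral ?l4 f = - contour_integral (linepath (Complex a (-T)) (Complex a T)) f"
    using contour_integral_reversepath[of "linepath (Complex a (-T)) (Complex a T)" f] by simp
  also have "contour_integral (linepath (Complex a (-T)) (Complex a T)) f =
      \<i> * integral {-T..T} (\<lambda>t. f (Complex a t))"
    using assms(2) by (subst contour_integral_linepath_same_Re) auto
  also have "contour_integral ?l3 f = - contour_integral (linepath (Complex a T) (Complex b T)) f"
    using contour_integral_reversepath[of "linepath (Complex a T) (Complex b T)" f] by simp
  finally show ?thesis by (simp add: algebra_simps)
qed

text \<open>
  The residue theorem on the rectangles with vertices \<open>a \<plusminus> iT\<close> and \<open>b \<plusminus> iT\<close>: the horizontal sides
  contribute \<open>O(1/T\<^sup>2)\<close>.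
\<close>
theorem vertical_integral_shift:
  assumes "a' < a" "a < b" "b < b'" "finite S" "S \<subseteq> {s. a < Re s \<and> Re s < b}"
    and holo: "f holomorphic_on {s. a' < Re s \<and> Re s < b'} - S"
    and growth: "vertical_growth \<kappa> {a..b} f" "\<kappa> < 0"
  shows "vertical_integral b f - vertical_integral a f = (\<Sum>p\<in>S. residue f p)"
proof -
  let ?U = "{s. a' < Re s \<and> Re s < b'}"
  have U: "open ?U" "connected ?U"
  proof -
    have "?U = {s. a' < Re s} \<inter> {s. Re s < b'}" by auto
    then show "open ?U" "connected ?U"
      by (auto intro!: convex_connected convex_Int convex_halfspace_Re_gt convex_halfspace_Re_lt open_Int
         open_halfspace_Re_gt open_halfspace_Re_lt)
  qed
  have cont: "continuous_on (?U - S) f" using holo by (rule holomorphic_on_imp_continuous_on)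
  have int: "integrable lborel (\<lambda>t. f (Complex c t))" if "c \<in> {a, b}" for c
    using that assms by (intro integrable_vertical_line[OF growth] continuous_on_subset[OF cont]) auto
  obtain K where K: "K \<ge> 0" "\<And>s. Re s \<in> {a..b} \<Longrightarrow> 1 \<le> \<bar>Im s\<bar> \<Longrightarrow> norm (f s) \<le> K / (1 + Im s ^ 2)"
    using growth by (rule vertical_growth_decay) blast
  define B where "B = (\<lambda>T. K / (1 + T\<^sup>2) * (b - a))"
  define H where "H = (\<lambda>T. contour_integral (linepath (Complex a T) (Complex b T)) f)"
  \<comment> \<open>All poles lie strictly inside the rectangle of height \<open>2T\<close> once \<open>T > T0\<close>.\<close>
  define T0 where "T0 = Max (insert 1 ((\<lambda>p. \<bar>Im p\<bar>) ` S))"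
  have T0: "T0 \<ge> 1" "\<And>p. p \<in> S \<Longrightarrow> \<bar>Im p\<bar> \<le> T0" using \<open>finite S\<close> by (auto simp: T0_def)
  have H: "norm (H T) \<le> B T" if "\<bar>T\<bar> > T0" for T
  proof -
    have *: "closed_segment (Complex a T) (Complex b T) \<subseteq> {s. Re s \<in> {a..b} \<and> Im s = T}"
      using assms(2) by (auto simp: closed_segment_same_Im closed_segment_eq_real_ivl)
    have "continuous_on (closed_segment (Complex a T) (Complex b T)) f"
      using * assms(1,3) T0 that by (intro continuous_on_subset[OF cont]) fastforce
    then have "norm (H T) \<le> K / (1 + T\<^sup>2) * norm (Complex b T - Complex a T)"
      unfolding H_def using * K T0 that
      by (intro contour_integral_bound_linepath contour_integrable_continuous_linepath)
         (auto intro!: add_nonneg_nonneg divide_nonneg_nonneg)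
    also have "Complex b T - Complex a T = of_real (b - a)" by (simp add: complex_eq_iff)
    finally show ?thesis using assms(2) by (simp add: B_def del: of_real_diff)
  qed
  have "(B \<longlongrightarrow> 0) at_top"
  proof -
    have "filterlim (\<lambda>T::real. 1 + T\<^sup>2) at_top at_top"
      by (intro filterlim_tendsto_add_at_top[OF tendsto_const] filterlim_pow_at_top filterlim_ident) auto
    from real_tendsto_divide_at_top[OF tendsto_const this, of K] show ?thesis
      unfolding B_def by (intro tendsto_mult_left_zero)
  qed
  have H0: "(H \<longlongrightarrow> 0) at_top" "((\<lambda>T. H (- T)) \<longlongrightarrow> 0) at_top"
  proof -
    have "\<forall>\<^sub>F T in at_top. norm (H T) \<le> B T"
      using eventually_gt_at_top[of T0] by eventually_elim (use T0 in \<open>auto intro: H\<close>)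
    then show "(H \<longlongrightarrow> 0) at_top" by (rule Lim_null_comparison) fact
    have "B (- T) = B T" for T by (simp add: B_def)
    moreover have "\<forall>\<^sub>F T in at_top. norm (H (- T)) \<le> B (- T)"
      using eventually_gt_at_top[of T0] by eventually_elim (use T0 in \<open>auto intro: H\<close>)
    ultimately have "\<forall>\<^sub>F T in at_top. norm (H (- T)) \<le> B T" by simp
    then show "((\<lambda>T. H (- T)) \<longlongrightarrow> 0) at_top" by (rule Lim_null_comparison) fact
  qed
  define R where "R = 2 * of_real pi * \<i> * (\<Sum>p\<in>S. residue f p)"
  have eq: "\<i> * integral {-T..T} (\<lambda>t. f (Complex b t)) - \<i> * integral {-T..T} (\<lambda>t. f (Complex a t)) +
      (H (- T) - H T) = R" if T: "T > T0" for T
  proof -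
    let ?r = "rectpath (Complex a (-T)) (Complex b T)"
    have in_box: "p \<in> box (Complex a (-T)) (Complex b T)" if "p \<in> S" for p
      using T0(2)[OF that] that T assms(5) by (auto simp: in_box_complex_iff)
    have sub: "path_image ?r \<subseteq> ?U - S"
    proof -
      have "path_image ?r = cbox (Complex a (-T)) (Complex b T) - box (Complex a (-T)) (Complex b T)"
        using T T0 assms(2) by (intro path_image_rectpath_cbox_minus_box) auto
      also have "\<dots> \<subseteq> ?U - S" using in_box assms(1,3) by (auto simp: in_cbox_complex_iff)
      finally show ?thesis .
    qed
    have "contour_integral ?r f = of_real (2 * pi) * \<i> * (\<Sum>p\<in>S. winding_number ?r p * residue f p)"
    proof (rule Residue_theorem[OF U \<open>finite S\<close> holo _ _ sub])
      have "winding_number ?r z = 0" if "z \<notin> ?U" for z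
        using that T T0 assms(1-3) by (intro winding_number_rectpath_outside) (auto simp: in_cbox_complex_iff)
      then show "\<forall>z. z \<notin> ?U \<longrightarrow> winding_number ?r z = 0" by blast
    qed auto
    also have "(\<Sum>p\<in>S. winding_number ?r p * residue f p) = (\<Sum>p\<in>S. residue f p)"
      using in_box by (intro sum.cong refl) (simp add: winding_number_rectpath)
    also have "of_real (2 * pi) * \<i> * (\<Sum>p\<in>S. residue f p) = R" by (simp add: R_def)
    finally show ?thesis
      using contour_integral_rectpath[OF continuous_on_subset[OF cont sub]] T T0 by (simp add: H_def)
  qed
  have "((\<lambda>T. \<i> * integral {-T..T} (\<lambda>t. f (Complex b t)) - \<i> * integral {-T..T} (\<lambda>t. f (Complex a t)) +
      (H (- T) - H T)) \<longlongrightarrow> \<i> * (\<integral>t. f (Complex b t) \<partial>lborel) - \<i> * (\<integral>t. f (Complex a t) \<partial>lborel) + (0 - 0)) at_top"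
    by (intro tendsto_intros vertical_integral_tendsto int H0) auto
  moreover have "((\<lambda>T. \<i> * integral {-T..T} (\<lambda>t. f (Complex b t)) - \<i> * integral {-T..T} (\<lambda>t. f (Complex a t)) +
      (H (- T) - H T)) \<longlongrightarrow> R) at_top"
    by (intro tendsto_eventually eventually_mono[OF eventually_gt_at_top[of T0]] eq)
  ultimately have "\<i> * (\<integral>t. f (Complex b t) \<partial>lborel) - \<i> * (\<integral>t. f (Complex a t) \<partial>lborel) + (0 - 0) = R"
    by (rule tendsto_unique[OF trivial_limit_at_top_linorder])
  then have "\<i> * ((\<integral>t. f (Complex b t) \<partial>lborel) - (\<integral>t. f (Complex a t) \<partial>lborel)) =
      \<i> * (2 * of_real pi * (\<Sum>p\<in>S. residue f p))" 
    by (simp add: R_def algebra_simps)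
  then have "(\<integral>t. f (Complex b t) \<partial>lborel) - (\<integral>t. f (Complex a t) \<partial>lborel) = 2 * of_real pi * (\<Sum>p\<in>S. residue f p)"
    by simp
  then show ?thesis
    by (simp add: vertical_integral_def field_simps flip: diff_divide_distrib)
qed

section \<open>Holomorphic dependence of an integral on a parameter\<close>

text \<open>
  Cauchy's estimate bounds the derivative of the integrand near \<open>s\<close> by a multiple of the majorant
  \<open>G\<close>; hence so are the difference quotients, and dominated convergence applies to them.
\<close>
lemma holomorphic_on_lebesgue_integral:
  fixes f :: "complex \<Rightarrow> 'a \<Rightarrow> complex"
  assumes "open A"
    and meas: "\<And>s. s \<in> A \<Longrightarrow> f s \<in> borel_measurable M"
    and holo: "\<And>x. x \<in> space M \<Longrightarrow> (\<lambda>s. f s x) holomorphic_on A"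
    and dom: "\<And>s. s \<in> A \<Longrightarrow> \<exists>r>0. \<exists>G. integrable M G \<and> cball s r \<subseteq> A \<and>
                (\<forall>y\<in>cball s r. \<forall>x\<in>space M. norm (f y x) \<le> G x)"
  shows "(\<lambda>s. \<integral>x. f s x \<partial>M) holomorphic_on A"
  unfolding holomorphic_on_open[OF \<open>open A\<close>]
proof (intro ballI exI)
  fix s assume "s \<in> A"
  from dom[OF this] obtain r G where r: "r > 0" "cball s r \<subseteq> A" and G1: "integrable M G"
    and G2: "\<forall>y\<in>cball s r. \<forall>x\<in>space M. norm (f y x) \<le> G x"
    by blast
  note G = G1 G2[rule_format]
  define B where "B = ball s (r / 2)"
  have BA: "B \<subseteq> A" "B \<subseteq> cball s r" using r by (auto simp: B_def)
  have lip: "norm (f y x - f s x) \<le> 2 / r * G x * norm (y - s)" if "y \<in> B" "x \<in> space M" for y x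
  proof (rule field_differentiable_bound[where f' = "deriv (\<lambda>s. f s x)" and S = B])
    fix w assume w: "w \<in> B"
    have sub: "cball w (r / 2) \<subseteq> cball s r"
    proof
      fix v assume "v \<in> cball w (r / 2)"
      then show "v \<in> cball s r" using w dist_triangle[of s v w] by (auto simp: B_def)
    qed
    have h: "(\<lambda>s. f s x) holomorphic_on cball w (r / 2)"
      using holo[OF that(2)] sub r by (auto intro: holomorphic_on_subset)
    have "norm ((deriv ^^ 1) (\<lambda>s. f s x) w) \<le> fact 1 * G x / (r / 2) ^ 1"
    proof (rule Cauchy_inequality)
      show "(\<lambda>s. f s x) holomorphic_on ball w (r / 2)" using h ball_subset_cball by (rule holomorphic_on_subset)
      show "continuous_on (cball w (r / 2)) (\<lambda>s. f s x)" using h by (rule holomorphic_on_imp_continuous_on)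
      show "norm (f v x) \<le> G x" if "norm (w - v) = r / 2" for v
        using that sub by (intro G(2) \<open>x \<in> space M\<close>) (auto simp: dist_norm)
    qed (use r in auto)
    then show "norm (deriv (\<lambda>s. f s x) w) \<le> 2 / r * G x" using r by (simp add: field_simps)
    have "((\<lambda>s. f s x) has_field_derivative deriv (\<lambda>s. f s x) w) (at w)"
      using w BA by (intro holomorphic_derivI[OF holo[OF that(2)] \<open>open A\<close>]) auto
    then show "((\<lambda>s. f s x) has_field_derivative deriv (\<lambda>s. f s x) w) (at w within B)"
      by (rule has_field_derivative_at_within)
  qed (use that r in \<open>auto simp: B_def\<close>)
  have "((\<lambda>y. ((\<integral>x. f y x \<partial>M) - (\<integral>x. f s x \<partial>M)) / (y - s)) \<longlongrightarrow>
        (\<integral>x. deriv (\<lambda>s. f s x) s \<partial>M)) (at s within B)"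
    unfolding tendsto_at_iff_sequentially
  proof (intro allI impI)
    fix X :: "nat \<Rightarrow> complex"
    assume X: "\<forall>i. X i \<in> B - {s}" "X \<longlonglongrightarrow> s"
    have int: "integrable M (f y)" if "y \<in> cball s r" for y
      using that r G by (intro Bochner_Integration.integrable_bound[OF G(1)] meas AE_I2) fastforce+
    have lim: "(\<lambda>i. (f (X i) x - f s x) / (X i - s)) \<longlonglongrightarrow> deriv (\<lambda>s. f s x) s" if "x \<in> space M" for x
    proof -
      have "((\<lambda>s. f s x) has_field_derivative deriv (\<lambda>s. f s x) s) (at s)"
        by (rule holomorphic_derivI[OF holo[OF that] \<open>open A\<close> \<open>s \<in> A\<close>])
      then have "((\<lambda>y. (f y x - f s x) / (y - s)) \<longlongrightarrow> deriv (\<lambda>s. f s x) s) (at s)"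
        by (simp add: has_field_derivative_iff)
      then show ?thesis using X unfolding tendsto_at_iff_sequentially by (auto simp: o_def)
    qed
    have m: "(\<lambda>x. (f (X i) x - f s x) / (X i - s)) \<in> borel_measurable M" for i
      using X(1) BA r \<open>s \<in> A\<close> meas[of "X i"] meas[of s] by (intro borel_measurable_divide borel_measurable_diff) auto
    have "(\<lambda>i. \<integral>x. (f (X i) x - f s x) / (X i - s) \<partial>M) \<longlonglongrightarrow> (\<integral>x. deriv (\<lambda>s. f s x) s \<partial>M)"
    proof (rule integral_dominated_convergence)
      show "(\<lambda>x. deriv (\<lambda>s. f s x) s) \<in> borel_measurable M"
        by (rule borel_measurable_LIMSEQ_metric[OF m lim])
      show "integrable M (\<lambda>x. 2 / r * G x)" using G(1) by simp
      show "AE x in M. norm ((f (X i) x - f s x) / (X i - s)) \<le> 2 / r * G x" for i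
        using lip[of "X i"] X(1) by (intro AE_I2) (auto simp: norm_divide field_simps)
    qed (use m lim in auto)
    moreover have "(\<integral>x. (f (X i) x - f s x) / (X i - s) \<partial>M) =
        ((\<integral>x. f (X i) x \<partial>M) - (\<integral>x. f s x \<partial>M)) / (X i - s)" for i
      using X(1) BA r by (simp add: Bochner_Integration.integral_diff int subset_iff)
    ultimately show "((\<lambda>y. ((\<integral>x. f y x \<partial>M) - (\<integral>x. f s x \<partial>M)) / (y - s)) \<circ> X) \<longlonglongrightarrow>
        (\<integral>x. deriv (\<lambda>s. f s x) s \<partial>M)"
      by (simp only: o_def)
  qed
  moreover have "at s within B = at s" using r by (intro at_within_open) (auto simp: B_def)
  ultimately show "((\<lambda>s. \<integral>x. f s x \<partial>M) has_field_derivative (\<integral>x. deriv (\<lambda>s. f s x) s \<partial>M)) (at s)"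
    by (simp add: has_field_derivative_iff)
qed

section \<open>The zeta function right of the imaginary axis\<close>

lemma norm_powr_diff_le:
  fixes a b :: real and s :: complex
  assumes "0 < a" "a \<le> b" "Re s \<ge> -1"
  shows "norm (of_real a powr (-s) - of_real b powr (-s)) \<le> norm s * a powr (- Re s - 1) * (b - a)"
proof -
  have "norm (of_real b powr (-s) - of_real a powr (-s)) \<le>
      norm s * a powr (- Re s - 1) * norm (of_real b - (of_real a :: complex))"
  proof (rule field_differentiable_bound[where S = "closed_segment (of_real a) (of_real b)"
        and f' = "\<lambda>z. - s * z powr (- s - 1)"])
    fix z :: complex assume "z \<in> closed_segment (of_real a) (of_real b)"
    then obtain x where x: "z = of_real x" "a \<le> x" "x \<le> b"
      using assms by (auto simp: closed_segment_of_real closed_segment_eq_real_ivl)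
    then have "z \<notin> \<real>\<^sub>\<le>\<^sub>0" using assms by auto
    then show "((\<lambda>z. z powr (- s)) has_field_derivative - s * z powr (- s - 1))
        (at z within closed_segment (of_real a) (of_real b))"
      by (auto intro!: derivative_eq_intros)
    have "x powr (- Re s - 1) \<le> a powr (- Re s - 1)"
      using x assms by (intro powr_mono2') auto
    then show "norm (- s * z powr (- s - 1)) \<le> norm s * a powr (- Re s - 1)"
      using x assms by (simp add: norm_mult norm_powr_real_powr mult_left_mono)
  qed auto
  also have "norm (of_real b - (of_real a :: complex)) = b - a"
    using assms by (simp flip: of_real_diff)
  finally show ?thesis by (simp add: norm_minus_commute)
qed

text \<open>
  The summands of \<open>(s - 1) (\<zeta>(s) - 1/(s - 1)) = (s - 1) \<Sum>\<^sub>n (n\<^sup>-\<^sup>s - \<integral>\<^sub>n\<^sup>n\<^sup>+\<^sup>1 x\<^sup>-\<^sup>s dx)\<close>. The factor \<open>s - 1\<close>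
  makes them entire and removes the pole of \<open>\<zeta>\<close>.
\<close>
definition zeta_reg_term :: "nat \<Rightarrow> complex \<Rightarrow> complex" where
  "zeta_reg_term n s = (s - 1) * of_nat (Suc n) powr (- s) +
     (of_nat (Suc (Suc n)) powr (1 - s) - of_nat (Suc n) powr (1 - s))"

text \<open>
  This is \<open>(s - 1) \<zeta>(s)\<close> on the half-plane \<open>Re s > 0\<close>.
\<close>
definition zeta_reg :: "complex \<Rightarrow> complex" where
  "zeta_reg s = 1 + (\<Sum>n. zeta_reg_term n s)"

text \<open>
  With \<open>N = n + 1\<close>, the term is \<open>\<phi>(1) - \<phi>(0)\<close> for \<open>\<phi>(u) = (s - 1) N\<^sup>-\<^sup>s u + (N + u)\<^sup>1\<^sup>-\<^sup>s\<close>, whose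
  derivative \<open>(s - 1) (N\<^sup>-\<^sup>s - (N + u)\<^sup>-\<^sup>s)\<close> is again a difference, which gains one more power of \<open>N\<close>.
\<close>
lemma norm_zeta_reg_term_le:
  assumes "Re s \<ge> -1"
  shows "norm (zeta_reg_term n s) \<le> norm (s - 1) * norm s * real (Suc n) powr (- Re s - 1)"
proof -
  define N :: real where "N = real (Suc n)"
  define \<phi> where "\<phi> = (\<lambda>u::complex. (s - 1) * of_real N powr (- s) * u + (of_real N + u) powr (1 - s))"
  have "norm (\<phi> 1 - \<phi> 0) \<le> norm (s - 1) * norm s * N powr (- Re s - 1) * norm (1 - (0 :: complex))"
  proof (rule field_differentiable_bound[where S = "closed_segment 0 1"
        and f' = "\<lambda>u. (s - 1) * (of_real N powr (- s) - (of_real N + u) powr (- s))"])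
    fix z :: complex assume "z \<in> closed_segment 0 1"
    then obtain x where x: "z = of_real x" "0 \<le> x" "x \<le> 1"
      using closed_segment_of_real[of 0 1] by (fastforce simp: closed_segment_eq_real_ivl)
    then have "of_real N + z \<notin> \<real>\<^sub>\<le>\<^sub>0" by (auto simp: N_def complex_nonpos_Reals_iff)
    then show "(\<phi> has_field_derivative (s - 1) * (of_real N powr (- s) - (of_real N + z) powr (- s)))
        (at z within closed_segment 0 1)"
      unfolding \<phi>_def by (auto intro!: derivative_eq_intros simp: algebra_simps)
    have "norm (of_real N powr (- s) - of_real (N + x) powr (- s)) \<le> norm s * N powr (- Re s - 1) * ((N + x) - N)"
      using assms x by (intro norm_powr_diff_le) (auto simp: N_def)
    also have "\<dots> \<le> norm s * N powr (- Re s - 1) * 1"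
      using x by (intro mult_left_mono) auto
    finally show "norm ((s - 1) * (of_real N powr (- s) - (of_real N + z) powr (- s))) \<le>
        norm (s - 1) * norm s * N powr (- Re s - 1)"
      using x by (simp add: norm_mult mult.assoc mult_left_mono)
  qed auto
  moreover have "\<phi> 1 - \<phi> 0 = zeta_reg_term n s"
    by (simp add: \<phi>_def zeta_reg_term_def N_def add_ac)
  ultimately show ?thesis by (simp add: N_def)
qed

lemma summable_Suc_powr:
  assumes "x > 1"
  shows "summable (\<lambda>n. real (Suc n) powr (- x))"
proof -
  have "summable (\<lambda>n. real n powr (- x))" using assms by (simp add: summable_real_powr_iff)
  then show ?thesis by (subst summable_Suc_iff)
qed

lemma norm_zeta_reg_term_le':
  assumes "\<delta> > 0" "Re s \<ge> \<delta>"
  shows "norm (zeta_reg_term n s) \<le> norm (s - 1) * norm s * real (Suc n) powr (- (1 + \<delta>))"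
proof -
  have "real (Suc n) powr (- Re s - 1) \<le> real (Suc n) powr (- (1 + \<delta>))"
    using assms by (intro powr_mono) auto
  then have "norm (s - 1) * norm s * real (Suc n) powr (- Re s - 1) \<le>
      norm (s - 1) * norm s * real (Suc n) powr (- (1 + \<delta>))"
    by (intro mult_left_mono) auto
  then show ?thesis using norm_zeta_reg_term_le[of s n] assms by linarith
qed

lemma summable_zeta_reg_term:
  assumes "Re s > 0"
  shows "summable (\<lambda>n. zeta_reg_term n s)"
proof (rule summable_comparison_test'[where N = 0])
  show "summable (\<lambda>n. norm (s - 1) * norm s * real (Suc n) powr (- (1 + Re s)))"
    using assms by (intro summable_mult summable_Suc_powr) auto
  show "norm (zeta_reg_term n s) \<le> norm (s - 1) * norm s * real (Suc n) powr (- (1 + Re s))" for n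
    by (rule norm_zeta_reg_term_le'[OF assms order.refl])
qed

lemma zeta_reg_bound:
  assumes "\<delta> > 0"
  obtains C where "C \<ge> 0" "\<And>s. Re s \<ge> \<delta> \<Longrightarrow> norm (zeta_reg s) \<le> 1 + norm (s - 1) * norm s * C"
proof (rule that)
  let ?C = "\<Sum>n. real (Suc n) powr (- (1 + \<delta>))"
  have sum: "summable (\<lambda>n. real (Suc n) powr (- (1 + \<delta>)))" using assms by (intro summable_Suc_powr) auto
  show "?C \<ge> 0" by (intro suminf_nonneg sum) auto
  fix s assume s: "Re s \<ge> \<delta>"
  have "norm (\<Sum>n. zeta_reg_term n s) \<le> (\<Sum>n. norm (s - 1) * norm s * real (Suc n) powr (- (1 + \<delta>)))"
    by (intro norm_suminf_le norm_zeta_reg_term_le' summable_mult sum assms s)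
  also have "\<dots> = norm (s - 1) * norm s * ?C" using sum by (rule suminf_mult)
  finally show "norm (zeta_reg s) \<le> 1 + norm (s - 1) * norm s * ?C"
    unfolding zeta_reg_def by (intro order.trans[OF norm_triangle_ineq]) simp
qed

lemma holomorphic_zeta_reg: "zeta_reg holomorphic_on {s. Re s > 0}"
proof -
  have "(\<lambda>s. \<Sum>n. zeta_reg_term n s) holomorphic_on {s. Re s > 0}"
  proof (rule holomorphic_uniform_sequence[where f = "\<lambda>N s. \<Sum>n<N. zeta_reg_term n s"])
    show "open {s. Re s > 0}" by (rule open_halfspace_Re_gt)
    show "(\<lambda>s. \<Sum>n<N. zeta_reg_term n s) holomorphic_on {s. Re s > 0}" for N
      unfolding zeta_reg_term_def by (intro holomorphic_intros) (auto simp del: of_nat_Suc)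
    fix s :: complex assume "s \<in> {s. Re s > 0}"
    then have s: "Re s > 0" by simp
    define d where "d = Re s / 2"
    have Re: "Re z \<ge> d" if "z \<in> cball s d" for z
      using that abs_Re_le_cmod[of "s - z"] by (simp add: dist_norm d_def)
    then have Re': "Re z > 0" if "z \<in> cball s d" for z
      using that s by (force simp: d_def)
    have nz: "norm z \<le> norm s + d" if "z \<in> cball s d" for z
      using that norm_triangle_ineq2[of z s] by (simp add: dist_norm norm_minus_commute)
    show "\<exists>d>0. cball s d \<subseteq> {s. Re s > 0} \<and>
        uniform_limit (cball s d) (\<lambda>N s. \<Sum>n<N. zeta_reg_term n s) (\<lambda>s. \<Sum>n. zeta_reg_term n s) sequentially"
    proof (intro exI[of _ d] conjI)
      show "uniform_limit (cball s d) (\<lambda>N s. \<Sum>n<N. zeta_reg_term n s) (\<lambda>s. \<Sum>n. zeta_reg_term n s) sequentially"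
      proof (rule Weierstrass_m_test)
        fix n z assume z: "z \<in> cball s d"
        have "norm (zeta_reg_term n z) \<le> norm (z - 1) * norm z * real (Suc n) powr (- (1 + d))"
          using Re[OF z] s by (intro norm_zeta_reg_term_le') (auto simp: d_def)
        also have "\<dots> \<le> (norm s + d + 1) * (norm s + d) * real (Suc n) powr (- (1 + d))"
          using nz[OF z] norm_triangle_ineq4[of z 1] s
          by (intro mult_right_mono mult_mono) (auto simp: d_def)
        finally show "norm (zeta_reg_term n z) \<le> (norm s + d + 1) * (norm s + d) * real (Suc n) powr (- (1 + d))" .
      next
        show "summable (\<lambda>n. (norm s + d + 1) * (norm s + d) * real (Suc n) powr (- (1 + d)))"
          using s by (intro summable_mult summable_Suc_powr) (auto simp: d_def)
      qed
    qed (use s Re' in \<open>auto simp: d_def\<close>)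
  qed
  then show ?thesis unfolding zeta_reg_def[abs_def] by (intro holomorphic_intros)
qed

text \<open>
  Where the Dirichlet series converges, the differences of powers telescope to \<open>-1\<close>.
\<close>
lemma zeta_reg_sums:
  assumes "Re s > 1"
  shows "(\<lambda>n. of_nat (Suc n) powr (- s)) sums (zeta_reg s / (s - 1))"
proof -
  have "s \<noteq> 1" using assms by auto
  have "(\<lambda>n. of_nat (Suc n) powr (1 - s)) \<longlonglongrightarrow> (0 :: complex)"
  proof (rule tendsto_norm_zero_cancel)
    have "(\<lambda>n. real (Suc n) powr (1 - Re s)) \<longlonglongrightarrow> 0"
      using assms
      by (intro tendsto_neg_powr filterlim_compose[OF filterlim_real_sequentially filterlim_Suc]) auto
    moreover have "norm (of_nat (Suc n) powr (1 - s)) = real (Suc n) powr (1 - Re s)" for n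
      by (subst norm_powr_real_powr) auto
    ultimately show "(\<lambda>n. norm (of_nat (Suc n) powr (1 - s))) \<longlonglongrightarrow> 0" by simp
  qed
  from telescope_sums[OF this]
  have "(\<lambda>n. of_nat (Suc (Suc n)) powr (1 - s) - of_nat (Suc n) powr (1 - s)) sums (- 1)" by simp
  from sums_diff[OF summable_sums[OF summable_zeta_reg_term[of s]] this] assms
  have "(\<lambda>n. (s - 1) * of_nat (Suc n) powr (- s)) sums zeta_reg s"
    by (simp add: zeta_reg_term_def zeta_reg_def add.commute)
  from sums_divide[OF this, of "s - 1"] show ?thesis using \<open>s \<noteq> 1\<close> by simp
qed

section \<open>Mellin transforms on the positive half-line\<close>

lemma has_bochner_integral_nonneg_indicator:
  fixes f :: "real \<Rightarrow> real"
  assumes "\<And>x. x \<in> A \<Longrightarrow> 0 \<le> f x" "(f has_integral I) A"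
    and "(\<lambda>x. indicator A x * f x) \<in> borel_measurable borel"
  shows "has_bochner_integral lborel (\<lambda>x. indicator A x * f x) I"
proof (rule has_bochner_integral_nn_integral)
  show "I \<ge> 0" using assms(2,1) by (rule has_integral_nonneg)
  show "(\<integral>\<^sup>+x. ennreal (indicator A x * f x) \<partial>lborel) = ennreal I"
    using nn_integral_has_integral_lebesgue[OF assms(1,2)] by simp
qed (use assms in \<open>auto simp: indicator_def\<close>)

lemma has_bochner_integral_sums_nonneg:
  fixes f :: "nat \<Rightarrow> 'a \<Rightarrow> real"
  assumes "\<And>n. has_bochner_integral M (f n) (I n)"
    and "\<And>n x. 0 \<le> f n x" "\<And>x. (\<lambda>n. f n x) sums g x" "I sums S"
  shows "has_bochner_integral M g S"
proof -
  have int: "integrable M (f n)" "integral\<^sup>L M (f n) = I n" for n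
    using assms(1)[of n] by (auto simp: has_bochner_integral_iff)
  have 1: "AE x in M. summable (\<lambda>n. norm (f n x))"
    using assms(2,3) by (auto simp: sums_iff)
  have 2: "summable (\<lambda>n. \<integral>x. norm (f n x) \<partial>M)"
    using assms(2,4) int by (simp add: sums_iff)
  have "(\<lambda>x. \<Sum>n. f n x) = g" using assms(3) by (auto simp: sums_iff)
  with integrable_suminf[OF int(1) 1 2] sums_integral[OF int(1) 1 2] int(2) assms(4)
  show ?thesis by (auto simp: has_bochner_integral_iff dest: sums_unique2)
qed

lemma has_bochner_integral_powr_exp:
  assumes "a > 0" "c > (0 :: real)"
  shows "has_bochner_integral lborel (\<lambda>x. indicator {0<..} x * (x powr (a - 1) * exp (- (c * x))))
           (Gamma a * c powr (- a))"
proof -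
  have "has_bochner_integral lborel (\<lambda>x. indicator {0..} x * (x powr (a - 1) / exp x)) (Gamma a)"
    using Gamma_integral_real[OF assms(1)] by (intro has_bochner_integral_nonneg_indicator) auto
  then have "has_bochner_integral lborel (\<lambda>x. indicator {0..} (0 + c * x) * ((0 + c * x) powr (a - 1) / exp (0 + c * x)))
      (Gamma a /\<^sub>R \<bar>c\<bar>)"
    using assms(2) by (subst (asm) lborel_has_bochner_integral_real_affine_iff[of c _ _ 0]) auto
  from has_bochner_integral_mult_right[OF this, of "c powr (1 - a)"]
  have "has_bochner_integral lborel (\<lambda>x. c powr (1 - a) * (indicator {0..} (0 + c * x) * ((0 + c * x) powr (a - 1) / exp (0 + c * x))))
      (c powr (1 - a) * (Gamma a /\<^sub>R \<bar>c\<bar>))" by simp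
  moreover have "c powr (1 - a) * (indicator {0..} (0 + c * x) * ((0 + c * x) powr (a - 1) / exp (0 + c * x))) =
      indicator {0<..} x * (x powr (a - 1) * exp (- (c * x)))" for x
  proof (cases "x > 0")
    case True
    have "c powr (1 - a) * c powr (a - 1) = 1"
      using assms(2) by (simp flip: powr_add)
    then have "c powr (1 - a) * (c * x) powr (a - 1) = x powr (a - 1)"
      using True assms(2) by (simp add: powr_mult flip: mult.assoc)
    then show ?thesis using True assms(2) by (simp add: exp_minus divide_inverse flip: mult.assoc)
  next
    case False
    then show ?thesis using assms(2) by (cases "x = 0") (auto simp: indicator_def zero_le_mult_iff)
  qed
  moreover have "c powr (1 - a) * (Gamma a /\<^sub>R \<bar>c\<bar>) = Gamma a * c powr (- a)"
  proof -
    have "c powr (1 - a) = c * c powr (- a)" using assms(2) by (simp add: powr_diff powr_minus field_simps)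
    then show ?thesis using assms(2) by simp
  qed
  ultimately show ?thesis by (simp only:)
qed

lemma has_bochner_integral_powr_0_1:
  assumes "a > (0 :: real)"
  shows "has_bochner_integral lborel (\<lambda>x. indicator {0<..1} x * x powr (a - 1)) (1 / a)"
proof -
  have "has_bochner_integral lborel (\<lambda>x. indicator {0..1} x * x powr (a - 1)) (1 powr (a - 1 + 1) / (a - 1 + 1))"
    using assms by (intro has_bochner_integral_nonneg_indicator has_integral_powr_from_0) auto
  moreover have "indicator {0..1} x * x powr (a - 1) = indicator {0<..1} x * x powr (a - 1)" for x :: real
    by (cases "x = 0") (auto simp: indicator_def)
  ultimately show ?thesis by simp
qed

lemma has_bochner_integral_powr_1_inf:
  assumes "a < (0 :: real)"
  shows "has_bochner_integral lborel (\<lambda>x. indicator {1..} x * x powr (a - 1)) (- 1 / a)"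
proof -
  have "has_bochner_integral lborel (\<lambda>x. indicator {1..} x * x powr (a - 1)) (- (1 powr (a - 1 + 1)) / (a - 1 + 1))"
    using assms by (intro has_bochner_integral_nonneg_indicator has_integral_powr_to_inf) auto
  then show ?thesis by simp
qed

text \<open>
  The substitution \<open>x = A (t / (1 - t))\<^sup>1\<^sup>/\<^sup>2\<close> maps \<open>(0, 1)\<close> onto \<open>(0, \<infinity>)\<close> and turns this into a Beta
  integral with arguments \<open>(1 \<plusminus> \<sigma>) / 2\<close>, whose value is given by the reflection formula.
\<close>
lemma has_bochner_integral_powr_quadratic:
  assumes "- 1 < \<sigma>" "\<sigma> < 1" "A > 0"
  shows "has_bochner_integral lborel (\<lambda>x. indicator {0<..} x * (2 * x powr \<sigma> / (x\<^sup>2 + A\<^sup>2)))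
           (A powr (\<sigma> - 1) * (pi / cos (pi * \<sigma> / 2)))"
proof -
  define f where "f = (\<lambda>x. 2 * x powr \<sigma> / (x\<^sup>2 + A\<^sup>2))"
  define g where "g = (\<lambda>t. A * (t / (1 - t)) powr (1/2))"
  define g' where "g' = (\<lambda>t. A * ((1/2) * (t / (1 - t)) powr (- 1/2) * (1 / (1 - t)\<^sup>2)))"
  define p where "p = (\<lambda>t::real. t powr ((1 + \<sigma>) / 2 - 1) * (1 - t) powr ((1 - \<sigma>) / 2 - 1))"
  define B where "B = Beta ((1 + \<sigma>) / 2) ((1 - \<sigma>) / 2)"
  let ?S = "{0<..<1::real}"
  have "(p has_integral B) {0..1}"
    unfolding p_def B_def using assms by (intro has_integral_Beta_real) auto
  then have "(p has_integral B) ?S"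
    using has_integral_open_interval[of p B 0 1] by simp
  then have p: "((\<lambda>t. A powr (\<sigma> - 1) * p t) has_integral (A powr (\<sigma> - 1) * B)) ?S"
    by (rule has_integral_mult_right)
  have eq: "\<bar>g' t\<bar> * f (g t) = A powr (\<sigma> - 1) * p t" if t: "t \<in> ?S" for t
  proof -
    define v where "v = t / (1 - t)"
    have v: "v > 0" using t by (simp add: v_def)
    have "(A * v powr (1/2))\<^sup>2 + A\<^sup>2 = A\<^sup>2 / (1 - t)"
    proof -
      have "(v powr (1/2))\<^sup>2 = v" using v by (simp add: power2_eq_square flip: powr_add)
      moreover have "v + 1 = 1 / (1 - t)" using t by (simp add: v_def field_simps)
      moreover have "A\<^sup>2 * v + A\<^sup>2 = A\<^sup>2 * (v + 1)" by (simp add: distrib_left)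
      ultimately show ?thesis by (simp add: power_mult_distrib)
    qed
    then have "f (g t) = 2 * (A powr \<sigma> * v powr (\<sigma> / 2)) * ((1 - t) / A\<^sup>2)"
      using assms v by (simp add: f_def g_def powr_mult powr_powr flip: v_def)
    moreover have "\<bar>g' t\<bar> = A * (1/2 * v powr (- 1/2) * (1 / (1 - t)\<^sup>2))"
      using assms by (simp add: g'_def abs_mult flip: v_def)
    moreover have "(A * (1/2 * Q * (1 / r\<^sup>2))) * (2 * (X * P) * (r / A\<^sup>2)) = (X / A) * (P * Q) / r"
      if "r \<noteq> 0" for P Q X r :: real
      using that assms by (simp add: field_simps power2_eq_square)
    ultimately have "\<bar>g' t\<bar> * f (g t) = (A powr \<sigma> / A) * (v powr (\<sigma> / 2) * v powr (- 1/2)) / (1 - t)"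
      using t by (simp only:) simp
    also have "A powr \<sigma> / A = A powr (\<sigma> - 1)" using assms by (simp add: powr_diff)
    also have "v powr (\<sigma> / 2) * v powr (- 1/2) = v powr ((1 + \<sigma>) / 2 - 1)"
    proof -
      have "\<sigma> / 2 + - 1/2 = (1 + \<sigma>) / 2 - 1" by (simp add: field_simps)
      then show ?thesis by (simp only: powr_add[symmetric])
    qed
    also have "\<dots> = t powr ((1 + \<sigma>) / 2 - 1) / (1 - t) powr ((1 + \<sigma>) / 2 - 1)"
      using t by (simp add: v_def powr_divide)
    also have "A powr (\<sigma> - 1) * \<dots> / (1 - t) = A powr (\<sigma> - 1) * p t"
    proof -
      have "(1 - t) powr ((1 + \<sigma>) / 2 - 1) * (1 - t) powr 1 = (1 - t) powr ((1 + \<sigma>) / 2)"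
        unfolding powr_add[symmetric] by (rule arg_cong2[where f = "(powr)"]) (simp_all add: field_simps)
      then have "(1 - t) powr ((1 + \<sigma>) / 2 - 1) * (1 - t) = (1 - t) powr ((1 + \<sigma>) / 2)"
        using t by simp
      moreover have "(1 - \<sigma>) / 2 - 1 = - ((1 + \<sigma>) / 2)" by (simp add: field_simps)
      ultimately show ?thesis using t
        by (simp only: p_def powr_minus) (simp add: field_simps)
    qed
    finally show ?thesis .
  qed
  have "(\<lambda>t. \<bar>g' t\<bar> * f (g t)) absolutely_integrable_on ?S \<and>
      integral ?S (\<lambda>t. \<bar>g' t\<bar> * f (g t)) = A powr (\<sigma> - 1) * B"
  proof
    have h: "((\<lambda>t. \<bar>g' t\<bar> * f (g t)) has_integral (A powr (\<sigma> - 1) * B)) ?S"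
      using p by (rule has_integral_eq[rotated]) (simp add: eq)
    then show "integral ?S (\<lambda>t. \<bar>g' t\<bar> * f (g t)) = A powr (\<sigma> - 1) * B" by (rule integral_unique)
    show "(\<lambda>t. \<bar>g' t\<bar> * f (g t)) absolutely_integrable_on ?S"
    proof (rule nonnegative_absolutely_integrable_1)
      show "(\<lambda>t. \<bar>g' t\<bar> * f (g t)) integrable_on ?S" using h by (rule has_integral_integrable)
    qed (auto simp: f_def)
  qed
  then have *: "f absolutely_integrable_on (g ` ?S) \<and> integral (g ` ?S) f = A powr (\<sigma> - 1) * B"
  proof (rule iffD1[OF has_absolute_integral_change_of_variables_1', rotated -1])
    show "inj_on g ?S"
    proof (rule inj_onI)
      fix s t assume st: "s \<in> ?S" "t \<in> ?S" "g s = g t"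
      then have "(s / (1 - s)) powr (1/2) = (t / (1 - t)) powr (1/2)" using assms by (simp add: g_def)
      then have "((s / (1 - s)) powr (1/2)) powr 2 = ((t / (1 - t)) powr (1/2)) powr 2" by simp
      then have "s / (1 - s) = t / (1 - t)" using st by (simp add: powr_powr del: powr_numeral)
      then show "s = t" using st by (simp add: field_simps)
    qed
    show "(g has_field_derivative g' t) (at t within ?S)" if "t \<in> ?S" for t
      unfolding g_def g'_def using that
      by (auto intro!: derivative_eq_intros simp: field_simps power2_eq_square)
  qed simp
  have img: "g ` ?S = {0<..}"
  proof
    show "g ` ?S \<subseteq> {0<..}" using assms by (auto simp: g_def)
    show "{0<..} \<subseteq> g ` ?S"
    proof
      fix x :: real assume "x \<in> {0<..}"
      then have x: "x > 0" by simp
      define v where "v = (x / A)\<^sup>2"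
      have v: "v > 0" using x assms by (simp add: v_def)
      have "v / (1 + v) / (1 - v / (1 + v)) = v" using v by (simp add: field_simps)
      then have "g (v / (1 + v)) = A * v powr (1/2)" by (simp add: g_def)
      also have "v powr (1/2) = x / A" using x assms by (simp add: v_def powr_half_sqrt)
      finally have "x = g (v / (1 + v))" using assms by simp
      moreover have "v / (1 + v) \<in> ?S" using v by (simp add: field_simps)
      ultimately show "x \<in> g ` ?S" by blast
    qed
  qed
  have "(f has_integral (A powr (\<sigma> - 1) * B)) {0<..}"
    using * unfolding img by (auto simp: absolutely_integrable_on_def has_integral_iff)
  then have "has_bochner_integral lborel (\<lambda>x. indicator {0<..} x * f x) (A powr (\<sigma> - 1) * B)"
    by (intro has_bochner_integral_nonneg_indicator) (auto simp: f_def)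
  moreover have "B = pi / cos (pi * \<sigma> / 2)"
  proof -
    have "complex_of_real B = Gamma (of_real ((1 + \<sigma>) / 2)) * Gamma (1 - of_real ((1 + \<sigma>) / 2))"
    proof -
      have 1: "1 - complex_of_real ((1 + \<sigma>) / 2) = of_real ((1 - \<sigma>) / 2)" by (simp add: field_simps)
      have 2: "(1 + \<sigma>) / 2 + (1 - \<sigma>) / 2 = 1" by (simp add: field_simps)
      show ?thesis unfolding 1 Gamma_complex_of_real B_def Beta_def 2 by simp
    qed
    also have "\<dots> = of_real (pi / sin (pi * ((1 + \<sigma>) / 2)))"
      by (subst Gamma_reflection_complex) (simp only: of_real_divide sin_of_real[symmetric] of_real_mult)
    finally have "B = pi / sin (pi * ((1 + \<sigma>) / 2))" by (simp only: of_real_eq_iff)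
    also have "sin (pi * ((1 + \<sigma>) / 2)) = cos (pi * \<sigma> / 2)"
    proof -
      have "pi * ((1 + \<sigma>) / 2) = pi / 2 + pi * \<sigma> / 2" by (simp add: field_simps)
      then show ?thesis by (simp only: sin_add) simp
    qed
    finally show ?thesis .
  qed
  ultimately show ?thesis by (simp add: f_def)
qed

section \<open>The Mellin transform that continues the zeta function\<close>

text \<open>
  The summands of the partial fractions lie between \<open>0\<close> and \<open>2x / (2\<pi>n)\<^sup>2\<close>, and
  \<open>\<Sum>\<^sub>n n\<^sup>-\<^sup>2 = \<pi>\<^sup>2/6\<close>.
\<close>
lemma exp_partial_fractions_bounds:
  fixes x :: real
  assumes "x > 0"
  shows "0 \<le> 1 / (exp x - 1) - 1 / x + 1 / 2" "1 / (exp x - 1) - 1 / x + 1 / 2 \<le> x / 12"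
proof -
  have s: "(\<lambda>n. 2 * x / (x\<^sup>2 + (2 * pi * real (Suc n))\<^sup>2)) sums (1 / (exp x - 1) - 1 / x + 1 / 2)"
    using assms by (intro exp_partial_fractions) auto
  show "0 \<le> 1 / (exp x - 1) - 1 / x + 1 / 2"
    by (rule sums_le[OF _ sums_zero s]) (use assms in auto)
  have "(\<lambda>n. x / (2 * pi\<^sup>2) * (1 / (real (Suc n))\<^sup>2)) sums (x / (2 * pi\<^sup>2) * (pi\<^sup>2 / 6))"
    using inverse_squares_sums by (intro sums_mult) (simp add: add.commute)
  also have "x / (2 * pi\<^sup>2) * (pi\<^sup>2 / 6) = x / 12" by simp
  finally have t: "(\<lambda>n. x / (2 * pi\<^sup>2) * (1 / (real (Suc n))\<^sup>2)) sums (x / 12)" .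
  show "1 / (exp x - 1) - 1 / x + 1 / 2 \<le> x / 12"
  proof (rule sums_le[OF _ s t])
    fix n
    have "2 * x / (x\<^sup>2 + (2 * pi * real (Suc n))\<^sup>2) \<le> 2 * x / (2 * pi * real (Suc n))\<^sup>2"
      using assms by (intro divide_left_mono mult_pos_pos add_nonneg_pos) auto
    also have "\<dots> = x / (2 * pi\<^sup>2) * (1 / (real (Suc n))\<^sup>2)"
      by (simp add: power_mult_distrib field_simps del: of_nat_Suc)
    finally show "2 * x / (x\<^sup>2 + (2 * pi * real (Suc n))\<^sup>2) \<le> x / (2 * pi\<^sup>2) * (1 / (real (Suc n))\<^sup>2)" .
  qed
qed

text \<open>
  The terms \<open>1/x - 1/2\<close> of the expansion of \<open>1/(e\<^sup>x - 1)\<close> at \<open>0\<close> are removed on \<open>(0, 1]\<close> only, so that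
  the kernel is \<open>O(x)\<close> at \<open>0\<close> and still decays exponentially at \<open>\<infinity>\<close>. Its Mellin transform therefore exists
  on the whole half-plane \<open>Re s > -1\<close>.
\<close>
definition zeta_kernel :: "real \<Rightarrow> real" where
  "zeta_kernel x = 1 / (exp x - 1) - (if x \<le> 1 then 1 / x - 1 / 2 else 0)"

lemma zeta_kernel_measurable [measurable]: "zeta_kernel \<in> borel_measurable borel"
  unfolding zeta_kernel_def[abs_def] by measurable

lemma abs_zeta_kernel_le:
  assumes "x > 0"
  shows "\<bar>zeta_kernel x\<bar> \<le> indicator {0<..1} x * x + 2 * exp (- x)"
proof (cases "x \<le> 1")
  case True
  then have "\<bar>zeta_kernel x\<bar> \<le> x / 12"
    using exp_partial_fractions_bounds[OF assms] by (simp add: zeta_kernel_def)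
  also have "\<dots> \<le> indicator {0<..1} x * x + 2 * exp (- x)"
    using assms True by (simp add: add_increasing2)
  finally show ?thesis .
next
  case False
  have "exp x \<ge> 2" using exp_ge_add_one_self[of x] False by linarith
  then have "\<bar>zeta_kernel x\<bar> \<le> 2 * exp (- x)"
    using False by (simp add: zeta_kernel_def exp_minus field_simps)
  then show ?thesis using False by simp
qed

definition zeta_mellin :: "complex \<Rightarrow> complex" where
  "zeta_mellin s = (\<integral>x. indicator {0<..} x *\<^sub>R
     (of_real (zeta_kernel x) * exp ((s - 1) * of_real (ln x))) \<partial>lborel)"

lemma holomorphic_zeta_mellin: "zeta_mellin holomorphic_on {s. Re s > - 1}"
  unfolding zeta_mellin_def[abs_def]
proof (rule holomorphic_on_lebesgue_integral)
  show "open {s. Re s > - 1}" by (rule open_halfspace_Re_gt)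
  show "(\<lambda>s. indicator {0<..} x *\<^sub>R (complex_of_real (zeta_kernel x) * exp ((s - 1) * of_real (ln x))))
      holomorphic_on {s. Re s > - 1}" for x
    by (intro holomorphic_intros)
  fix s assume "s \<in> {s. Re s > - 1}"
  then have s: "Re s > - 1" by simp
  show "(\<lambda>x. indicator {0<..} x *\<^sub>R (complex_of_real (zeta_kernel x) * exp ((s - 1) * of_real (ln x))))
      \<in> borel_measurable lborel" by measurable
  define r where "r = (Re s + 1) / 2"
  define lo hi where "lo = Re s - r" and "hi = Re s + r + 2"
  have r: "r > 0" "lo > - 1" "hi > 1" using s by (auto simp: r_def lo_def hi_def field_simps)
  define G where "G = (\<lambda>x. 3 * (indicator {0<..1} x * x powr (lo + 1 - 1)) + 
      2 * (indicator {0<..} x * (x powr (hi - 1) * exp (- (1 * x)))))"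
  show "\<exists>r>0. \<exists>G. integrable lborel G \<and> cball s r \<subseteq> {s. Re s > - 1} \<and>
      (\<forall>y\<in>cball s r. \<forall>x\<in>space lborel. norm (indicator {0<..} x *\<^sub>R
         (complex_of_real (zeta_kernel x) * exp ((y - 1) * of_real (ln x)))) \<le> G x)"
  proof (intro exI conjI ballI)
    show "r > 0" by fact
    show "integrable lborel G" unfolding G_def
      using has_bochner_integral_powr_exp[of hi 1] has_bochner_integral_powr_0_1[of "lo + 1"] r
      by (intro Bochner_Integration.integrable_add integrable_mult_right)
         (auto simp: has_bochner_integral_iff)
    have Re: "lo \<le> Re y \<and> Re y \<le> hi - 2" if "y \<in> cball s r" for y
      using that abs_Re_le_cmod[of "s - y"] by (auto simp: dist_norm lo_def hi_def abs_le_iff)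
    then show "cball s r \<subseteq> {s. Re s > - 1}" using r by fastforce
    fix y x assume y: "y \<in> cball s r"
    show "norm (indicator {0<..} x *\<^sub>R (complex_of_real (zeta_kernel x) * exp ((y - 1) * of_real (ln x)))) \<le> G x"
    proof (cases "x > 0")
      case x: True
      have "norm (indicator {0<..} x *\<^sub>R (complex_of_real (zeta_kernel x) * exp ((y - 1) * of_real (ln x)))) =
          \<bar>zeta_kernel x\<bar> * x powr (Re y - 1)"
        using x by (simp add: norm_mult powr_def)
      also have "\<dots> \<le> G x"
      proof (cases "x \<le> 1")
        case True
        have "\<bar>zeta_kernel x\<bar> \<le> x / 12"
          using exp_partial_fractions_bounds[OF x] True by (simp add: zeta_kernel_def)
        then have "\<bar>zeta_kernel x\<bar> * x powr (Re y - 1) \<le> (3 * x) * x powr (lo - 1)"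
          using x True Re[OF y] by (intro mult_mono powr_mono') auto
        also have "\<dots> = 3 * x powr lo" using x by (simp add: powr_diff)
        also have "\<dots> \<le> G x" using x True by (simp add: G_def)
        finally show ?thesis .
      next
        case False
        then have "\<bar>zeta_kernel x\<bar> * x powr (Re y - 1) \<le> (2 * exp (- x)) * x powr (hi - 1)"
          using abs_zeta_kernel_le[OF x] x Re[OF y] by (intro mult_mono powr_mono) auto
        also have "\<dots> = G x" using False x by (simp add: G_def)
        finally show ?thesis .
      qed
      finally show ?thesis .
    qed (simp add: G_def)
  qed
qed

lemma zeta_mellin_of_real:
  assumes "has_bochner_integral lborel (\<lambda>x. indicator {0<..} x * (zeta_kernel x * x powr (\<sigma> - 1))) I"
  shows "zeta_mellin (of_real \<sigma>) = of_real I"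
proof -
  have "has_bochner_integral lborel
      (\<lambda>x. complex_of_real (indicator {0<..} x * (zeta_kernel x * x powr (\<sigma> - 1)))) (of_real I)"
    using assms by (rule has_bochner_integral_of_real)
  also have "(\<lambda>x. complex_of_real (indicator {0<..} x * (zeta_kernel x * x powr (\<sigma> - 1)))) =
      (\<lambda>x. indicator {0<..} x *\<^sub>R (of_real (zeta_kernel x) * exp ((of_real \<sigma> - 1) * of_real (ln x))))"
  proof
    fix x :: real
    have "exp ((of_real \<sigma> - 1) * of_real (ln x)) = complex_of_real (x powr (\<sigma> - 1))" if "x > 0"
      using that by (simp add: powr_def exp_of_real[symmetric])
    then show "complex_of_real (indicator {0<..} x * (zeta_kernel x * x powr (\<sigma> - 1))) =
      indicator {0<..} x *\<^sub>R (of_real (zeta_kernel x) * exp ((of_real \<sigma> - 1) * of_real (ln x)))"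
      by (simp add: indicator_def)
  qed
  finally show ?thesis
    unfolding zeta_mellin_def by (rule has_bochner_integral_integral_eq)
qed

text \<open>
  The classical formula \<open>\<Gamma>(\<sigma>) \<zeta>(\<sigma>) = \<integral> x\<^sup>\<sigma>\<^sup>-\<^sup>1 / (e\<^sup>x - 1) dx\<close>, by expanding the integrand in a geometric
  series; the two rational terms are the integral of the part that the kernel lacks on \<open>(0, 1]\<close>.
\<close>
lemma zeta_mellin_right:
  assumes "\<sigma> > 1" "(\<lambda>n. real (Suc n) powr (- \<sigma>)) sums Z"
  shows "zeta_mellin (of_real \<sigma>) = of_real (Gamma \<sigma> * Z - 1 / (\<sigma> - 1) + 1 / (2 * \<sigma>))"
proof (rule zeta_mellin_of_real)
  have 1: "has_bochner_integral lborel (\<lambda>x. indicator {0<..} x * (x powr (\<sigma> - 1) * (1 / (exp x - 1)))) (Gamma \<sigma> * Z)"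
  proof (rule has_bochner_integral_sums_nonneg)
    show "has_bochner_integral lborel (\<lambda>x. indicator {0<..} x * (x powr (\<sigma> - 1) * exp (- (real (Suc n) * x))))
        (Gamma \<sigma> * real (Suc n) powr (- \<sigma>))" for n
      using assms by (intro has_bochner_integral_powr_exp) auto
    show "(\<lambda>n. Gamma \<sigma> * real (Suc n) powr (- \<sigma>)) sums (Gamma \<sigma> * Z)"
      using assms(2) by (rule sums_mult)
    fix x :: real
    show "(\<lambda>n. indicator {0<..} x * (x powr (\<sigma> - 1) * exp (- (real (Suc n) * x)))) sums
        (indicator {0<..} x * (x powr (\<sigma> - 1) * (1 / (exp x - 1))))"
    proof (cases "x > 0")
      case True
      have "(\<lambda>n. exp (- x) * exp (- x) ^ n) sums (exp (- x) * (1 / (1 - exp (- x))))"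
        using True by (intro sums_mult geometric_sums) auto
      moreover have "exp (- x) * exp (- x) ^ n = exp (- (real (Suc n) * x))" for n
        by (simp add: algebra_simps flip: exp_of_nat_mult exp_add)
      moreover have "exp (- x) * (1 / (1 - exp (- x))) = 1 / (exp x - 1)"
        using True by (simp add: exp_minus field_simps)
      ultimately have "(\<lambda>n. exp (- (real (Suc n) * x))) sums (1 / (exp x - 1))" by simp
      then show ?thesis by (intro sums_mult)
    qed simp
  qed (auto simp: indicator_def)
  have 2: "has_bochner_integral lborel (\<lambda>x. indicator {0<..1} x * x powr (\<sigma> - 1 - 1)) (1 / (\<sigma> - 1))"
    using assms by (intro has_bochner_integral_powr_0_1) auto
  have 3: "has_bochner_integral lborel (\<lambda>x. 1 / 2 * (indicator {0<..1} x * x powr (\<sigma> - 1))) (1 / 2 * (1 / \<sigma>))"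
    using assms by (intro has_bochner_integral_mult_right has_bochner_integral_powr_0_1) auto
  have "has_bochner_integral lborel (\<lambda>x. indicator {0<..} x * (x powr (\<sigma> - 1) * (1 / (exp x - 1))) -
      indicator {0<..1} x * x powr (\<sigma> - 1 - 1) + 1 / 2 * (indicator {0<..1} x * x powr (\<sigma> - 1)))
      (Gamma \<sigma> * Z - 1 / (\<sigma> - 1) + 1 / 2 * (1 / \<sigma>))"
    by (intro has_bochner_integral_add has_bochner_integral_diff 1 2 3)
  also have "(\<lambda>x. indicator {0<..} x * (x powr (\<sigma> - 1) * (1 / (exp x - 1))) -
      indicator {0<..1} x * x powr (\<sigma> - 1 - 1) + 1 / 2 * (indicator {0<..1} x * x powr (\<sigma> - 1))) =
      (\<lambda>x. indicator {0<..} x * (zeta_kernel x * x powr (\<sigma> - 1)))"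
  proof
    fix x :: real
    have "x powr (\<sigma> - 1 - 1) = x powr (\<sigma> - 1) / x" if "x > 0" using that by (subst powr_diff) simp
    then show "indicator {0<..} x * (x powr (\<sigma> - 1) * (1 / (exp x - 1))) -
      indicator {0<..1} x * x powr (\<sigma> - 1 - 1) + 1 / 2 * (indicator {0<..1} x * x powr (\<sigma> - 1)) =
      indicator {0<..} x * (zeta_kernel x * x powr (\<sigma> - 1))"
      by (simp add: indicator_def zeta_kernel_def algebra_simps)
  qed
  finally show "has_bochner_integral lborel (\<lambda>x. indicator {0<..} x * (zeta_kernel x * x powr (\<sigma> - 1)))
      (Gamma \<sigma> * Z - 1 / (\<sigma> - 1) + 1 / (2 * \<sigma>))" by simp
qed

text \<open>
  Left of the imaginary axis the removed terms \<open>1/x - 1/2\<close> have a convergent Mellin integral over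
  \<open>[1, \<infinity>)\<close>, and the same two rational terms arise as for \<open>\<sigma> > 1\<close>. What remains is the transform of
  \<open>1/(e\<^sup>x - 1) - 1/x + 1/2\<close>, which is integrated term by term in its partial fractions.
\<close>
lemma zeta_mellin_strip:
  assumes "- 1 < \<sigma>" "\<sigma> < 0" "(\<lambda>n. real (Suc n) powr (\<sigma> - 1)) sums Z"
  shows "zeta_mellin (of_real \<sigma>) =
    of_real ((2 * pi) powr (\<sigma> - 1) * (pi / cos (pi * \<sigma> / 2)) * Z - 1 / (\<sigma> - 1) + 1 / (2 * \<sigma>))"
proof (rule zeta_mellin_of_real)
  define h where "h = (\<lambda>x::real. 1 / (exp x - 1) - 1 / x + 1 / 2)"
  let ?c = "(2 * pi) powr (\<sigma> - 1) * (pi / cos (pi * \<sigma> / 2))"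
  have 1: "has_bochner_integral lborel (\<lambda>x. indicator {0<..} x * (x powr (\<sigma> - 1) * h x)) (?c * Z)"
  proof (rule has_bochner_integral_sums_nonneg)
    show "has_bochner_integral lborel
        (\<lambda>x. indicator {0<..} x * (2 * x powr \<sigma> / (x\<^sup>2 + (2 * pi * real (Suc n))\<^sup>2)))
        (?c * real (Suc n) powr (\<sigma> - 1))" for n
      using has_bochner_integral_powr_quadratic[of \<sigma> "2 * pi * real (Suc n)"] assms
      by (simp add: powr_mult mult_ac del: of_nat_Suc)
    show "(\<lambda>n. ?c * real (Suc n) powr (\<sigma> - 1)) sums (?c * Z)"
      using assms(3) by (rule sums_mult)
    fix x :: real
    show "(\<lambda>n. indicator {0<..} x * (2 * x powr \<sigma> / (x\<^sup>2 + (2 * pi * real (Suc n))\<^sup>2))) sums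
        (indicator {0<..} x * (x powr (\<sigma> - 1) * h x))"
    proof (cases "x > 0")
      case True
      have "(\<lambda>n. x powr (\<sigma> - 1) * (2 * x / (x\<^sup>2 + (2 * pi * real (Suc n))\<^sup>2))) sums (x powr (\<sigma> - 1) * h x)"
        unfolding h_def using True by (intro sums_mult exp_partial_fractions) auto
      moreover have "x powr (\<sigma> - 1) * (2 * x / y) = 2 * x powr \<sigma> / y" for y
        using True by (simp add: powr_diff)
      ultimately have "(\<lambda>n. 2 * x powr \<sigma> / (x\<^sup>2 + (2 * pi * real (Suc n))\<^sup>2)) sums (x powr (\<sigma> - 1) * h x)"
        by (simp only:)
      then show ?thesis by (intro sums_mult)
    qed simp
  qed (auto simp: indicator_def)
  have 2: "has_bochner_integral lborel (\<lambda>x. indicator {1..} x * x powr (\<sigma> - 1 - 1)) (- 1 / (\<sigma> - 1))"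
    using assms by (intro has_bochner_integral_powr_1_inf) auto
  have 3: "has_bochner_integral lborel (\<lambda>x. 1 / 2 * (indicator {1..} x * x powr (\<sigma> - 1))) (1 / 2 * (- 1 / \<sigma>))"
    using assms by (intro has_bochner_integral_mult_right has_bochner_integral_powr_1_inf) auto
  have "has_bochner_integral lborel (\<lambda>x. indicator {0<..} x * (x powr (\<sigma> - 1) * h x) +
      indicator {1..} x * x powr (\<sigma> - 1 - 1) - 1 / 2 * (indicator {1..} x * x powr (\<sigma> - 1)))
      (?c * Z + (- 1 / (\<sigma> - 1)) - 1 / 2 * (- 1 / \<sigma>))"
    by (intro has_bochner_integral_add has_bochner_integral_diff 1 2 3)
  also have "?this \<longleftrightarrow> has_bochner_integral lborel (\<lambda>x. indicator {0<..} x * (zeta_kernel x * x powr (\<sigma> - 1)))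
      (?c * Z + (- 1 / (\<sigma> - 1)) - 1 / 2 * (- 1 / \<sigma>))"
  proof (rule has_bochner_integral_cong_AE)
    \<comment> \<open>At \<open>x = 1\<close> the cut-offs \<open>(0, 1]\<close> of the kernel and \<open>[1, \<infinity>)\<close> of the correction overlap.\<close>
    show "AE x in lborel. indicator {0<..} x * (x powr (\<sigma> - 1) * h x) +
      indicator {1..} x * x powr (\<sigma> - 1 - 1) - 1 / 2 * (indicator {1..} x * x powr (\<sigma> - 1)) =
      indicator {0<..} x * (zeta_kernel x * x powr (\<sigma> - 1))"
      using AE_lborel_singleton[of 1]
    proof eventually_elim
      case (elim x)
      have "x powr (\<sigma> - 1 - 1) = x powr (\<sigma> - 1) / x" if "x > 0" using that by (subst powr_diff) simp
      then show ?case using elim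
        by (auto simp: indicator_def zeta_kernel_def h_def algebra_simps)
    qed
  qed (auto simp: h_def)
  finally show "has_bochner_integral lborel (\<lambda>x. indicator {0<..} x * (zeta_kernel x * x powr (\<sigma> - 1)))
      (?c * Z - 1 / (\<sigma> - 1) + 1 / (2 * \<sigma>))" by simp
qed

section \<open>Continuation, functional equation and growth of the zeta function\<close>

text \<open>
  This is \<open>(s - 1) \<zeta>(s)\<close> on the half-plane \<open>Re s > -1\<close>. The rational terms of the Mellin transform are
  multiplied out with \<open>1/\<Gamma>(s)\<close> and \<open>1/(s \<Gamma>(s)) = 1/\<Gamma>(s + 1)\<close>, so that the expression is
  defined at \<open>0\<close> and \<open>1\<close>.
\<close>
definition zeta_ext :: "complex \<Rightarrow> complex" where
  "zeta_ext s = (s - 1) * (rGamma s * zeta_mellin s - rGamma (s + 1) / 2) + rGamma s"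

lemma holomorphic_zeta_ext: "zeta_ext holomorphic_on {s. Re s > - 1}"
  unfolding zeta_ext_def[abs_def]
  by (intro holomorphic_intros holomorphic_zeta_mellin) auto

lemma zeta_ext_of_real:
  assumes "\<sigma> \<noteq> 0" "\<sigma> \<noteq> 1" "zeta_mellin (of_real \<sigma>) = of_real (I - 1 / (\<sigma> - 1) + 1 / (2 * \<sigma>))"
  shows "zeta_ext (of_real \<sigma>) = (of_real \<sigma> - 1) * (rGamma (of_real \<sigma>) * of_real I)"
proof -
  have "complex_of_real \<sigma> \<noteq> 0" "complex_of_real \<sigma> - 1 \<noteq> 0" using assms by auto
  moreover have "rGamma (of_real \<sigma> + 1 :: complex) = rGamma (of_real \<sigma>) / of_real \<sigma>"
    using rGamma_plus1[of "of_real \<sigma> :: complex"] \<open>complex_of_real \<sigma> \<noteq> 0\<close> by (simp add: field_simps)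
  moreover have "d * (r * (J - 1 / d + 1 / (2 * x)) - r / x / 2) + r = d * (r * J)"
    if "x \<noteq> 0" "d \<noteq> 0" for x d r J :: complex
    using that by (simp add: field_simps)
  ultimately show ?thesis
    unfolding zeta_ext_def assms(3) by simp
qed

lemma real_interval_islimpt:
  fixes a b c :: real
  assumes "a < c" "c < b"
  shows "complex_of_real c islimpt (of_real ` {a<..<b})"
proof -
  have "c islimpt {a<..<b}" using assms by (simp add: islimpt_greaterThanLessThan1 open_imp_islimpt)
  then obtain f where f: "\<And>n. f n \<in> {a<..<b} - {c}" "f \<longlonglongrightarrow> c"
    unfolding islimpt_sequential by blast
  show ?thesis unfolding islimpt_sequential
    by (intro exI[of _ "\<lambda>n. of_real (f n)"]) (use f in \<open>auto intro: tendsto_of_real\<close>)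
qed

text \<open>
  The Mellin transforms were evaluated for real exponents only; this carries the results over to
  complex ones.
\<close>
lemma holomorphic_eq_of_real_interval:
  assumes "f holomorphic_on S" "g holomorphic_on S" "open S" "connected S"
    and "a < c" "c < b" "of_real ` {a<..<b} \<subseteq> S"
    and "\<And>x. a < x \<Longrightarrow> x < b \<Longrightarrow> f (of_real x) = g (of_real x)" "s \<in> S"
  shows "f s = g s"
proof -
  have "f s - g s = 0"
  proof (rule analytic_continuation[of "\<lambda>s. f s - g s" S "of_real ` {a<..<b}" "of_real c"])
    show "complex_of_real c islimpt (of_real ` {a<..<b})" using assms(5,6) by (rule real_interval_islimpt)
  qed (use assms in \<open>auto intro!: holomorphic_intros\<close>)
  then show ?thesis by simp
qed

lemma zeta_reg_of_real:
  assumes "\<sigma> > 1"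
  obtains Z where "(\<lambda>n. real (Suc n) powr (- \<sigma>)) sums Z"
    "zeta_reg (of_real \<sigma>) = (of_real \<sigma> - 1) * of_real Z"
proof -
  have "summable (\<lambda>n. real (Suc n) powr (- \<sigma>))" using assms by (rule summable_Suc_powr)
  then obtain Z where Z: "(\<lambda>n. real (Suc n) powr (- \<sigma>)) sums Z" by (auto simp: summable_def)
  have "(\<lambda>n. of_nat (Suc n) powr (- complex_of_real \<sigma>)) sums (zeta_reg (of_real \<sigma>) / (of_real \<sigma> - 1))"
    using assms by (intro zeta_reg_sums) auto
  moreover have "of_nat (Suc n) powr (- complex_of_real \<sigma>) = of_real (real (Suc n) powr (- \<sigma>))" for n
    by (simp add: powr_of_real[symmetric] del: of_nat_Suc)
  ultimately have "zeta_reg (of_real \<sigma>) / (of_real \<sigma> - 1) = of_real Z"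
    using sums_of_real[OF Z, where 'a = complex] by (auto dest: sums_unique2)
  moreover have "complex_of_real \<sigma> - 1 \<noteq> 0" using assms by auto
  ultimately show ?thesis using that[OF Z] by (simp add: field_simps)
qed

lemma zeta_ext_eq:
  assumes "Re s > 0"
  shows "zeta_ext s = zeta_reg s"
proof (rule holomorphic_eq_of_real_interval[where f = zeta_ext and g = zeta_reg
      and S = "{s. Re s > 0}" and a = 1 and c = 2 and b = 3 and s = s])
  show "zeta_ext holomorphic_on {s. Re s > 0}"
    by (rule holomorphic_on_subset[OF holomorphic_zeta_ext]) auto
  fix \<sigma> :: real assume \<sigma>: "1 < \<sigma>" "\<sigma> < 3"
  obtain Z where Z: "(\<lambda>n. real (Suc n) powr (- \<sigma>)) sums Z"
    "zeta_reg (of_real \<sigma>) = (of_real \<sigma> - 1) * of_real Z"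
    using \<sigma>(1) by (rule zeta_reg_of_real)
  have "zeta_ext (of_real \<sigma>) = (of_real \<sigma> - 1) * (rGamma (of_real \<sigma>) * of_real (Gamma \<sigma> * Z))"
    using \<sigma> by (intro zeta_ext_of_real zeta_mellin_right Z(1)) auto
  moreover have "rGamma (of_real \<sigma>) * complex_of_real (Gamma \<sigma> * Z) = of_real Z"
  proof -
    have "Gamma \<sigma> > 0" using \<sigma> by (intro Gamma_real_pos) auto
    then show ?thesis by (simp add: rGamma_inverse_Gamma Gamma_complex_of_real)
  qed
  ultimately show "zeta_ext (of_real \<sigma>) = zeta_reg (of_real \<sigma>)" using Z(2) by simp
qed (use assms in \<open>auto intro!: holomorphic_zeta_reg open_halfspace_Re_gt convex_connected convex_halfspace_Re_gt\<close>)

text \<open>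
  The factor in \<open>\<zeta>(1 - w) = 2 (2\<pi>)\<^sup>-\<^sup>w cos (\<pi>w/2) \<Gamma>(w) \<zeta>(w)\<close>.
\<close>
definition zeta_factor :: "complex \<Rightarrow> complex" where
  "zeta_factor w = 2 * of_real (2 * pi) powr (- w) * cos (of_real pi * w / 2) * Gamma w"

text \<open>
  The functional equation. For real \<open>s\<close> in the strip it is the evaluation of the Mellin transform by
  partial fractions; the reflection and double-angle formulas turn \<open>\<pi> / (\<Gamma>(s) cos (\<pi>s/2))\<close> into
  \<open>2 sin (\<pi>s/2) \<Gamma>(1 - s)\<close>.
\<close>
lemma zeta_ext_reflect:
  assumes "- 1 < Re s" "Re s < 0"
  shows "zeta_ext s = (s - 1) * (zeta_factor (1 - s) * (zeta_ext (1 - s) / (- s)))"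
proof (rule holomorphic_eq_of_real_interval[where f = zeta_ext
      and g = "\<lambda>s. (s - 1) * (zeta_factor (1 - s) * (zeta_ext (1 - s) / (- s)))"
      and S = "{s. - 1 < Re s} \<inter> {s. Re s < 0}"
      and a = "-1" and c = "-1/2" and b = 0 and s = s])
  let ?S = "{s. - 1 < Re s} \<inter> {s. Re s < 0}"
  show "zeta_ext holomorphic_on ?S"
    by (rule holomorphic_on_subset[OF holomorphic_zeta_ext]) auto
  have "(\<lambda>s. zeta_ext (1 - s)) holomorphic_on ?S"
    by (rule holomorphic_on_compose_gen[OF _ holomorphic_zeta_ext, unfolded o_def])
       (auto intro!: holomorphic_intros)
  then show "(\<lambda>s. (s - 1) * (zeta_factor (1 - s) * (zeta_ext (1 - s) / (- s)))) holomorphic_on ?S"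
    unfolding zeta_factor_def
    by (intro holomorphic_intros) (auto elim!: nonpos_Ints_cases simp: complex_eq_iff)
  show "open ?S" by (intro open_Int open_halfspace_Re_gt open_halfspace_Re_lt)
  show "connected ?S" by (intro convex_connected convex_Int convex_halfspace_Re_gt convex_halfspace_Re_lt)
  fix \<sigma> :: real assume \<sigma>: "- 1 < \<sigma>" "\<sigma> < 0"
  have ne: "complex_of_real \<sigma> \<noteq> 0" "complex_of_real \<sigma> - 1 \<noteq> 0" using \<sigma> by auto
  have "1 - \<sigma> > 1" using \<sigma> by simp
  then obtain Z where Z': "(\<lambda>n. real (Suc n) powr (- (1 - \<sigma>))) sums Z"
    "zeta_reg (of_real (1 - \<sigma>)) = (of_real (1 - \<sigma>) - 1) * of_real Z"
    by (rule zeta_reg_of_real)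
  then have Z: "(\<lambda>n. real (Suc n) powr (\<sigma> - 1)) sums Z" by simp
  from Z'(2) ne have "zeta_reg (of_real (1 - \<sigma>)) / (- of_real \<sigma>) = of_real Z" by simp
  then have zZ: "zeta_ext (1 - of_real \<sigma>) / (- of_real \<sigma>) = of_real Z"
    using \<sigma> by (subst zeta_ext_eq) auto
  have 1: "zeta_ext (of_real \<sigma>) = (of_real \<sigma> - 1) *
      (rGamma (of_real \<sigma>) * of_real ((2 * pi) powr (\<sigma> - 1) * (pi / cos (pi * \<sigma> / 2)) * Z))"
    using \<sigma> by (intro zeta_ext_of_real zeta_mellin_strip Z) auto
  have f: "zeta_factor (1 - of_real \<sigma>) = 
      of_real (2 * (2 * pi) powr (\<sigma> - 1) * sin (pi * \<sigma> / 2)) * Gamma (1 - of_real \<sigma>)"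
  proof -
    have "complex_of_real (2 * pi) powr (- (1 - of_real \<sigma>)) = of_real ((2 * pi) powr (\<sigma> - 1))"
      by (simp add: powr_of_real[symmetric])
    moreover have "cos (of_real pi * (1 - of_real \<sigma>) / 2) = complex_of_real (sin (pi * \<sigma> / 2))"
    proof -
      have "of_real pi * (1 - of_real \<sigma>) / 2 = complex_of_real (pi / 2 - pi * \<sigma> / 2)" by (simp add: field_simps)
      then show ?thesis by (simp only: cos_of_real cos_diff) simp
    qed
    ultimately show ?thesis by (simp add: zeta_factor_def)
  qed
  have "rGamma (of_real \<sigma>) = Gamma (1 - of_real \<sigma>) * complex_of_real (2 * sin (pi * \<sigma> / 2) * cos (pi * \<sigma> / 2) / pi)"
  proof -
    have "1 - complex_of_real \<sigma> \<notin> \<int>\<^sub>\<le>\<^sub>0" using \<sigma> by (auto elim!: nonpos_Ints_cases simp: complex_eq_iff)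
    then have "rGamma (of_real \<sigma>) = Gamma (1 - of_real \<sigma>) * (rGamma (of_real \<sigma>) * rGamma (1 - complex_of_real \<sigma>))"
      by (simp add: rGamma_inverse_Gamma Gamma_eq_zero_iff)
    also have "rGamma (of_real \<sigma>) * rGamma (1 - complex_of_real \<sigma>) = of_real (sin (2 * (pi * \<sigma> / 2)) / pi)"
      by (simp add: rGamma_reflection_complex sin_of_real[symmetric])
    finally show ?thesis by (simp only: sin_double)
  qed
  moreover have "cos (pi * \<sigma> / 2) \<noteq> 0"
    using \<sigma> mult_strict_left_mono[of "-1" \<sigma> pi]
    by (intro less_imp_neq[symmetric] cos_gt_zero_pi) auto
  ultimately have "rGamma (of_real \<sigma>) * of_real ((2 * pi) powr (\<sigma> - 1) * (pi / cos (pi * \<sigma> / 2)) * Z) =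
      zeta_factor (1 - of_real \<sigma>) * of_real Z"
    unfolding f by (simp add: field_simps)
  then show "zeta_ext (of_real \<sigma>) = (of_real \<sigma> - 1) *
      (zeta_factor (1 - of_real \<sigma>) * (zeta_ext (1 - of_real \<sigma>) / (- of_real \<sigma>)))"
    unfolding zZ 1 by (simp only:)
qed (use assms in auto)

text \<open>
  The value at the pole is \<open>0\<close>, because division by zero is. Left of \<open>Re s = -1\<close> the functional
  equation serves as definition.
\<close>
definition zeta :: "complex \<Rightarrow> complex" where
  "zeta s = (if Re s > - 1 then zeta_ext s / (s - 1)
             else zeta_factor (1 - s) * (zeta_ext (1 - s) / (- s)))"

lemma zeta_left:
  assumes "Re s < 0"
  shows "zeta s = zeta_factor (1 - s) * (zeta_ext (1 - s) / (- s))"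
proof -
  have "s \<noteq> 1" using assms by auto
  then show ?thesis using zeta_ext_reflect[of s] assms by (simp add: zeta_def)
qed

lemma holomorphic_zeta: "zeta holomorphic_on - {1}"
proof -
  have R: "zeta holomorphic_on {s. Re s > - 1} - {1}"
  proof (rule holomorphic_transform)
    show "(\<lambda>s. zeta_ext s / (s - 1)) holomorphic_on {s. Re s > - 1} - {1}"
      by (intro holomorphic_intros holomorphic_on_subset[OF holomorphic_zeta_ext]) auto
  qed (auto simp: zeta_def)
  have L: "zeta holomorphic_on {s. Re s < 0}"
  proof (rule holomorphic_transform)
    have "(\<lambda>s. zeta_ext (1 - s)) holomorphic_on {s. Re s < 0}"
      by (rule holomorphic_on_compose_gen[OF _ holomorphic_zeta_ext, unfolded o_def])
         (auto intro!: holomorphic_intros)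
    then show "(\<lambda>s. zeta_factor (1 - s) * (zeta_ext (1 - s) / (- s))) holomorphic_on {s. Re s < 0}"
      unfolding zeta_factor_def
      by (intro holomorphic_intros) (auto elim!: nonpos_Ints_cases simp: complex_eq_iff)
  qed (auto simp: zeta_left)
  have "zeta holomorphic_on ({s. Re s > - 1} - {1}) \<union> {s. Re s < 0}"
    by (intro holomorphic_on_Un R L open_Diff open_halfspace_Re_gt open_halfspace_Re_lt) auto
  then show ?thesis by (rule holomorphic_on_subset) auto
qed

lemma zeta_sums:
  assumes "Re s > 1"
  shows "(\<lambda>n. 1 / of_nat (Suc n) powr s) sums zeta s"
  using zeta_reg_sums[OF assms] assms
  by (simp add: zeta_def zeta_ext_eq powr_minus inverse_eq_divide)

text \<open>
  The identity theorem shows that there is only one candidate for the definite description.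
\<close>
lemma riemann_zeta_eq: "riemann_zeta = zeta"
  unfolding riemann_zeta_def
proof (rule the_equality)
  show "zeta holomorphic_on - {1} \<and> (\<forall>s. 1 < Re s \<longrightarrow> (\<lambda>n. 1 / of_nat (Suc n) powr s) sums zeta s) \<and> zeta 1 = 0"
    using holomorphic_zeta zeta_sums by (simp add: zeta_def)
next
  fix f assume f: "f holomorphic_on - {1} \<and> (\<forall>s. 1 < Re s \<longrightarrow> (\<lambda>n. 1 / of_nat (Suc n) powr s) sums f s) \<and> f 1 = 0"
  show "f = zeta"
  proof
    fix s
    show "f s = zeta s"
    proof (cases "s = 1")
      case False
      show ?thesis
      proof (rule analytic_continuation_open[where s = "{s. Re s > 1}" and s' = "- {1}" and f = f and g = zeta])
        show "f z = zeta z" if "z \<in> {s. Re s > 1}" for z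
          using that f zeta_sums[of z] by (auto dest: sums_unique2)
        show "connected (- {1::complex})" by (intro connected_punctured_universe) simp
        show "{s. 1 < Re s} \<noteq> {}" by (auto intro: exI[of _ 2])
      qed (use f holomorphic_zeta False in \<open>auto intro: open_halfspace_Re_gt\<close>)
    qed (use f in \<open>simp add: zeta_def\<close>)
  qed
qed

lemma zeta_functional_equation:
  assumes "w \<notin> \<int>\<^sub>\<le>\<^sub>0" "w \<noteq> 1"
  shows "riemann_zeta (1 - w) = zeta_factor w * riemann_zeta w"
  unfolding riemann_zeta_eq
proof (rule analytic_continuation_open[where s = "{s. Re s > 1}" and s' = "UNIV - insert 1 \<int>\<^sub>\<le>\<^sub>0" and z = w
      and f = "\<lambda>w. zeta (1 - w)" and g = "\<lambda>w. zeta_factor w * zeta w"])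
  let ?S = "UNIV - insert 1 \<int>\<^sub>\<le>\<^sub>0 :: complex set"
  show "open ?S" by (intro open_Diff closed_insert closed_nonpos_Ints open_UNIV)
  show "connected ?S"
  proof (rule connected_open_diff_countable)
    have "\<int>\<^sub>\<le>\<^sub>0 \<subseteq> range (of_int :: int \<Rightarrow> complex)" by (auto elim!: nonpos_Ints_cases)
    then have "countable (\<int>\<^sub>\<le>\<^sub>0 :: complex set)" by (rule countable_subset) simp
    then show "countable (insert 1 \<int>\<^sub>\<le>\<^sub>0 :: complex set)" by (rule countable_insert)
  qed auto
  show "(\<lambda>w. zeta (1 - w)) holomorphic_on ?S"
    by (rule holomorphic_on_compose_gen[OF _ holomorphic_zeta, unfolded o_def])
       (auto intro!: holomorphic_intros)
  show "(\<lambda>w. zeta_factor w * zeta w) holomorphic_on ?S"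
    unfolding zeta_factor_def
    by (intro holomorphic_intros holomorphic_on_subset[OF holomorphic_zeta]) auto
  show "zeta (1 - z) = zeta_factor z * zeta z" if "z \<in> {s. 1 < Re s}" for z
    using that by (subst zeta_left) (auto simp: zeta_def)
  show "{s. 1 < Re s} \<noteq> {}" by (auto intro: exI[of _ 2])
qed (use assms in \<open>auto intro: open_halfspace_Re_gt elim!: nonpos_Ints_cases\<close>)

text \<open>
  Right of \<open>Re s = 1/2\<close> this is the bound on the regularised series, left of it the functional
  equation: the decay of \<open>\<Gamma>\<close> cancels the growth of the cosine.
\<close>
lemma vertical_growth_zeta: "vertical_growth 0 {a..b} riemann_zeta"
proof -
  have R: "vertical_growth 0 {1/2..b} zeta" for b
  proof -
    obtain C where C: "C \<ge> 0" "\<And>s. Re s \<ge> 1/2 \<Longrightarrow> norm (zeta_reg s) \<le> 1 + norm (s - 1) * norm s * C"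
      by (rule zeta_reg_bound[of "1/2"]) auto
    show ?thesis
    proof (rule vertical_growthI)
      fix s assume s: "Re s \<in> {1/2..b}" "1 \<le> \<bar>Im s\<bar>"
      have ge: "norm (s - 1) \<ge> 1" using s abs_Im_le_cmod[of "s - 1"] by simp
      have "norm s \<le> \<bar>Re s\<bar> + \<bar>Im s\<bar>" by (rule cmod_le)
      also have "\<dots> \<le> \<bar>b\<bar> * \<bar>Im s\<bar> + \<bar>Im s\<bar>"
      proof -
        have "\<bar>Re s\<bar> * 1 \<le> \<bar>b\<bar> * \<bar>Im s\<bar>" using s by (intro mult_mono) auto
        then show ?thesis by simp
      qed
      finally have ns: "norm s \<le> (\<bar>b\<bar> + 1) * \<bar>Im s\<bar>" by (simp add: algebra_simps)
      have "norm (zeta s) = norm (zeta_reg s) / norm (s - 1)"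
        using s by (simp add: zeta_def zeta_ext_eq norm_divide)
      also have "\<dots> \<le> (1 + norm (s - 1) * norm s * C) / norm (s - 1)"
        using s by (intro divide_right_mono C) auto
      also have "\<dots> = 1 / norm (s - 1) + norm s * C"
      proof -
        have "norm (s - 1) \<noteq> 0" using ge by linarith
        then show ?thesis by (simp add: add_divide_distrib)
      qed
      also have "\<dots> \<le> \<bar>Im s\<bar> + ((\<bar>b\<bar> + 1) * \<bar>Im s\<bar>) * C"
      proof (intro add_mono mult_right_mono ns C)
        have "1 / norm (s - 1) \<le> 1 / 1" using ge by (intro frac_le) auto
        then show "1 / norm (s - 1) \<le> \<bar>Im s\<bar>" using s by linarith
      qed
      finally show "norm (zeta s) \<le> (1 + (\<bar>b\<bar> + 1) * C) * \<bar>Im s\<bar> ^ 1 * exp (0 * \<bar>Im s\<bar>)"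
        by (simp add: algebra_simps)
    qed
  qed
  have F: "vertical_growth 0 {1/2..b} zeta_factor" for b
  proof -
    have "vertical_growth (0 + 0 + pi / 2 + (- pi / 2)) {1/2..b}
        (\<lambda>w. 2 * of_real (2 * pi) powr (of_real (- 1) * w) * cos (of_real pi * w / 2) * Gamma w)"
      by (intro vertical_growth_mult vertical_growth_powr vertical_growth_cos vertical_growth_Gamma
          vertical_growth_bounded[where C = 2]) auto
    then show ?thesis by (simp add: zeta_factor_def[abs_def])
  qed
  have L: "vertical_growth 0 {a..1/2} zeta"
  proof (rule vertical_growth_cong)
    have "vertical_growth (0 + 0) {1/2..1-a} (\<lambda>w. zeta_factor w * zeta w)"
      by (intro vertical_growth_mult F R)
    then show "vertical_growth 0 {a..1/2} (\<lambda>s. zeta_factor (of_real 1 - s) * zeta (of_real 1 - s))"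
      using vertical_growth_compose[of 0 "{1/2..1-a}" "\<lambda>w. zeta_factor w * zeta w" "{a..1/2}" "\<lambda>s. of_real 1 - s"]
      by simp
    fix s assume s: "Re s \<in> {a..1/2}" "1 \<le> \<bar>Im s\<bar>"
    have "1 - s \<notin> \<int>\<^sub>\<le>\<^sub>0" "1 - s \<noteq> 1" using s by (auto elim!: nonpos_Ints_cases simp: complex_eq_iff)
    from zeta_functional_equation[OF this]
    show "norm (zeta s) \<le> norm (zeta_factor (of_real 1 - s) * zeta (of_real 1 - s))"
      by (simp add: riemann_zeta_eq)
  qed
  obtain C N where C: "C \<ge> 0"
    "\<And>s. Re s \<in> {a..1/2} \<Longrightarrow> 1 \<le> \<bar>Im s\<bar> \<Longrightarrow> norm (zeta s) \<le> C * \<bar>Im s\<bar> ^ N * exp (0 * \<bar>Im s\<bar>)"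
    using L by (rule vertical_growthE) blast
  obtain C' N' where C': "C' \<ge> 0"
    "\<And>s. Re s \<in> {1/2..b} \<Longrightarrow> 1 \<le> \<bar>Im s\<bar> \<Longrightarrow> norm (zeta s) \<le> C' * \<bar>Im s\<bar> ^ N' * exp (0 * \<bar>Im s\<bar>)"
    using R[of b] by (rule vertical_growthE) blast
  show ?thesis unfolding riemann_zeta_eq
  proof (rule vertical_growthI)
    fix s assume s: "Re s \<in> {a..b}" "1 \<le> \<bar>Im s\<bar>"
    have "norm (zeta s) \<le> C * \<bar>Im s\<bar> ^ N + C' * \<bar>Im s\<bar> ^ N'"
    proof (cases "Re s \<le> 1/2")
      case True
      then show ?thesis using C(2)[of s] C'(1) s by (simp add: add_increasing2)
    next
      case False
      then show ?thesis using C'(2)[of s] C(1) s by (simp add: add_increasing)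
    qed
    also have "\<dots> \<le> C * \<bar>Im s\<bar> ^ (N + N') + C' * \<bar>Im s\<bar> ^ (N + N')"
      using s C(1) C'(1) by (intro add_mono mult_left_mono power_increasing) auto
    finally show "norm (zeta s) \<le> (C + C') * \<bar>Im s\<bar> ^ (N + N') * exp (0 * \<bar>Im s\<bar>)"
      by (simp add: algebra_simps)
  qed
qed

lemma zeta_0: "riemann_zeta 0 = - 1 / 2"
  by (simp add: riemann_zeta_eq zeta_def zeta_ext_def)

text \<open>
  The cosine in the functional equation vanishes at odd arguments.
\<close>
lemma zeta_neg_even:
  assumes "n > 0"
  shows "riemann_zeta (- of_nat (2 * n)) = 0"
proof -
  have "riemann_zeta (1 - of_nat (2 * n + 1)) = zeta_factor (of_nat (2 * n + 1)) * riemann_zeta (of_nat (2 * n + 1))"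
    using assms by (intro zeta_functional_equation) (auto elim!: nonpos_Ints_cases simp: complex_eq_iff)
  moreover have "cos (of_real pi * of_nat (2 * n + 1) / 2 :: complex) = 0"
  proof -
    have "of_real pi * of_nat (2 * n + 1) / 2 = complex_of_real (pi * real (2 * n + 1) / 2)" by simp
    moreover have "cos (pi * real (2 * n + 1) / 2) = 0"
      unfolding cos_zero_iff by (intro disjI1 exI[of _ "2 * n + 1"]) auto
    ultimately show ?thesis by (simp only: cos_of_real) simp
  qed
  ultimately show ?thesis by (simp add: zeta_factor_def)
qed

section \<open>Zeta at the even integers and Bernoulli numbers\<close>

text \<open>
  An interchange of summations for double series that converge absolutely; \<open>B\<close> collects the sums of
  absolute values over the inner index.
\<close>
lemma sums_swap:
  fixes f :: "nat \<Rightarrow> nat \<Rightarrow> real"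
  assumes B: "\<And>n. (\<lambda>i. norm (f n i)) sums B n" "summable B"
    and g: "\<And>n. f n sums g n" "g sums S" and h: "\<And>i. (\<lambda>n. f n i) sums h i"
  shows "h sums S"
proof -
  have B0: "B n \<ge> 0" for n by (rule sums_le[OF _ sums_zero B(1)]) auto
  have le: "norm (f n i) \<le> B n" for n i
    using sum_le_suminf[of "\<lambda>i. norm (f n i)" "{i}"] B(1)[of n] by (simp add: sums_iff)
  have gB: "norm (g n) \<le> B n" for n
    using summable_norm[of "f n"] B(1)[of n] g(1)[of n] by (simp add: sums_iff)
  have "(\<lambda>(n, i). norm (f n i)) summable_on UNIV \<times> UNIV"
  proof (rule summable_on_SigmaI)
    show "((\<lambda>i. case (n, i) of (n, i) \<Rightarrow> norm (f n i)) has_sum B n) UNIV" for n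
      using B(1)[of n] by (auto intro!: norm_summable_imp_has_sum simp: sums_iff)
    show "B summable_on UNIV" using B(2) B0 by (simp add: summable_on_UNIV_nonneg_real_iff)
  qed auto
  then have "(\<lambda>p. norm (case p of (n, i) \<Rightarrow> f n i)) summable_on UNIV \<times> UNIV"
    unfolding case_prod_unfold .
  then have "(\<lambda>(n, i). f n i) summable_on UNIV \<times> UNIV" by (rule abs_summable_summable)
  then have "((\<lambda>(n, i). f n i) has_sum S) (UNIV \<times> UNIV)"
  proof (rule has_sum_SigmaI[rotated 2])
    show "((\<lambda>i. case (n, i) of (n, i) \<Rightarrow> f n i) has_sum g n) UNIV" for n
      using B(1)[of n] g(1)[of n] by (auto intro!: norm_summable_imp_has_sum simp: sums_iff)
    show "(g has_sum S) UNIV"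
      by (intro norm_summable_imp_has_sum g(2) summable_comparison_test'[OF B(2), where N = 0])
         (use gB in auto)
  qed
  then have "((\<lambda>(i, n). f n i) has_sum S) (UNIV \<times> UNIV)"
    by (subst (asm) has_sum_swap) simp
  then have "(h has_sum S) UNIV"
  proof (rule has_sum_SigmaD)
    show "((\<lambda>n. case (i, n) of (i, n) \<Rightarrow> f n i) has_sum h i) UNIV" for i
      unfolding prod.case
      by (intro norm_summable_imp_has_sum h summable_comparison_test'[OF B(2), where N = 0])
         (use le in auto)
  qed
  then show ?thesis by (rule has_sum_imp_sums)
qed

definition zeta_real :: "nat \<Rightarrow> real" where
  "zeta_real m = (\<Sum>n. 1 / real (Suc n) ^ m)"

lemma zeta_real_sums:
  assumes "m \<ge> 2"
  shows "(\<lambda>n. 1 / real (Suc n) ^ m) sums zeta_real m"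
proof -
  have "summable (\<lambda>n. real (Suc n) powr (- real m))" using assms by (intro summable_Suc_powr) auto
  then have "summable (\<lambda>n. 1 / real (Suc n) ^ m)"
    by (simp add: powr_minus powr_realpow inverse_eq_divide del: of_nat_Suc)
  then show ?thesis unfolding zeta_real_def by (rule summable_sums)
qed

lemma riemann_zeta_of_nat:
  assumes "m \<ge> 2"
  shows "riemann_zeta (of_nat m) = of_real (zeta_real m)"
proof -
  have "(\<lambda>n. 1 / of_nat (Suc n) powr (of_nat m)) sums riemann_zeta (of_nat m)"
    unfolding riemann_zeta_eq using assms by (intro zeta_sums) auto
  moreover have "1 / of_nat (Suc n) powr (of_nat m :: complex) = of_real (1 / real (Suc n) ^ m)" for n
    by (subst powr_nat') (auto simp del: of_nat_Suc)
  moreover have "(\<lambda>n. complex_of_real (1 / real (Suc n) ^ m)) sums of_real (zeta_real m)"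
    using assms by (intro sums_of_real zeta_real_sums)
  ultimately show ?thesis by (simp only: sums_unique2)
qed

text \<open>
  Expand every partial fraction \<open>2x/(x\<^sup>2 + A\<^sup>2)\<close> in a geometric series and sum over \<open>A = 2\<pi>n\<close> first.
\<close>
lemma exp_quotient_power_series:
  fixes x :: real
  assumes "x \<noteq> 0" "\<bar>x\<bar> < 1"
  shows "(\<lambda>i. 2 * (-1) ^ i * zeta_real (2 * i + 2) / (2 * pi) ^ (2 * i + 2) * x ^ (2 * i + 2)) sums
     (x / (exp x - 1) - 1 + x / 2)"
proof -
  define A where "A = (\<lambda>n. 2 * pi * real (Suc n))"
  have A: "A n \<ge> 2" for n
  proof -
    have "2 * 1 \<le> (2 * pi) * real (Suc n)" using pi_gt3 by (intro mult_mono) auto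
    then show ?thesis by (simp add: A_def)
  qed
  have x2: "x\<^sup>2 < 1" "x\<^sup>2 > 0" using assms by (auto simp: abs_square_less_1)
  have A2: "(A n)\<^sup>2 \<ge> 4" for n using power_mono[OF A, of 2 n] by simp
  define q where "q = (\<lambda>n. x\<^sup>2 / (A n)\<^sup>2)"
  have q: "0 < q n" "q n < 1" for n
  proof -
    have "(A n)\<^sup>2 > 0" "x\<^sup>2 < (A n)\<^sup>2" using x2 A2[of n] by linarith+
    then show "0 < q n" "q n < 1" using x2 by (simp_all add: q_def)
  qed
  define f where "f = (\<lambda>n i. 2 * x\<^sup>2 / (A n)\<^sup>2 * (- q n) ^ i)"
  have "(\<lambda>i. 2 * (-1) ^ i * zeta_real (2 * i + 2) / (2 * pi) ^ (2 * i + 2) * x ^ (2 * i + 2)) sums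
      (x * (1 / (exp x - 1) - 1 / x + 1 / 2))"
  proof (rule sums_swap)
    show "(\<lambda>i. norm (f n i)) sums (2 * x\<^sup>2 / (A n)\<^sup>2 * (1 / (1 - q n)))" for n
    proof -
      have "(\<lambda>i. 2 * x\<^sup>2 / (A n)\<^sup>2 * q n ^ i) sums (2 * x\<^sup>2 / (A n)\<^sup>2 * (1 / (1 - q n)))"
        using q[of n] by (intro sums_mult geometric_sums) auto
      then show ?thesis using q[of n] by (simp add: f_def abs_mult power_abs)
    qed
    show "summable (\<lambda>n. 2 * x\<^sup>2 / (A n)\<^sup>2 * (1 / (1 - q n)))"
    proof (rule summable_comparison_test'[where N = 0])
      show "summable (\<lambda>n. (4 * x\<^sup>2 / (2 * pi)\<^sup>2) * (1 / real (Suc n) ^ 2))"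
        using zeta_real_sums[of 2] by (intro summable_mult) (auto simp: sums_iff)
      fix n
      have "q n \<le> 1 / 4" unfolding q_def by (rule frac_le) (use x2 A2[of n] in auto)
      then have "1 / (1 - q n) \<le> 1 / (1 / 2)" by (intro frac_le) auto
      then have "2 * x\<^sup>2 / (A n)\<^sup>2 * (1 / (1 - q n)) \<le> 2 * x\<^sup>2 / (A n)\<^sup>2 * 2"
        by (intro mult_left_mono) auto
      also have "\<dots> = (4 * x\<^sup>2 / (2 * pi)\<^sup>2) * (1 / real (Suc n) ^ 2)"
        by (simp add: A_def power_mult_distrib del: of_nat_Suc)
      finally show "norm (2 * x\<^sup>2 / (A n)\<^sup>2 * (1 / (1 - q n))) \<le> (4 * x\<^sup>2 / (2 * pi)\<^sup>2) * (1 / real (Suc n) ^ 2)"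
        using q[of n] by simp
    qed
    show "f n sums (x * (2 * x / (x\<^sup>2 + (2 * pi * real (Suc n))\<^sup>2)))" for n
    proof -
      have "f n sums (2 * x\<^sup>2 / (A n)\<^sup>2 * (1 / (1 - (- q n))))"
        unfolding f_def using q[of n] by (intro sums_mult geometric_sums) auto
      also have "2 * x\<^sup>2 / (A n)\<^sup>2 * (1 / (1 - (- q n))) = x * (2 * x / (x\<^sup>2 + (A n)\<^sup>2))"
      proof -
        have "(A n)\<^sup>2 \<noteq> 0" "x\<^sup>2 + (A n)\<^sup>2 \<noteq> 0" using A2[of n] x2 by linarith+
        then show ?thesis by (simp add: q_def divide_simps) (simp add: algebra_simps power2_eq_square)
      qed
      finally show ?thesis by (simp add: A_def)
    qed
    show "(\<lambda>n. x * (2 * x / (x\<^sup>2 + (2 * pi * real (Suc n))\<^sup>2))) sums (x * (1 / (exp x - 1) - 1 / x + 1 / 2))"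
      using assms by (intro sums_mult exp_partial_fractions) auto
    show "(\<lambda>n. f n i) sums
        (2 * (-1) ^ i * zeta_real (2 * i + 2) / (2 * pi) ^ (2 * i + 2) * x ^ (2 * i + 2))" for i
    proof -
      have "(\<lambda>n. 2 * (-1) ^ i * x ^ (2 * i + 2) / (2 * pi) ^ (2 * i + 2) * (1 / real (Suc n) ^ (2 * i + 2))) sums
          (2 * (-1) ^ i * x ^ (2 * i + 2) / (2 * pi) ^ (2 * i + 2) * zeta_real (2 * i + 2))"
        by (intro sums_mult zeta_real_sums) auto
      moreover have "f n i = 2 * (-1) ^ i * x ^ (2 * i + 2) / (2 * pi) ^ (2 * i + 2) * (1 / real (Suc n) ^ (2 * i + 2))" for n
      proof -
        have "(- q n) ^ i = (-1) ^ i * (x ^ (2 * i) / A n ^ (2 * i))"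
          by (subst power_minus) (simp add: q_def power_divide flip: power_mult)
        then have "f n i = 2 * (-1) ^ i * x ^ (2 * i + 2) / A n ^ (2 * i + 2)"
          by (simp add: f_def power_add power2_eq_square mult_ac)
        then show ?thesis by (simp add: A_def power_mult_distrib del: of_nat_Suc)
      qed
      ultimately show ?thesis by (simp add: mult_ac)
    qed
  qed
  also have "x * (1 / (exp x - 1) - 1 / x + 1 / 2) = x / (exp x - 1) - 1 + x / 2"
    using assms by (simp add: algebra_simps)
  finally show ?thesis .
qed

lemma bernoulli_fps_sums:
  obtains r :: real where "r > 0" "r < 1"
    "\<And>x. \<bar>x\<bar> < r \<Longrightarrow> (\<lambda>n. fps_nth (fps_X / (fps_exp 1 - 1)) n * x ^ n) sums (if x = 0 then 1 else x / (exp x - 1))"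
proof -
  let ?F = "fps_X / (fps_exp 1 - 1) :: real fps"
  have ne: "fps_exp 1 - 1 \<noteq> (0 :: real fps)" 
  proof
    assume "fps_exp 1 - 1 = (0 :: real fps)"
    then have "fps_nth (fps_exp 1 - 1) 1 = (0 :: real)" by simp
    then show False by simp
  qed
  have sd: "subdegree (fps_exp 1 - 1 :: real fps) = 1"
    by (rule subdegreeI) auto
  have "(\<lambda>x::real. if x = 0 then 1 else x / (exp x - 1)) has_fps_expansion ?F"
  proof (rule has_fps_expansion_divide[OF has_fps_expansion_fps_X
         has_fps_expansion_diff[OF has_fps_expansion_exp1 has_fps_expansion_1]])
    show "subdegree (fps_exp 1 - 1 :: real fps) \<le> subdegree (fps_X :: real fps)" unfolding sd by simp
    show "1 = fps_nth fps_X (subdegree (fps_exp 1 - 1 :: real fps)) / 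
        fps_nth (fps_exp 1 - 1 :: real fps) (subdegree (fps_exp 1 - 1 :: real fps))" unfolding sd by simp
  qed (rule ne)
  then obtain e where e: "fps_conv_radius ?F > 0" "e > 0"
      "\<And>x. \<bar>x\<bar> < e \<Longrightarrow> eval_fps ?F x = (if x = 0 then 1 else x / (exp x - 1))"
    unfolding has_fps_expansion_def eventually_nhds_metric by (auto simp: dist_norm)
  obtain r' :: real where r': "r' > 0" "ereal r' < fps_conv_radius ?F"
    using e(1) ereal_dense2[of 0 "fps_conv_radius ?F"] by auto
  show ?thesis
  proof (rule that[of "min (1/2) (min e r')"])
    fix x :: real assume x: "\<bar>x\<bar> < min (1/2) (min e r')"
    then have "ereal (norm x) < fps_conv_radius ?F"
      using r' by (auto intro: less_trans[of _ "ereal r'"])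
    from sums_eval_fps[OF this] show "(\<lambda>n. fps_nth ?F n * x ^ n) sums (if x = 0 then 1 else x / (exp x - 1))"
      using e(3)[of x] x by auto
  qed (use e r' in auto)
qed

text \<open>
  Uniqueness of power series: the generating function of the Bernoulli numbers and the expansion by
  partial fractions represent the same function near \<open>0\<close>.
\<close>
lemma bernoulli_even:
  "bernoulli 0 = 1"
  "bernoulli (2 * i + 2) = fact (2 * i + 2) * (2 * (-1) ^ i * zeta_real (2 * i + 2) / (2 * pi) ^ (2 * i + 2))"
proof -
  define F where "F = (fps_X / (fps_exp 1 - 1) :: real fps)"
  define c where "c = (\<lambda>j. if j = 0 then 1 else
     2 * (-1) ^ (j - 1) * zeta_real (2 * j) / (2 * pi) ^ (2 * j))"
  \<comment> \<open>\<open>x/(e\<^sup>x - 1) + x/2\<close> is even, so \<open>-1/2\<close> at \<open>n = 1\<close> is the only odd coefficient.\<close>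
  define a where "a = (\<lambda>n. (if even n then c (n div 2) else 0) + (if n = 1 then - 1 / 2 else 0))"
  obtain r where r: "r > 0" "r < 1"
    "\<And>x. \<bar>x\<bar> < r \<Longrightarrow> (\<lambda>n. fps_nth F n * x ^ n) sums (if x = 0 then 1 else x / (exp x - 1))"
    unfolding F_def by (rule bernoulli_fps_sums) blast
  have a: "(\<lambda>n. a n * x ^ n) sums (if x = 0 then 1 else x / (exp x - 1))" if "\<bar>x\<bar> < 1" for x
  proof (cases "x = 0")
    case True
    then show ?thesis using powser_sums_zero[of a] by (simp add: a_def c_def)
  next
    case False
    have "(\<lambda>j. c (Suc j) * x ^ (2 * Suc j)) sums (x / (exp x - 1) - 1 + x / 2)"
      using exp_quotient_power_series[OF False that] by (simp add: c_def)
    then have "(\<lambda>j. c j * x ^ (2 * j)) sums (x / (exp x - 1) - 1 + x / 2 + c 0 * x ^ (2 * 0))"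
      by (subst (asm) sums_Suc_iff)
    then have "(\<lambda>j. c j * x ^ (2 * j)) sums (x / (exp x - 1) + x / 2)"
      by (simp add: c_def)
    also have "?this \<longleftrightarrow> (\<lambda>j. (if even (2 * j) then c (2 * j div 2) else 0) * x ^ (2 * j)) sums (x / (exp x - 1) + x / 2)"
      by simp
    also have "\<dots> \<longleftrightarrow> (\<lambda>n. (if even n then c (n div 2) else 0) * x ^ n) sums (x / (exp x - 1) + x / 2)"
      by (rule sums_mono_reindex[of "\<lambda>j. 2 * j" "\<lambda>n. (if even n then c (n div 2) else 0) * x ^ n"])
         (auto simp: strict_mono_def)
    finally have "(\<lambda>n. (if even n then c (n div 2) else 0) * x ^ n + (if n = 1 then - 1 / 2 * x ^ n else 0)) sums
        (x / (exp x - 1) + x / 2 + (- 1 / 2) * x ^ 1)"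
      by (intro sums_add sums_single)
    moreover have "(if even n then c (n div 2) else 0) * x ^ n + (if n = 1 then - 1 / 2 * x ^ n else 0) = a n * x ^ n" for n
      by (simp add: a_def algebra_simps)
    ultimately show ?thesis using False by simp
  qed
  have diff: "(\<lambda>n. (fps_nth F n - a n) * x ^ n) sums 0" if "\<bar>x\<bar> < r" for x
    using sums_diff[OF r(3)[OF that] a[of x]] that r(2) by (simp add: algebra_simps)
  have eq: "fps_nth F n = a n" for n
  proof (cases "n = 0")
    case True
    then show ?thesis using diff[of 0] r(1) powser_sums_zero[of "\<lambda>n. fps_nth F n - a n"]
      by (auto dest: sums_unique2)
  next
    case False
    show ?thesis
    proof (rule ccontr)
      assume "fps_nth F n \<noteq> a n"
      then have ne: "fps_nth F n - a n \<noteq> 0" by simp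
      show False
      proof (rule powser_0_nonzero[of r "0::real" "\<lambda>n. fps_nth F n - a n" "\<lambda>_. 0 :: real" n])
        show "(\<lambda>n. (fps_nth F n - a n) * (x - 0) ^ n) sums 0" if "norm (x - 0) < r" for x
          using diff[of x] that by simp
        fix s :: real assume "0 < s" "\<And>z::real. z \<in> cball 0 s - {0} \<Longrightarrow> (0::real) \<noteq> 0"
        from this(2)[of s] this(1) show False by auto
      qed (use r(1) ne False in auto)
    qed
  qed
  have "bernoulli n = fact n * a n" for n
    unfolding bernoulli_def eq[symmetric] F_def ..
  then show "bernoulli 0 = 1"
    "bernoulli (2 * i + 2) = fact (2 * i + 2) * (2 * (-1) ^ i * zeta_real (2 * i + 2) / (2 * pi) ^ (2 * i + 2))"
    by (simp_all add: a_def c_def)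
qed

theorem zeta_even:
  "riemann_zeta (of_nat (2 * j)) =
     of_real ((-1) ^ (j + 1) * bernoulli (2 * j) * (2 * pi) ^ (2 * j) / (2 * fact (2 * j)))"
proof (cases j)
  case 0
  then show ?thesis by (simp add: zeta_0 bernoulli_even(1))
next
  case (Suc i)
  have "zeta_real (2 * i + 2) = (-1) ^ i * bernoulli (2 * i + 2) * (2 * pi) ^ (2 * i + 2) / (2 * fact (2 * i + 2))"
  proof -
    have "z = s * (f * (2 * s * z / p)) * p / (2 * f)" if "s * s = 1" "f \<noteq> 0" "p \<noteq> 0" for s f p z :: real
      using that by (simp add: field_simps)
    moreover have "(-1) ^ i * (-1) ^ i = (1 :: real)" by (simp flip: power_add)
    ultimately show ?thesis unfolding bernoulli_even(2) by simp
  qed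
  moreover have "riemann_zeta (of_nat (2 * i + 2)) = of_real (zeta_real (2 * i + 2))"
    by (rule riemann_zeta_of_nat) auto
  ultimately show ?thesis using Suc by simp
qed

section \<open>The Dirichlet series of the Piltz divisor function\<close>

definition positive_lists :: "nat \<Rightarrow> nat list set" where
  "positive_lists k = {xs. length xs = k \<and> (\<forall>x\<in>set xs. x > 0)}"

text \<open>
  The \<open>k\<close>-th power of a series, multiplied out: one term for every \<open>k\<close>-tuple of indices.
\<close>
lemma has_sum_positive_lists:
  fixes g :: "nat \<Rightarrow> complex"
  assumes g: "(g has_sum Z) {0<..}"
  shows "((\<lambda>xs. prod_list (map g xs)) has_sum Z ^ k) (positive_lists k)"
proof (induction k)
  case 0
  have "positive_lists 0 = {[]}" by (auto simp: positive_lists_def)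
  then show ?case using has_sum_finite[of "{[]}" "\<lambda>xs. prod_list (map g xs)"] by simp
next
  case (Suc k)
  let ?P = "\<lambda>xs. prod_list (map g xs)"
  let ?f = "\<lambda>(x, xs). g x * ?P xs"
  have norms: "(\<lambda>x. norm (g x)) summable_on {0<..}" "(\<lambda>xs. norm (?P xs)) summable_on positive_lists k"
    using has_sum_imp_summable[OF g] has_sum_imp_summable[OF Suc]
    by (simp_all only: summable_on_iff_abs_summable_on_complex)
  define B where "B = infsum (\<lambda>xs. norm (?P xs)) (positive_lists k)"
  have B: "((\<lambda>xs. norm (?P xs)) has_sum B) (positive_lists k)"
    unfolding B_def using norms(2) by (rule has_sum_infsum)
  have "(\<lambda>(x, xs). norm (g x) * norm (?P xs)) summable_on {0<..} \<times> positive_lists k"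
  proof (rule summable_on_SigmaI)
    show "((\<lambda>xs. case (x, xs) of (x, xs) \<Rightarrow> norm (g x) * norm (?P xs)) has_sum norm (g x) * B) (positive_lists k)" for x
      unfolding prod.case by (intro has_sum_cmult_right B)
    show "(\<lambda>x. norm (g x) * B) summable_on {0<..}"
      using norms(1) by (rule summable_on_cmult_left)
  qed auto
  then have "(\<lambda>p. norm (?f p)) summable_on {0<..} \<times> positive_lists k"
    by (simp add: case_prod_unfold norm_mult)
  then have "?f summable_on {0<..} \<times> positive_lists k" by (rule abs_summable_summable)
  then have "(?f has_sum Z * Z ^ k) ({0<..} \<times> positive_lists k)"
  proof (rule has_sum_SigmaI[rotated 2])
    show "((\<lambda>xs. ?f (x, xs)) has_sum g x * Z ^ k) (positive_lists k)" for x
      unfolding prod.case by (intro has_sum_cmult_right Suc)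
    show "((\<lambda>x. g x * Z ^ k) has_sum Z * Z ^ k) {0<..}"
      by (intro has_sum_cmult_left g)
  qed
  also have "?this \<longleftrightarrow> (?P has_sum Z * Z ^ k) (positive_lists (Suc k))"
    by (rule has_sum_reindex_bij_witness[of _ "\<lambda>xs. (hd xs, tl xs)" "\<lambda>(x, xs). x # xs"])
       (auto simp: positive_lists_def length_Suc_conv)
  finally show ?case by simp
qed

lemma piltz_eq_card: "piltz k n = card {xs \<in> positive_lists k. prod_list xs = n}"
  unfolding piltz_def positive_lists_def by (intro arg_cong[where f = card]) auto

lemma finite_factorizations:
  assumes "n > 0"
  shows "finite {xs \<in> positive_lists k. prod_list xs = n}"
proof (rule finite_subset)
  have "x \<le> prod_list xs" if "x \<in> set xs" "prod_list xs > 0" for x and xs :: "nat list"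
    using that by (intro dvd_imp_le prod_list_dvd)
  then show "{xs \<in> positive_lists k. prod_list xs = n} \<subseteq> {xs. set xs \<subseteq> {..n} \<and> length xs = k}"
    using assms by (auto simp: positive_lists_def)
  show "finite {xs. set xs \<subseteq> {..n} \<and> length xs = k}" by (rule finite_lists_length_eq) simp
qed

text \<open>
  Group the \<open>k\<close>-tuples by the product of their entries; for completely multiplicative \<open>g\<close> the term
  depends on that product only.
\<close>
lemma has_sum_piltz:
  fixes g :: "nat \<Rightarrow> complex"
  assumes g: "(g has_sum Z) {0<..}"
    and mult: "g 1 = 1" "\<And>m n. m > 0 \<Longrightarrow> n > 0 \<Longrightarrow> g (m * n) = g m * g n"
  shows "((\<lambda>n. of_nat (piltz k n) * g n) has_sum Z ^ k) {0<..}"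
proof -
  let ?A = "\<lambda>n. {xs \<in> positive_lists k. prod_list xs = n}"
  have pos: "prod_list xs > 0" if "\<forall>x\<in>set xs. x > 0" for xs :: "nat list"
    using that by (induction xs) auto
  have prod: "prod_list (map g xs) = g (prod_list xs)" if "\<forall>x\<in>set xs. x > 0" for xs
    using that by (induction xs) (auto simp: mult(1)[simplified] mult(2) pos)
  have "((\<lambda>xs. g (prod_list xs)) has_sum Z ^ k) (positive_lists k)"
    using has_sum_positive_lists[OF g, of k]
    by (rule iffD1[OF has_sum_cong, rotated]) (auto simp: prod positive_lists_def)
  also have "?this \<longleftrightarrow> ((\<lambda>(n, xs). g n) has_sum Z ^ k) (SIGMA n:{0<..}. ?A n)"
    by (rule has_sum_reindex_bij_witness[of _ snd "\<lambda>xs. (prod_list xs, xs)"])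
       (auto simp: positive_lists_def intro!: pos[rule_format])
  finally show ?thesis
  proof (rule has_sum_SigmaD)
    fix n :: nat assume "n \<in> {0<..}"
    then have "finite (?A n)" by (intro finite_factorizations) auto
    then show "((\<lambda>xs. case (n, xs) of (n, xs) \<Rightarrow> g n) has_sum of_nat (piltz k n) * g n) (?A n)"
      by (intro has_sum_finiteI) (auto simp: piltz_eq_card)
  qed
qed

lemma complex_powr_pos: "b > 0 \<Longrightarrow> complex_of_real b powr z = exp (z * of_real (ln b))"
  by (simp add: powr_def Ln_of_real)

text \<open>
  The tuples are grouped for \<open>g(n) = n\<^sup>-\<^sup>s\<close>. The second part is the absolute convergence, which
  justifies the interchange of sums and integrals below.
\<close>
lemma
  assumes "Re s > 1"
  shows piltz_sums: "(\<lambda>i. of_nat (piltz k (Suc i)) * of_nat (Suc i) powr (- s)) sums riemann_zeta s ^ k"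
    and piltz_summable: "summable (\<lambda>i. real (piltz k (Suc i)) * real (Suc i) powr (- Re s))"
proof -
  define g where "g = (\<lambda>n::nat. of_nat n powr (- s) :: complex)"
  have norm_g: "norm (g n) = real n powr (- Re s)" for n
    unfolding g_def by (subst norm_powr_real_powr) auto
  have Suc: "bij_betw Suc UNIV {0<..}"
    by (rule bij_betwI[of _ _ _ "\<lambda>n. n - 1"]) auto
  have "(\<lambda>i. g (Suc i)) sums riemann_zeta s"
    using zeta_sums[OF assms] unfolding riemann_zeta_eq g_def
    by (simp add: powr_minus inverse_eq_divide del: of_nat_Suc)
  moreover have "summable (\<lambda>i. norm (g (Suc i)))"
    unfolding norm_g using assms by (rule summable_Suc_powr)
  ultimately have "((\<lambda>i. g (Suc i)) has_sum riemann_zeta s) UNIV"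
    by (intro norm_summable_imp_has_sum)
  then have "(g has_sum riemann_zeta s) {0<..}"
    using has_sum_reindex_bij_betw[OF Suc] by blast
  then have "((\<lambda>n. of_nat (piltz k n) * g n) has_sum riemann_zeta s ^ k) {0<..}"
  proof (rule has_sum_piltz)
    fix m n :: nat assume "m > 0" "n > 0"
    then show "g (m * n) = g m * g n" unfolding g_def of_nat_mult by (intro powr_times_real) auto
  qed (simp add: g_def)
  then have *: "((\<lambda>i. of_nat (piltz k (Suc i)) * g (Suc i)) has_sum riemann_zeta s ^ k) UNIV"
    using has_sum_reindex_bij_betw[OF Suc, of "\<lambda>n. of_nat (piltz k n) * g n"] by blast
  then show "(\<lambda>i. of_nat (piltz k (Suc i)) * of_nat (Suc i) powr (- s)) sums riemann_zeta s ^ k"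
    unfolding g_def by (rule has_sum_imp_sums)
  have "(\<lambda>i. norm (of_nat (piltz k (Suc i)) * g (Suc i))) summable_on UNIV"
    using has_sum_imp_summable[OF *] by (simp only: summable_on_iff_abs_summable_on_complex)
  then have "summable (\<lambda>i. norm (of_nat (piltz k (Suc i)) * g (Suc i)))"
    by (rule summable_on_imp_summable)
  then show "summable (\<lambda>i. real (piltz k (Suc i)) * real (Suc i) powr (- Re s))"
    unfolding norm_mult norm_g by simp
qed

section \<open>The Meijer function as an inverse Mellin transform\<close>

text \<open>
  The Mellin transform whose inverse is the Meijer function, up to a constant and an exponential
  factor in \<open>w\<close>.
\<close>
definition mellin_kernel :: "nat \<Rightarrow> complex \<Rightarrow> complex" where
  "mellin_kernel k w = Gamma w ^ k * cos (of_real pi * w / 2) ^ (k - 1)"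

text \<open>
  The reflection formula moves \<open>\<Gamma>((1 - w)/2)\<close> into the numerator as \<open>\<Gamma>((1 + w)/2) cos (\<pi>w/2) / \<pi>\<close>. Then
  there are equally many factors \<open>\<Gamma>(w/2)\<close> and \<open>\<Gamma>((1 + w)/2)\<close>, and each pair is a multiple of \<open>\<Gamma>(w)\<close> by the
  duplication formula.
\<close>
lemma meijer_gamma_quotient:
  assumes "k \<ge> 1" "Re w > 0"
  shows "Gamma (w / 2) ^ k * Gamma ((1 + w) / 2) / Gamma ((1 - w) / 2) ^ (k - 1) =
    of_real (2 ^ k * pi powr (1 - real k / 2)) * exp (- (of_nat k * w * of_real (ln 2))) * mellin_kernel k w"
proof -
  define G1 G2 c where "G1 = Gamma (w / 2)" and "G2 = Gamma ((1 + w) / 2)"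
    and "c = cos (of_real pi * w / 2)"
  have w: "w / 2 \<notin> \<int>\<^sub>\<le>\<^sub>0" "(1 + w) / 2 \<notin> \<int>\<^sub>\<le>\<^sub>0"
    using assms(2) by (auto elim!: nonpos_Ints_cases simp: complex_eq_iff)
  have G2: "G2 \<noteq> 0" using w by (simp add: G2_def Gamma_eq_zero_iff)
  have "rGamma ((1 + w) / 2) * rGamma (1 - (1 + w) / 2) = sin (of_real pi * ((1 + w) / 2)) / of_real pi"
    by (rule rGamma_reflection_complex)
  also have "sin (of_real pi * ((1 + w) / 2)) = c"
  proof -
    have "of_real pi * ((1 + w) / 2) = of_real pi * w / 2 + of_real (pi / 2)" by (simp add: field_simps)
    then show ?thesis by (simp only: sin_add sin_of_real cos_of_real c_def) simp
  qed
  also have "1 - (1 + w) / 2 = (1 - w) / 2" by (simp add: field_simps)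
  also have "rGamma ((1 + w) / 2) = inverse G2" by (simp add: rGamma_inverse_Gamma G2_def)
  finally have R: "rGamma ((1 - w) / 2) = G2 * c / of_real pi"
    using G2 by (simp add: field_simps)
  have G12: "G1 * G2 = exp ((1 - w) * of_real (ln 2)) * of_real (sqrt pi) * Gamma w"
  proof -
    have "w / 2 + 1 / 2 = (1 + w) / 2" by (simp add: field_simps)
    with Gamma_legendre_duplication[of "w / 2"] w show ?thesis
      by (simp add: G1_def G2_def)
  qed
  have "Gamma (w / 2) ^ k * Gamma ((1 + w) / 2) / Gamma ((1 - w) / 2) ^ (k - 1) =
      G1 ^ k * G2 * rGamma ((1 - w) / 2) ^ (k - 1)"
    unfolding G1_def G2_def rGamma_inverse_Gamma power_inverse divide_inverse ..
  also have "\<dots> = (G1 * G2) ^ k * (c / of_real pi) ^ (k - 1)"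
  proof -
    have "G2 ^ k = G2 * G2 ^ (k - 1)" using assms(1) by (cases k) auto
    then show ?thesis unfolding R by (simp add: power_mult_distrib power_divide)
  qed
  also have "\<dots> = (exp ((1 - w) * of_real (ln 2)) ^ k * (of_real (sqrt pi) ^ k / of_real pi ^ (k - 1))) * mellin_kernel k w"
    unfolding G12 by (simp add: mellin_kernel_def c_def power_mult_distrib power_divide)
  also have "of_real (sqrt pi) ^ k / of_real pi ^ (k - 1) = complex_of_real (pi powr (1 - real k / 2))"
  proof -
    have "sqrt pi ^ k / pi ^ (k - 1) = (pi powr (1/2)) powr real k / pi powr real (k - 1)"
      by (simp add: powr_realpow powr_half_sqrt)
    also have "\<dots> = pi powr (1 - real k / 2)"
      using assms(1) by (simp add: powr_powr flip: powr_diff)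
    finally show ?thesis by (simp flip: of_real_power of_real_divide)
  qed
  also have "exp ((1 - w) * of_real (ln 2)) ^ k = of_real (2 ^ k) * exp (- (of_nat k * w * of_real (ln 2)))"
  proof -
    have "(1 - w) * of_real (ln 2) = of_real (ln 2) + - (w * of_real (ln 2))" by (simp add: algebra_simps)
    then have "exp ((1 - w) * of_real (ln 2)) = 2 * exp (- (w * of_real (ln 2)))"
      by (simp only: exp_add exp_of_real) simp
    then show ?thesis by (simp add: power_mult_distrib algebra_simps flip: exp_of_nat_mult)
  qed
  finally show ?thesis by (simp add: mult_ac)
qed

text \<open>
  The substitution \<open>w = - 2 s\<close>. The constant in front is the normalisation of \<open>\<Psi>\<close>; it cancels the
  constant of the Gamma quotient and the factor \<open>1/2\<close> of the substitution.
\<close>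
lemma meijer_G_eq_vertical_integral:
  assumes "k \<ge> 1" "\<mu> < 0" "b > 0"
  shows "of_real (pi powr (real k / 2 - 1) / 2 ^ (k - 1)) * meijer_G \<mu> k (b\<^sup>2 / 2 ^ (2 * k)) =
    vertical_integral (- 2 * \<mu>) (\<lambda>w. mellin_kernel k w * of_real b powr (- w))"
proof -
  define H where "H = (\<lambda>w. mellin_kernel k w * of_real b powr (- w))"
  define K where "K = complex_of_real (2 ^ k * pi powr (1 - real k / 2))"
  define z where "z = b\<^sup>2 / 2 ^ (2 * k)"
  have integrand: "Gamma (- s) ^ k * Gamma (1/2 - s) / Gamma (1/2 + s) ^ (k - 1) * of_real z powr s =
      K * H (- 2 * s)" if "Re s < 0" for s
  proof -
    have z: "z > 0" "ln z = 2 * ln b - 2 * real k * ln 2"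
      using assms(3) by (simp_all add: z_def ln_div ln_realpow)
    have "of_real z powr s = exp (of_nat k * (- 2 * s) * of_real (ln 2)) * of_real b powr (- (- 2 * s))"
      unfolding complex_powr_pos[OF z(1)] complex_powr_pos[OF assms(3)] exp_add[symmetric] z(2)
      by (rule arg_cong[where f = exp]) (simp add: algebra_simps)
    moreover have "Gamma (- s) ^ k * Gamma (1/2 - s) / Gamma (1/2 + s) ^ (k - 1) =
        K * exp (- (of_nat k * (- 2 * s) * of_real (ln 2))) * mellin_kernel k (- 2 * s)"
    proof -
      have "- s = (- 2 * s) / 2" "1/2 - s = (1 + (- 2 * s)) / 2" "1/2 + s = (1 - (- 2 * s)) / 2"
        by (simp_all add: field_simps)
      then show ?thesis
        using meijer_gamma_quotient[OF assms(1), of "- 2 * s"] that by (simp only: K_def) simp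
    qed
    ultimately show ?thesis by (simp add: H_def exp_minus field_simps)
  qed
  have "(\<integral>y. H (Complex (- 2 * \<mu>) y) \<partial>lborel) = 2 * (\<integral>t. H (Complex (- 2 * \<mu>) (0 + (- 2) * t)) \<partial>lborel)"
    using lborel_integral_real_affine[of "- 2" "\<lambda>y. H (Complex (- 2 * \<mu>) y)" 0]
    by (simp add: scaleR_conv_of_real)
  also have "(\<lambda>t. H (Complex (- 2 * \<mu>) (0 + (- 2) * t))) = (\<lambda>t. H (- 2 * Complex \<mu> t))"
    by (intro ext arg_cong[where f = H]) (simp add: complex_eq_iff)
  finally have H: "(\<integral>t. H (- 2 * Complex \<mu> t) \<partial>lborel) = (\<integral>y. H (Complex (- 2 * \<mu>) y) \<partial>lborel) / 2"
    by simp
  have "meijer_G \<mu> k z = 1 / (2 * of_real pi * \<i>) * (\<integral>t. (K * \<i>) * H (- 2 * Complex \<mu> t) \<partial>lborel)"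
    unfolding meijer_G_def Let_def by (simp only: integrand complex.sel assms(2)) (simp add: mult_ac)
  also have "\<dots> = 1 / (2 * of_real pi * \<i>) * ((K * \<i>) * ((\<integral>y. H (Complex (- 2 * \<mu>) y) \<partial>lborel) / 2))"
    by (simp only: integral_mult_right_zero H)
  also have "\<dots> = K / 2 * vertical_integral (- 2 * \<mu>) H"
    by (simp add: vertical_integral_def)
  finally have G: "meijer_G \<mu> k z = K / 2 * vertical_integral (- 2 * \<mu>) H" .
  have "of_real (pi powr (real k / 2 - 1) / 2 ^ (k - 1)) * meijer_G \<mu> k z =
      (of_real (pi powr (real k / 2 - 1) / 2 ^ (k - 1)) * (K / 2)) * vertical_integral (- 2 * \<mu>) H"
    unfolding G by (rule mult.assoc[symmetric])
  also have "of_real (pi powr (real k / 2 - 1) / 2 ^ (k - 1)) * (K / 2) = 1"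
  proof -
    have "pi powr (real k / 2 - 1) * pi powr (1 - real k / 2) = 1"
      by (simp flip: powr_add)
    moreover have "(2 :: real) ^ k = 2 * 2 ^ (k - 1)" using assms(1) by (cases k) auto
    ultimately have "pi powr (real k / 2 - 1) / 2 ^ (k - 1) * ((2 ^ k * pi powr (1 - real k / 2)) / 2) = 1"
      by simp
    then show ?thesis unfolding K_def by (metis of_real_1 of_real_divide of_real_mult of_real_numeral)
  qed
  finally show ?thesis by (simp add: z_def H_def)
qed

lemma vertical_growth_mellin_kernel:
  assumes "k \<ge> 1" "a > 0"
  shows "vertical_growth (- pi / 2) {a..b} (mellin_kernel k)"
proof -
  have "vertical_growth (of_nat k * (- pi / 2) + of_nat (k - 1) * (pi / 2)) {a..b} (mellin_kernel k)"
    unfolding mellin_kernel_def[abs_def]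
    by (intro vertical_growth_mult vertical_growth_power vertical_growth_Gamma vertical_growth_cos assms)
  also have "of_nat k * (- pi / 2) + of_nat (k - 1) * (pi / 2) = - pi / 2"
    using assms(1) by (simp add: of_nat_diff field_simps)
  finally show ?thesis .
qed

lemma holomorphic_mellin_kernel: "mellin_kernel k holomorphic_on {w. Re w > 0}"
  unfolding mellin_kernel_def[abs_def] by (intro holomorphic_intros) (auto elim!: nonpos_Ints_cases)

lemma vertical_growth_powr_minus:
  assumes "b > (0::real)"
  shows "vertical_growth 0 {x..y} (\<lambda>w. of_real b powr (- w))"
  using vertical_growth_powr[OF assms, of x y "-1"] by simp

text \<open>
  The kernel has no pole right of the imaginary axis. This is why the choice of \<open>\<mu>\<close> does not matter, and
  why the sum over \<open>j\<close> may be treated on a line where it converges absolutely.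
\<close>
lemma vertical_integral_mellin_kernel_eq:
  assumes "k \<ge> 1" "b > 0" "c > 0" "d > 0"
  shows "vertical_integral c (\<lambda>w. mellin_kernel k w * of_real b powr (- w)) =
         vertical_integral d (\<lambda>w. mellin_kernel k w * of_real b powr (- w))"
proof -
  have *: "vertical_integral d (\<lambda>w. mellin_kernel k w * of_real b powr (- w)) -
      vertical_integral c (\<lambda>w. mellin_kernel k w * of_real b powr (- w)) = (\<Sum>p\<in>{}. residue (\<lambda>w. mellin_kernel k w * of_real b powr (- w)) p)"
    if "0 < c" "c < d" for c d
  proof (rule vertical_integral_shift)
    show "(\<lambda>w. mellin_kernel k w * of_real b powr (- w)) holomorphic_on {s. c / 2 < Re s \<and> Re s < d + 1} - {}"
      using that assms by (intro holomorphic_intros holomorphic_on_subset[OF holomorphic_mellin_kernel]) auto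
    have "vertical_growth (- pi / 2 + 0) {c..d} (\<lambda>w. mellin_kernel k w * of_real b powr (- w))"
      using that assms by (intro vertical_growth_mult vertical_growth_mellin_kernel vertical_growth_powr_minus)
    then show "vertical_growth (- pi / 2) {c..d} (\<lambda>w. mellin_kernel k w * of_real b powr (- w))" by simp
  qed (use that in auto)
  show ?thesis using *[of c d] *[of d c] assms by (cases c d rule: linorder_cases) auto
qed

lemma vertical_integral_dirichlet_series:
  assumes int: "integrable lborel (\<lambda>t. g (Complex c t))"
    and sum: "summable (\<lambda>i. norm (a i) * real (Suc i) powr (- c))"
    and sums: "\<And>t. (\<lambda>i. a i * of_nat (Suc i) powr (- Complex c t)) sums D (Complex c t)"
  shows "(\<lambda>i. a i * vertical_integral c (\<lambda>w. g w * of_nat (Suc i) powr (- w))) sums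
           vertical_integral c (\<lambda>w. g w * D w)"
proof -
  define f where "f = (\<lambda>i t. g (Complex c t) * (a i * of_nat (Suc i) powr (- Complex c t)))"
  have norm_n: "norm (of_nat (Suc i) powr (- Complex c t) :: complex) = real (Suc i) powr (- c)" for i t
    by (subst norm_powr_real_powr) auto
  have norm_f: "norm (f i t) = norm (g (Complex c t)) * (norm (a i) * real (Suc i) powr (- c))" for i t
    by (simp only: f_def norm_mult norm_n)
  have f_int: "integrable lborel (f i)" for i
  proof (rule Bochner_Integration.integrable_bound)
    show "integrable lborel (\<lambda>t. norm (g (Complex c t)) * (norm (a i) * real (Suc i) powr (- c)))"
      using int by (intro integrable_mult_left) auto
    have "(\<lambda>t. of_nat (Suc i) powr (- Complex c t) :: complex) \<in> borel_measurable borel"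
      by (intro borel_measurable_continuous_onI continuous_intros continuous_on_of_real)
         (auto simp: Complex_eq intro!: continuous_intros simp del: of_nat_Suc)
    then show "f i \<in> borel_measurable lborel"
      unfolding f_def using borel_measurable_integrable[OF int] by measurable
  qed (auto simp: norm_f)
  have 1: "AE t in lborel. summable (\<lambda>i. norm (f i t))"
    unfolding norm_f using sum by (intro AE_I2 summable_mult)
  have "(\<integral>t. norm (f i t) \<partial>lborel) = (\<integral>t. norm (g (Complex c t)) \<partial>lborel) * (norm (a i) * real (Suc i) powr (- c))" for i
    unfolding norm_f by simp
  then have 2: "summable (\<lambda>i. \<integral>t. norm (f i t) \<partial>lborel)"
    using sum by (simp add: summable_mult)
  have "(\<Sum>i. f i t) = g (Complex c t) * D (Complex c t)" for t
    using sums_mult[OF sums[of t], of "g (Complex c t)"] by (simp add: f_def sums_iff)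
  with sums_integral[OF f_int 1 2]
  have "(\<lambda>i. \<integral>t. f i t \<partial>lborel) sums (\<integral>t. g (Complex c t) * D (Complex c t) \<partial>lborel)" by simp
  moreover have "(\<integral>t. f i t \<partial>lborel) =
      a i * (\<integral>t. g (Complex c t) * of_nat (Suc i) powr (- Complex c t) \<partial>lborel)" for i
    unfolding f_def by (simp add: mult.left_commute flip: integral_mult_right_zero)
  ultimately have "(\<lambda>i. a i * (\<integral>t. g (Complex c t) * of_nat (Suc i) powr (- Complex c t) \<partial>lborel)) sums
      (\<integral>t. g (Complex c t) * D (Complex c t) \<partial>lborel)" by simp
  from sums_mult[OF this, of "1 / (2 * of_real pi)"] show ?thesis
    by (simp add: vertical_integral_def mult_ac)
qed

text \<open>
  Move the line of every term to \<open>Re w = c\<close>, where the Dirichlet series of \<open>d\<^sub>k\<close> converges absolutely,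
  and sum over \<open>j\<close> under the integral.
\<close>
lemma Psi_eq_vertical_integral:
  assumes "k \<ge> 1" "\<mu> < 0" "\<rho> > 0" "x > 0" "c > 1"
  shows "Psi \<mu> \<rho> k x = vertical_integral c
     (\<lambda>w. mellin_kernel k w * of_real (\<rho> * x) powr (- w) * riemann_zeta w ^ k)"
proof -
  have meijer: "of_real (pi powr (real k / 2 - 1) / 2 ^ (k - 1)) * meijer_G \<mu> k (\<rho>\<^sup>2 * (real (Suc i))\<^sup>2 * x\<^sup>2 / 2 ^ (2 * k)) =
      vertical_integral c (\<lambda>w. mellin_kernel k w * of_real (\<rho> * x) powr (- w) * of_nat (Suc i) powr (- w))" for i
  proof -
    define b where "b = \<rho> * real (Suc i) * x"
    have b: "b > 0" using assms by (simp add: b_def)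
    have "of_real (pi powr (real k / 2 - 1) / 2 ^ (k - 1)) * meijer_G \<mu> k (b\<^sup>2 / 2 ^ (2 * k)) =
        vertical_integral c (\<lambda>w. mellin_kernel k w * of_real b powr (- w))"
      using meijer_G_eq_vertical_integral[of k \<mu> b] vertical_integral_mellin_kernel_eq[of k b "- 2 * \<mu>" c] assms b
      by simp
    moreover have "of_real b powr (- w) = of_real (\<rho> * x) powr (- w) * of_nat (Suc i) powr (- w)" for w :: complex
    proof -
      have "complex_of_real b = of_real (\<rho> * x) * of_nat (Suc i)" by (simp add: b_def mult_ac)
      then show ?thesis using assms by (simp only:) (rule powr_times_real, auto)
    qed
    ultimately show ?thesis by (simp add: b_def power_mult_distrib mult.assoc)
  qed
  have growth: "vertical_growth (- pi / 2 + 0) {c..c} (\<lambda>w. mellin_kernel k w * of_real (\<rho> * x) powr (- w))"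
    using assms by (intro vertical_growth_mult vertical_growth_mellin_kernel vertical_growth_powr_minus) auto
  have cont: "continuous_on {s. Re s = c} (\<lambda>w. mellin_kernel k w * of_real (\<rho> * x) powr (- w))"
    using assms
    by (intro holomorphic_on_imp_continuous_on holomorphic_intros holomorphic_on_subset[OF holomorphic_mellin_kernel]) auto
  have "(\<lambda>i. of_nat (piltz k (Suc i)) *
      vertical_integral c (\<lambda>w. mellin_kernel k w * of_real (\<rho> * x) powr (- w) * of_nat (Suc i) powr (- w))) sums
      vertical_integral c (\<lambda>w. mellin_kernel k w * of_real (\<rho> * x) powr (- w) * riemann_zeta w ^ k)"
  proof (rule vertical_integral_dirichlet_series)
    show "integrable lborel (\<lambda>t. mellin_kernel k (Complex c t) * of_real (\<rho> * x) powr (- Complex c t))"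
      using integrable_vertical_line[OF growth _ _ cont] by simp
    show "summable (\<lambda>i. norm (of_nat (piltz k (Suc i)) :: complex) * real (Suc i) powr (- c))"
      using piltz_summable[of "of_real c" k] assms by simp
    show "(\<lambda>i. of_nat (piltz k (Suc i)) * of_nat (Suc i) powr (- Complex c t)) sums riemann_zeta (Complex c t) ^ k" for t
      using assms by (intro piltz_sums) simp
  qed
  then have "(\<lambda>i. of_real (pi powr (real k / 2 - 1) / 2 ^ (k - 1)) *
       (of_nat (piltz k (Suc i)) * meijer_G \<mu> k (\<rho>\<^sup>2 * (real (Suc i))\<^sup>2 * x\<^sup>2 / 2 ^ (2 * k)))) sums
      vertical_integral c (\<lambda>w. mellin_kernel k w * of_real (\<rho> * x) powr (- w) * riemann_zeta w ^ k)"
    unfolding meijer[symmetric] by (simp only: mult.left_commute)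
  moreover have "complex_of_real (pi powr (real k / 2 - 1) / 2 ^ (k - 1)) \<noteq> 0" by simp
  ultimately show ?thesis
    unfolding Psi_def Let_def by (subst suminf_mult[symmetric]) (auto simp: sums_iff summable_cmult_iff simp del: of_nat_Suc of_real_divide)
qed

section \<open>The integrand of the transformation formula\<close>

lemma cos_pi_half_eq_0_iff:
  fixes w :: complex
  shows "cos (of_real pi * w / 2) = 0 \<longleftrightarrow> (\<exists>n::int. w = of_int (2 * n + 1))"
proof -
  have "of_real pi * w / 2 = complex_of_real (of_int n * pi) + of_real pi / 2 \<longleftrightarrow> w = of_int (2 * n + 1)" for n :: int
  proof -
    have "of_real pi * w / 2 = complex_of_real (of_int n * pi) + of_real pi / 2 \<longleftrightarrow>
        of_real pi * w = of_real pi * (of_int (2 * n + 1))"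
      by (simp add: field_simps)
    then show ?thesis by simp
  qed
  then show ?thesis by (simp add: cos_eq_0)
qed

text \<open>
  If also \<open>f z = 0\<close>, the singularity is removable; the formula for simple poles then applies to the
  numerators \<open>f + 1\<close> and \<open>1\<close> instead. Thus poles that are cancelled by zeros of \<open>\<zeta>\<close> can be
  treated like the others.
\<close>
lemma residue_simple_zero_quotient:
  assumes "f holomorphic_on A" "g holomorphic_on A" "open A" "connected A" "z \<in> A"
    and "(g has_field_derivative g') (at z)" "g z = 0" "g' \<noteq> 0" "\<And>w. w \<in> A - {z} \<Longrightarrow> g w \<noteq> 0"
  shows "residue (\<lambda>w. f w / g w) z = f z / g'"
proof (cases "f z = 0")
  case False
  then show ?thesis using assms by (intro residue_simple_pole_deriv[of f A g]) auto
next
  case True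
  have "residue (\<lambda>w. (f w + 1) / g w - 1 / g w) z =
      residue (\<lambda>w. (f w + 1) / g w) z - residue (\<lambda>w. 1 / g w) z"
    using assms by (intro residue_diff[of A]) (auto intro!: holomorphic_intros intro: holomorphic_on_subset)
  also have "residue (\<lambda>w. (f w + 1) / g w) z = (f z + 1) / g'"
    using assms True by (intro residue_simple_pole_deriv[of "\<lambda>w. f w + 1" A g]) (auto intro!: holomorphic_intros)
  also have "residue (\<lambda>w. 1 / g w) z = 1 / g'"
    using assms by (intro residue_simple_pole_deriv[of "\<lambda>w. 1" A g]) auto
  finally show ?thesis using True by (simp add: diff_divide_distrib add_divide_distrib)
qed

text \<open>
  The form given by the functional equation. It is meromorphic on the whole plane, with singularities that can
  be read off, and its symmetry is visible.
\<close>
definition mellin_integrand :: "nat \<Rightarrow> int \<Rightarrow> real \<Rightarrow> complex \<Rightarrow> complex" where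
  "mellin_integrand k m a w = of_real (pi / a) powr (of_nat k * w) * riemann_zeta (1 - w) ^ k *
     riemann_zeta (of_int (2 * m + 1) + w) ^ k / (2 ^ k * cos (of_real pi * w / 2))"

definition bracket_function :: "nat \<Rightarrow> int \<Rightarrow> real \<Rightarrow> complex \<Rightarrow> complex" where
  "bracket_function k m a s =
     riemann_zeta (of_int (2 * m + 1) + s) ^ k * riemann_zeta s ^ k * Gamma (s + 1) ^ k *
       cos (of_real pi * s / 2) ^ (k - 1) * of_real (2 * a) powr (- (of_nat k * s))"

lemma mellin_integrand_eq:
  assumes "k \<ge> 1" "a > 0" "w \<notin> \<int>\<^sub>\<le>\<^sub>0" "w \<noteq> 1" "cos (of_real pi * w / 2) \<noteq> 0"
  shows "mellin_integrand k m a w = mellin_kernel k w * riemann_zeta w ^ k *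
    riemann_zeta (of_int (2 * m + 1) + w) ^ k * of_real (2 * a) powr (- (of_nat k * w))"
proof -
  define c where "c = cos (of_real pi * w / 2)"
  define z1 where "z1 = riemann_zeta (of_int (2 * m + 1) + w) ^ k"
  have FE: "riemann_zeta (1 - w) = 2 * of_real (2 * pi) powr (- w) * c * Gamma w * riemann_zeta w"
    using zeta_functional_equation[OF assms(3,4)] by (simp add: zeta_factor_def c_def)
  have ck: "c ^ k / c = c ^ (k - 1)" using assms(1,5) by (cases k) (auto simp: c_def)
  have p: "of_real (pi / a) powr (of_nat k * w) * (of_real (2 * pi) powr (- w)) ^ k =
      complex_of_real (2 * a) powr (- (of_nat k * w))"
  proof -
    have "pi / a > 0" "2 * pi > 0" "2 * a > 0" using assms(2) by auto
    moreover have "ln (pi / a) = ln pi - ln a" "ln (2 * pi) = ln 2 + ln pi" "ln (2 * a) = ln 2 + ln a"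
      using assms(2) by (simp_all add: ln_div ln_mult)
    ultimately show ?thesis
      by (simp only: complex_powr_pos exp_of_nat_mult[symmetric] exp_add[symmetric])
         (rule arg_cong[where f = exp], simp add: algebra_simps)
  qed
  have "mellin_integrand k m a w = (of_real (pi / a) powr (of_nat k * w) * (of_real (2 * pi) powr (- w)) ^ k) *
      (c ^ k / c) * Gamma w ^ k * riemann_zeta w ^ k * z1"
    unfolding mellin_integrand_def FE by (simp add: z1_def c_def power_mult_distrib)
  also have "\<dots> = mellin_kernel k w * riemann_zeta w ^ k * z1 * of_real (2 * a) powr (- (of_nat k * w))"
    unfolding p ck by (simp add: mellin_kernel_def c_def)
  finally show ?thesis by (simp add: z1_def)
qed

lemma vertical_integral_cong:
  assumes "\<And>w. Re w = c \<Longrightarrow> f w = g w"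
  shows "vertical_integral c f = vertical_integral c g"
  using assms by (simp add: vertical_integral_def)

lemma series_eq_vertical_integral:
  assumes "k \<ge> 1" "\<mu> < 0" "a > 0" "c > 1" "c + 2 * of_int m > 0"
    and "\<And>n::int. c \<noteq> of_int (2 * n + 1)"
  shows "(\<Sum>i. let n = Suc i in
        of_nat (piltz k n) / of_nat n powi (2 * m + 1) * Psi \<mu> ((2 * a) ^ k) k (real n)) =
      vertical_integral c (mellin_integrand k m a)"
proof -
  define \<rho> where "\<rho> = (2 * a) ^ k"
  have \<rho>: "\<rho> > 0" using assms by (simp add: \<rho>_def)
  define g where "g = (\<lambda>w. mellin_kernel k w * of_real \<rho> powr (- w) * riemann_zeta w ^ k)"
  define b where "b = (\<lambda>i. of_nat (piltz k (Suc i)) / of_nat (Suc i) powi (2 * m + 1) :: complex)"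
  have b: "b i * of_nat (Suc i) powr (- w) = of_nat (piltz k (Suc i)) * of_nat (Suc i) powr (- (of_int (2 * m + 1) + w))" for i w
  proof -
    have "of_nat (Suc i) powi (2 * m + 1) = (of_nat (Suc i) powr of_int (2 * m + 1) :: complex)"
      by (rule complex_powr_of_int[symmetric]) (simp del: of_nat_Suc)
    then show ?thesis
      unfolding b_def powr_minus powr_add by (simp only: divide_inverse inverse_mult_distrib mult.assoc)
  qed
  have Psi: "Psi \<mu> \<rho> k (real (Suc i)) = vertical_integral c (\<lambda>w. g w * of_nat (Suc i) powr (- w))" for i
  proof -
    have "Psi \<mu> \<rho> k (real (Suc i)) = vertical_integral c
       (\<lambda>w. mellin_kernel k w * of_real (\<rho> * real (Suc i)) powr (- w) * riemann_zeta w ^ k)"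
      using assms \<rho> by (intro Psi_eq_vertical_integral) auto
    also have "\<dots> = vertical_integral c (\<lambda>w. g w * of_nat (Suc i) powr (- w))"
    proof (rule vertical_integral_cong)
      fix w :: complex
      have "of_real (\<rho> * real (Suc i)) powr (- w) = of_real \<rho> powr (- w) * of_nat (Suc i) powr (- w)"
        unfolding of_real_mult of_real_of_nat_eq using \<rho> by (intro powr_times_real) auto
      then show "mellin_kernel k w * of_real (\<rho> * real (Suc i)) powr (- w) * riemann_zeta w ^ k =
          g w * of_nat (Suc i) powr (- w)" by (simp only: g_def mult_ac)
    qed
    finally show ?thesis .
  qed
  have growth: "vertical_growth (- pi / 2 + 0 + of_nat k * 0) {c..c} g"
    unfolding g_def using assms \<rho>
    by (intro vertical_growth_mult vertical_growth_power vertical_growth_mellin_kernel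
        vertical_growth_powr_minus vertical_growth_zeta) auto
  have "riemann_zeta holomorphic_on {s. Re s = c}"
    using holomorphic_zeta unfolding riemann_zeta_eq by (rule holomorphic_on_subset) (use assms in auto)
  moreover have "mellin_kernel k holomorphic_on {s. Re s = c}"
    by (rule holomorphic_on_subset[OF holomorphic_mellin_kernel]) (use assms in auto)
  ultimately have cont: "continuous_on {s. Re s = c} g"
    unfolding g_def using \<rho> by (intro holomorphic_on_imp_continuous_on holomorphic_intros) auto
  have "(\<lambda>i. b i * vertical_integral c (\<lambda>w. g w * of_nat (Suc i) powr (- w))) sums
      vertical_integral c (\<lambda>w. g w * riemann_zeta (of_int (2 * m + 1) + w) ^ k)"
  proof (rule vertical_integral_dirichlet_series)
    show "integrable lborel (\<lambda>t. g (Complex c t))"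
      using integrable_vertical_line[OF growth _ _ cont] by simp
    have "norm (b i) * real (Suc i) powr (- c) =
        real (piltz k (Suc i)) * real (Suc i) powr (- Re (of_int (2 * m + 1) + of_real c))" for i
    proof -
      have "norm (b i * of_nat (Suc i) powr (- of_real c)) =
          norm (of_nat (piltz k (Suc i)) * of_nat (Suc i) powr (- (of_int (2 * m + 1) + of_real c)) :: complex)"
        by (simp only: b)
      moreover have "norm (of_nat (Suc i) powr w :: complex) = real (Suc i) powr (Re w)" for w
        by (subst norm_powr_real_powr) auto
      ultimately show ?thesis by (simp add: norm_mult del: of_nat_Suc)
    qed
    moreover have "summable (\<lambda>i. real (piltz k (Suc i)) * real (Suc i) powr (- Re (of_int (2 * m + 1) + of_real c)))"
      using assms by (intro piltz_summable) auto
    ultimately show "summable (\<lambda>i. norm (b i) * real (Suc i) powr (- c))" by (simp only:)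
    show "(\<lambda>i. b i * of_nat (Suc i) powr (- Complex c t)) sums
        (riemann_zeta (of_int (2 * m + 1) + Complex c t) ^ k)" for t
      unfolding b using assms by (intro piltz_sums) auto
  qed
  also have "vertical_integral c (\<lambda>w. g w * riemann_zeta (of_int (2 * m + 1) + w) ^ k) =
      vertical_integral c (mellin_integrand k m a)"
  proof (rule vertical_integral_cong)
    fix w assume w: "Re w = c"
    have "w \<notin> \<int>\<^sub>\<le>\<^sub>0" "w \<noteq> 1" using w assms by (auto elim!: nonpos_Ints_cases)
    moreover have "cos (of_real pi * w / 2) \<noteq> 0"
      unfolding cos_pi_half_eq_0_iff
    proof
      assume "\<exists>n::int. w = of_int (2 * n + 1)"
      then obtain n :: int where "w = of_int (2 * n + 1)" ..
      then have "Re w = of_int (2 * n + 1)" by simp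
      with w assms(6) show False by blast
    qed
    moreover have "complex_of_real \<rho> powr (- w) = of_real (2 * a) powr (- (of_nat k * w))"
    proof -
      have "2 * a > 0" using assms(3) by simp
      have "ln \<rho> = real k * ln (2 * a)" unfolding \<rho>_def by (rule ln_realpow)
      then show ?thesis unfolding complex_powr_pos[OF \<rho>] complex_powr_pos[OF \<open>2 * a > 0\<close>]
        by (simp add: mult_ac)
    qed
    ultimately show "g w * riemann_zeta (of_int (2 * m + 1) + w) ^ k = mellin_integrand k m a w"
      using mellin_integrand_eq[OF assms(1,3), of w m] by (simp add: g_def mult_ac)
  qed
  finally have "(\<Sum>i. b i * vertical_integral c (\<lambda>w. g w * of_nat (Suc i) powr (- w))) =
      vertical_integral c (mellin_integrand k m a)" by (rule sums_unique[symmetric])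
  then show ?thesis
    unfolding Let_def \<rho>_def[symmetric] Psi by (simp only: b_def)
qed

lemma holomorphic_mellin_integrand:
  assumes "a > 0" "0 \<notin> A" "- 2 * of_int m \<notin> A" "\<And>n::int. of_int (2 * n + 1) \<notin> A"
  shows "mellin_integrand k m a holomorphic_on A"
proof -
  have z: "riemann_zeta holomorphic_on - {1}" using holomorphic_zeta by (simp add: riemann_zeta_eq)
  have "(\<lambda>w. riemann_zeta (1 - w)) holomorphic_on A"
    by (rule holomorphic_on_compose_gen[OF _ z, unfolded o_def])
       (use assms in \<open>auto intro!: holomorphic_intros\<close>)
  moreover have "(\<lambda>w. riemann_zeta (of_int (2 * m + 1) + w)) holomorphic_on A"
  proof (rule holomorphic_on_compose_gen[OF _ z, unfolded o_def])
    have "of_int (2 * m + 1) + w \<noteq> 1" if "w \<in> A" for w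
    proof
      assume "of_int (2 * m + 1) + w = 1"
      then have "w = - 2 * of_int m" by (simp add: add_eq_0_iff)
      with that assms(3) show False by blast
    qed
    then show "(\<lambda>w. of_int (2 * m + 1) + w) ` A \<subseteq> - {1}" by auto
  qed (intro holomorphic_intros)
  moreover have "cos (of_real pi * w / 2) \<noteq> 0" if "w \<in> A" for w
    using that assms(4) by (auto simp: cos_pi_half_eq_0_iff)
  ultimately show ?thesis
    unfolding mellin_integrand_def[abs_def] using assms(1) by (intro holomorphic_intros) auto
qed

lemma vertical_growth_mellin_integrand:
  assumes "a > 0"
  shows "vertical_growth (- pi / 2) {x..y} (mellin_integrand k m a)"
proof -
  have 1: "vertical_growth 0 {x..y} (\<lambda>w. riemann_zeta (of_real 1 - w))"
    by (rule vertical_growth_compose[OF vertical_growth_zeta[of "1 - y" "1 - x"]]) auto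
  have 2: "vertical_growth 0 {x..y} (\<lambda>w. riemann_zeta (of_real (of_int (2 * m + 1)) + w))"
    by (rule vertical_growth_compose[OF vertical_growth_zeta[of "of_int (2 * m + 1) + x" "of_int (2 * m + 1) + y"]]) auto
  have "vertical_growth (0 + of_nat k * 0 + of_nat k * 0 + 0 + (- pi / 2)) {x..y}
    (\<lambda>w. of_real (pi / a) powr (of_real (real k) * w) * riemann_zeta (of_real 1 - w) ^ k *
     riemann_zeta (of_real (of_int (2 * m + 1)) + w) ^ k * (1 / 2 ^ k) * inverse (cos (of_real pi * w / 2)))"
    using assms
    by (intro vertical_growth_mult vertical_growth_power vertical_growth_powr vertical_growth_inverse_cos
        vertical_growth_bounded[where C = "1 / 2 ^ k"] 1 2)
       (auto simp: norm_divide norm_power)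
  then show ?thesis
    by (simp add: mellin_integrand_def[abs_def] field_simps)
qed

section \<open>Reflection and residues of the integrand\<close>

lemma vertical_integral_reflect:
  "vertical_integral (d - c) f = vertical_integral c (\<lambda>w. f (of_real d - w))"
proof -
  have "(\<integral>t. f (Complex (d - c) t) \<partial>lborel) = (\<integral>t. f (Complex (d - c) (0 + (- 1) * t)) \<partial>lborel)"
    using lborel_integral_real_affine[of "- 1" "\<lambda>t. f (Complex (d - c) t)" 0] by simp
  also have "(\<lambda>t. f (Complex (d - c) (0 + (- 1) * t))) = (\<lambda>t. f (of_real d - Complex c t))"
    by (intro ext arg_cong[where f = f]) (simp add: complex_eq_iff)
  finally show ?thesis by (simp add: vertical_integral_def)
qed

lemma vertical_integral_mult_left:
  "vertical_integral c (\<lambda>w. x * f w) = x * vertical_integral c f"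
  by (simp add: vertical_integral_def)

lemma power_powi_eq_exp:
  assumes "x > 0"
  shows "(x ^ k) powi n = exp (of_int n * (real k * ln x))"
proof -
  have "(x ^ k) powi n = (x ^ k) powr of_int n"
    using assms by (intro powr_real_of_int'[symmetric]) auto
  also have "\<dots> = exp (of_int n * ln (x ^ k))" using assms by (simp add: powr_def)
  also have "ln (x ^ k) = real k * ln x" by (rule ln_realpow)
  finally show ?thesis .
qed

text \<open>
  The two zeta factors are exchanged, the cosine changes by \<open>(-1)\<^sup>m\<close>, and \<open>\<pi>/\<alpha>\<close> is the inverse of
  \<open>\<pi>/\<beta>\<close>. The powers of \<open>\<alpha>\<close> and \<open>\<beta>\<close> in front are the ones of the transformation formula.
\<close>
lemma mellin_integrand_reflect:
  assumes "a > 0" "b > 0" "a * b = pi\<^sup>2"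
  shows "of_real ((a ^ k) powi (- m)) * mellin_integrand k m a (- 2 * of_int m - w) =
         of_real ((- (b ^ k)) powi (- m)) * mellin_integrand k m b w"
proof -
  have "ln (a * b) = ln a + ln b" using assms(1,2) by (simp add: ln_mult)
  moreover have "ln (pi\<^sup>2) = 2 * ln pi" using ln_realpow[of pi 2] by simp
  ultimately have ln_b: "ln b = 2 * ln pi - ln a" using assms(3) by simp
  have cos: "cos (of_real pi * (- 2 * of_int m - w) / 2) = (- 1) powi m * cos (of_real pi * w / 2)"
  proof -
    have "of_real pi * (- 2 * of_int m - w) / 2 = - (of_real pi * w / 2 + complex_of_real (pi * of_int m))"
      by (simp add: field_simps)
    then have "cos (of_real pi * (- 2 * of_int m - w) / 2) =
        cos (of_real pi * w / 2 + complex_of_real (pi * of_int m))"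
      by (simp only: cos_minus)
    also have "\<dots> = cos (of_real pi * w / 2) * of_real (cos (pi * of_int m)) -
        sin (of_real pi * w / 2) * of_real (sin (pi * of_int m))"
      by (simp only: cos_add cos_of_real sin_of_real)
    also have "sin (pi * of_int m) = 0" by simp
    also have "cos (pi * of_int m) = (- 1) powi m" by (simp add: power_int_minus_left)
    finally show ?thesis by simp
  qed
  define P where "P = (\<lambda>a w. complex_of_real (pi / a) powr (of_nat k * w))"
  have P: "of_real ((a ^ k) powi (- m)) * P a (- 2 * of_int m - w) = of_real ((b ^ k) powi (- m)) * P b w"
  proof -
    have pos: "pi / a > 0" "pi / b > 0" using assms by auto
    have ln: "ln (pi / a) = ln pi - ln a" "ln (pi / b) = ln a - ln pi"
      using assms(1,2) by (simp_all add: ln_div ln_b)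
    show ?thesis
      unfolding P_def power_powi_eq_exp[OF assms(1)] power_powi_eq_exp[OF assms(2)]
        complex_powr_pos[OF pos(1)] complex_powr_pos[OF pos(2)] exp_of_real[symmetric] exp_add[symmetric] ln ln_b
      by (rule arg_cong[where f = exp]) (simp add: algebra_simps)
  qed
  define z z' D where "z = riemann_zeta (of_int (2 * m + 1) + w) ^ k"
    and "z' = riemann_zeta (1 - w) ^ k" and "D = 2 ^ k * cos (of_real pi * w / 2)"
  have args: "1 - (- 2 * of_int m - w) = of_int (2 * m + 1) + w"
    "of_int (2 * m + 1) + (- 2 * of_int m - w) = 1 - w" by simp_all
  have "x / (2 ^ k * ((- 1) powi m * y)) = (- 1) powi m * (x / (2 ^ k * y))" for x y :: complex
    by (cases "even m") (simp_all add: power_int_minus_left)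
  then have 1: "mellin_integrand k m a (- 2 * of_int m - w) = (- 1) powi m * (P a (- 2 * of_int m - w) * z * z' / D)"
    unfolding mellin_integrand_def cos args by (simp only: P_def z_def z'_def D_def)
  have 2: "mellin_integrand k m b w = P b w * z' * z / D"
    by (simp only: mellin_integrand_def P_def z_def z'_def D_def)
  have 3: "complex_of_real ((- (b ^ k)) powi (- m)) = (- 1) powi m * of_real ((b ^ k) powi (- m))"
    by (cases "even m") (simp_all add: power_int_minus_left)
  have "x * (s * (p * z * z' / D)) = s * y * (q * z' * z / D)" if "x * p = y * q" for x y p q s :: complex
  proof -
    have "x * (s * (p * z * z' / D)) = s * (x * p) * (z * z' / D)" by simp
    then show ?thesis unfolding that by (simp add: mult_ac)
  qed
  from this[OF P] show ?thesis unfolding 1 2 3 .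
qed

text \<open>
  For \<open>m = 0\<close> the factor \<open>\<zeta>(2m + 1 + s)\<close> would have its pole at \<open>s = 0\<close>; for \<open>m \<noteq> 0\<close> the pole
  is at distance at least \<open>2\<close>.
\<close>
lemma holomorphic_bracket_function:
  assumes "m \<noteq> 0" "a > 0"
  shows "bracket_function k m a holomorphic_on ball 0 1"
proof -
  have z: "riemann_zeta holomorphic_on - {1}" using holomorphic_zeta by (simp add: riemann_zeta_eq)
  have "(\<lambda>w. riemann_zeta (of_int (2 * m + 1) + w)) holomorphic_on ball 0 1"
  proof (rule holomorphic_on_compose_gen[OF _ z, unfolded o_def])
    have "of_int (2 * m + 1) + w \<noteq> 1" if "w \<in> ball 0 1" for w :: complex
    proof
      assume "of_int (2 * m + 1) + w = 1"
      then have "w = of_int (- 2 * m)" by (simp add: add_eq_0_iff)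
      then have "norm w = \<bar>of_int (- 2 * m)\<bar>" by (simp only: norm_of_int)
      with that assms(1) show False by simp
    qed
    then show "(\<lambda>w. of_int (2 * m + 1) + w) ` ball 0 1 \<subseteq> - {1 :: complex}"
      by (auto simp only: image_subset_iff Compl_iff singleton_iff)
  qed (intro holomorphic_intros)
  moreover have "riemann_zeta holomorphic_on ball 0 1" by (rule holomorphic_on_subset[OF z]) auto
  moreover have "w + 1 \<notin> \<int>\<^sub>\<le>\<^sub>0" if "w \<in> ball 0 1" for w :: complex
    using that abs_Re_le_cmod[of w] by (auto elim!: nonpos_Ints_cases simp: complex_eq_iff)
  ultimately show ?thesis
    unfolding bracket_function_def[abs_def] using assms(2) by (intro holomorphic_intros) auto
qed

lemma mellin_integrand_near_0:
  assumes "k \<ge> 1" "a > 0" "w \<in> ball 0 1 - {0}"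
  shows "mellin_integrand k m a w = bracket_function k m a w / w ^ k"
proof -
  have re: "\<bar>Re w\<bar> < 1" using assms(3) abs_Re_le_cmod[of w] by simp
  have w: "w \<notin> \<int>\<^sub>\<le>\<^sub>0" "w \<noteq> 1" "w \<noteq> 0"
    using assms(3) re by (auto elim!: nonpos_Ints_cases)
  have c: "cos (of_real pi * w / 2) \<noteq> 0"
    unfolding cos_pi_half_eq_0_iff
  proof
    assume "\<exists>n::int. w = of_int (2 * n + 1)"
    then obtain n :: int where "w = of_int (2 * n + 1)" ..
    then have "\<bar>of_int (2 * n + 1) :: real\<bar> < 1" using re by simp
    then have "\<bar>2 * n + 1\<bar> < 1" by linarith
    then show False by presburger
  qed
  have "Gamma (w + 1) = w * Gamma w" using w(1) by (rule Gamma_plus1)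
  then show ?thesis
    using mellin_integrand_eq[OF assms(1,2) w(1,2) c, of m] w(3)
    by (simp add: bracket_function_def mellin_kernel_def power_mult_distrib)
qed

text \<open>
  The derivative in the bracket extracts the coefficient of \<open>s\<^sup>k\<^sup>-\<^sup>1\<close>, because
  \<open>\<Gamma>(s)\<^sup>k = \<Gamma>(s + 1)\<^sup>k / s\<^sup>k\<close>.
\<close>
lemma residue_mellin_integrand_0:
  assumes "k \<ge> 1" "m \<noteq> 0" "a > 0"
  shows "residue (mellin_integrand k m a) 0 = 1 / fact (k - 1) * (deriv ^^ (k - 1)) (bracket_function k m a) 0"
proof -
  have "residue (mellin_integrand k m a) 0 = residue (\<lambda>w. bracket_function k m a w / w ^ Suc (k - 1)) 0"
  proof (rule residue_cong)
    have "\<forall>\<^sub>F w in at 0. w \<in> ball (0::complex) 1 - {0}"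
      by (rule eventually_at_in_open) auto
    then show "\<forall>\<^sub>F w in at 0. mellin_integrand k m a w = bracket_function k m a w / w ^ Suc (k - 1)"
      by eventually_elim (use assms mellin_integrand_near_0 in auto)
  qed simp
  also have "\<dots> = (deriv ^^ (k - 1)) (bracket_function k m a) 0 / fact (k - 1)"
    by (rule residue_holomorphic_over_power'[OF _ _ holomorphic_bracket_function]) (use assms in auto)
  finally show ?thesis by simp
qed

text \<open>
  A reflection of the argument changes the sign of a residue. Here it is computed from the explicit form
  of the pole, whose order contributes \<open>(-1)\<^sup>k\<close> and whose derivative contributes \<open>(-1)\<^sup>k\<^sup>-\<^sup>1\<close>.
\<close>
lemma residue_mellin_integrand_reflect:
  assumes "k \<ge> 1" "m \<noteq> 0" "b > 0"
    and "\<And>w. f (- 2 * of_int m - w) = x * mellin_integrand k m b w"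
  shows "residue f (- 2 * of_int m) = - (x * residue (mellin_integrand k m b) 0)"
proof -
  define p where "p = (- 2 * of_int m :: complex)"
  define B where "B = bracket_function k m b"
  have B: "B holomorphic_on ball 0 1" unfolding B_def by (rule holomorphic_bracket_function[OF assms(2,3)])
  have im: "- 1 * w + p \<in> ball 0 1" if "w \<in> ball p 1" for w
  proof -
    have "- 1 * w + p = p - w" by simp
    with that show ?thesis by (simp only: mem_ball dist_norm) (simp add: norm_minus_commute)
  qed
  have B': "(\<lambda>w. B (- 1 * w + p)) holomorphic_on ball p 1"
  proof (rule holomorphic_on_compose_gen[OF _ B, unfolded o_def])
    show "(\<lambda>w. - 1 * w + p) ` ball p 1 \<subseteq> ball 0 1" using im by blast
  qed (intro holomorphic_intros)
  define y where "y = x * (- 1) ^ k"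
  have "residue f p = residue (\<lambda>w. (y * B (- 1 * w + p)) / (w - p) ^ Suc (k - 1)) p"
  proof (rule residue_cong)
    have "\<forall>\<^sub>F w in at p. w \<in> ball p 1 - {p}"
      by (rule eventually_at_in_open) auto
    then show "\<forall>\<^sub>F w in at p. f w = (y * B (- 1 * w + p)) / (w - p) ^ Suc (k - 1)"
    proof eventually_elim
      case (elim w)
      have "norm (p - w) < 1" using elim by (simp add: dist_norm)
      then have "p - w \<in> ball 0 1 - {0}" using elim by auto
      then have "mellin_integrand k m b (p - w) = B (p - w) / (p - w) ^ k"
        unfolding B_def by (rule mellin_integrand_near_0[OF assms(1,3)])
      moreover have "f w = x * mellin_integrand k m b (p - w)"
        using assms(4)[of "p - w"] by (simp add: p_def)
      moreover have "(p - w) ^ k = (- 1) ^ k * (w - p) ^ k"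
        by (simp flip: power_mult_distrib)
      moreover have "u / ((- 1) ^ k * v) = (- 1) ^ k * u / (v :: complex)" for u v
        by (cases "even k") auto
      ultimately show ?case using assms(1) by (simp add: y_def)
    qed
  qed simp
  also have "\<dots> = (deriv ^^ (k - 1)) (\<lambda>w. y * B (- 1 * w + p)) p / fact (k - 1)"
    by (rule residue_holomorphic_over_power[where A = "ball p 1"]) (use B' in \<open>auto intro!: holomorphic_intros\<close>)
  also have "(deriv ^^ (k - 1)) (\<lambda>w. y * B (- 1 * w + p)) p = y * (deriv ^^ (k - 1)) (\<lambda>w. B (- 1 * w + p)) p"
    by (rule higher_deriv_cmult[OF B']) auto
  also have "(deriv ^^ (k - 1)) (\<lambda>w. B (- 1 * w + p)) p = (- 1) ^ (k - 1) * (deriv ^^ (k - 1)) B (- 1 * p + p)"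
    by (rule higher_deriv_compose_linear'[OF B, where S = "ball p 1"]) (use im in auto)
  also have "y * ((- 1) ^ (k - 1) * (deriv ^^ (k - 1)) B (- 1 * p + p)) / fact (k - 1) =
      - (x * residue (mellin_integrand k m b) 0)"
  proof -
    have "(- 1) ^ k * (- 1) ^ (k - 1) = (- 1 :: complex)"
      using assms(1) by (cases k) (simp_all flip: power_add mult_2)
    moreover have "y * ((- 1) ^ (k - 1) * z) = x * ((- 1) ^ k * (- 1) ^ (k - 1)) * z" for z
      by (simp add: y_def)
    ultimately have "y * ((- 1) ^ (k - 1) * z) = - x * z" for z by simp
    then show ?thesis using residue_mellin_integrand_0[OF assms(1-3)] by (simp add: B_def)
  qed
  finally show ?thesis by (simp add: p_def)
qed

text \<open>
  The real number \<open>\<zeta>(2j)\<close> for any integer \<open>j\<close>.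
\<close>
definition zeta_even_value :: "int \<Rightarrow> real" where
  "zeta_even_value j = (if j < 0 then 0 else
     (-1) ^ (nat j + 1) * bernoulli (nat (2 * j)) * (2 * pi) ^ nat (2 * j) / (2 * fact (nat (2 * j))))"

lemma riemann_zeta_even_int: "riemann_zeta (of_int (2 * j)) = of_real (zeta_even_value j)"
proof (cases "j < 0")
  case True
  then obtain n where n: "j = - int n" "n > 0" by (metis neg_int_cases)
  then have "of_int (2 * j) = (- of_nat (2 * n) :: complex)" by simp
  then show ?thesis using zeta_neg_even[OF n(2)] True by (simp only: zeta_even_value_def) simp
next
  case False
  then obtain n where n: "j = int n" by (metis nonneg_int_cases not_less)
  then have "of_int (2 * j) = (of_nat (2 * n) :: complex)" "nat (2 * j) = 2 * n" by simp_all
  then show ?thesis using zeta_even[of n] n by (simp only: zeta_even_value_def) simp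
qed

text \<open>
  Only the cosine vanishes at \<open>1 - 2j\<close>; there \<open>1 - w = 2j\<close> and \<open>2m + 1 + w = 2 (m + 1 - j)\<close>.
\<close>
lemma residue_mellin_integrand_odd:
  assumes "a > 0"
  shows "residue (mellin_integrand k m a) (of_int (1 - 2 * j)) =
    of_real (- (2 / pi) * (- 1) powi j * (pi / a) powi (int k * (1 - 2 * j)) *
       zeta_even_value j ^ k * zeta_even_value (m + 1 - j) ^ k / 2 ^ k)"
proof -
  define p where "p = complex_of_int (1 - 2 * j)"
  define f where "f = (\<lambda>w. of_real (pi / a) powr (of_nat k * w) * riemann_zeta (1 - w) ^ k *
     riemann_zeta (of_int (2 * m + 1) + w) ^ k / 2 ^ k)"
  define g where "g = (\<lambda>w::complex. cos (of_real pi * w / 2))"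
  have only: "w = p" if "w = of_int n" "w \<in> ball p 1" for w n
  proof -
    have "norm (of_int (1 - 2 * j - n) :: complex) < 1" using that by (simp add: p_def dist_norm)
    then have "\<bar>1 - 2 * j - n\<bar> < 1" unfolding norm_of_int by linarith
    then have "n = 1 - 2 * j" by linarith
    then show ?thesis using that by (simp add: p_def)
  qed
  have z: "riemann_zeta holomorphic_on - {1}" using holomorphic_zeta by (simp add: riemann_zeta_eq)
  have ne: "w \<noteq> of_int (2 * n)" if "w \<in> ball p 1" for w and n :: int
  proof
    assume "w = of_int (2 * n)"
    with only[OF this that] have "of_int (2 * n) = p" by simp
    then have "2 * n = 1 - 2 * j" unfolding p_def of_int_eq_iff .
    then show False by presburger
  qed
  have "(\<lambda>w. riemann_zeta (1 - w)) holomorphic_on ball p 1"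
  proof (rule holomorphic_on_compose_gen[OF _ z, unfolded o_def])
    show "(\<lambda>w. 1 - w) ` ball p 1 \<subseteq> - {1}" using ne[of 0 0] by auto
  qed (intro holomorphic_intros)
  moreover have "(\<lambda>w. riemann_zeta (of_int (2 * m + 1) + w)) holomorphic_on ball p 1"
  proof (rule holomorphic_on_compose_gen[OF _ z, unfolded o_def])
    have "of_int (2 * m + 1) + w \<noteq> 1" if "w \<in> ball p 1" for w
    proof
      assume "of_int (2 * m + 1) + w = 1"
      then have "w = of_int (2 * (- m))" by (simp add: add_eq_0_iff)
      with ne[OF that] show False by blast
    qed
    then show "(\<lambda>w. of_int (2 * m + 1) + w) ` ball p 1 \<subseteq> - {1}"
      by (auto simp only: image_subset_iff Compl_iff singleton_iff)
  qed (intro holomorphic_intros)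
  ultimately have f: "f holomorphic_on ball p 1"
    unfolding f_def using assms by (intro holomorphic_intros) auto
  have s: "sin (of_real pi * p / 2) = of_real ((- 1) powi j)"
  proof -
    have "of_real pi * p / 2 = complex_of_real (pi / 2 - pi * of_int j)" by (simp add: p_def field_simps)
    then have "sin (of_real pi * p / 2) = of_real (sin (pi / 2 - pi * of_int j))" by (simp only: sin_of_real)
    also have "sin (pi / 2 - pi * of_int j) = cos (pi * of_int j)" by (simp add: sin_diff)
    also have "\<dots> = (- 1) powi j" by (simp add: power_int_minus_left)
    finally show ?thesis .
  qed
  have "residue (\<lambda>w. f w / g w) p = f p / (- sin (of_real pi * p / 2) * (of_real pi / 2))"
  proof (rule residue_simple_zero_quotient[OF f])
    show "(g has_field_derivative - sin (of_real pi * p / 2) * (of_real pi / 2)) (at p)"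
      unfolding g_def by (auto intro!: derivative_eq_intros)
    show "g p = 0" unfolding g_def cos_pi_half_eq_0_iff by (intro exI[of _ "- j"]) (simp add: p_def)
    show "- sin (of_real pi * p / 2) * (of_real pi / 2) \<noteq> 0" unfolding s by simp
    show "g w \<noteq> 0" if "w \<in> ball p 1 - {p}" for w
      using that only[of w] unfolding g_def cos_pi_half_eq_0_iff by blast
  qed (auto simp: g_def intro!: holomorphic_intros)
  also have "(\<lambda>w. f w / g w) = mellin_integrand k m a"
    by (simp add: f_def g_def mellin_integrand_def[abs_def])
  also have "f p = of_real ((pi / a) powi (int k * (1 - 2 * j)) * zeta_even_value j ^ k * zeta_even_value (m + 1 - j) ^ k / 2 ^ k)"
  proof -
    have "complex_of_real (pi / a) powr (of_nat k * p) = of_real ((pi / a) powi (int k * (1 - 2 * j)))"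
    proof -
      have "of_nat k * p = of_int (int k * (1 - 2 * j))" by (simp add: p_def)
      moreover have "complex_of_real (pi / a) \<noteq> 0" using assms by simp
      then have "complex_of_real (pi / a) powr of_int (int k * (1 - 2 * j)) = of_real (pi / a) powi (int k * (1 - 2 * j))"
        by (intro complex_powr_of_int disjI1)
      ultimately show ?thesis by (simp only: of_real_power_int)
    qed
    moreover have "1 - p = of_int (2 * j)" "of_int (2 * m + 1) + p = of_int (2 * (m + 1 - j))"
      by (simp_all add: p_def)
    ultimately show ?thesis unfolding f_def by (simp only: riemann_zeta_even_int) simp
  qed
  finally have "residue (mellin_integrand k m a) p =
      of_real ((pi / a) powi (int k * (1 - 2 * j)) * zeta_even_value j ^ k * zeta_even_value (m + 1 - j) ^ k / 2 ^ k) /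
      (- of_real ((- 1) powi j) * (of_real pi / 2))" unfolding s .
  moreover have "of_real x / (- of_real ((- 1) powi j) * (of_real pi / 2)) =
      complex_of_real (- (2 / pi) * (- 1) powi j * x)" for x
    by (cases "even j") (simp_all add: power_int_minus_left)
  ultimately show ?thesis
    unfolding p_def by (simp only: times_divide_eq_right mult.assoc)
qed

section \<open>The transformation formula\<close>

lemma bracket_eq_vertical_integral:
  assumes "k \<ge> 1" "m \<noteq> 0" "a > 0" "\<mu> < 0" "c > 1" "c + 2 * of_int m > 0"
    and "\<And>n::int. c \<noteq> of_int (2 * n + 1)"
  shows "bracket \<mu> k m a = vertical_integral c (mellin_integrand k m a) - residue (mellin_integrand k m a) 0"
  unfolding bracket_def residue_mellin_integrand_0[OF assms(1-3)]
    series_eq_vertical_integral[OF assms(1,4,3,5-7)] bracket_function_def[abs_def] ..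

text \<open>
  The abscissa \<open>2M\<close> is even, so that neither of the two lines meets a pole, and it exceeds both \<open>1\<close> and
  \<open>-2m\<close>, so that both Dirichlet series converge on the right-hand line. Between the lines lie \<open>0\<close>, \<open>-2m\<close> and
  the odd integers \<open>1 - 2j\<close> with \<open>1 - M \<le> j \<le> m + M\<close>.
\<close>
lemma mellin_integrand_shift:
  fixes m M :: int
  assumes "a > 0" "m \<noteq> 0" "M = \<bar>m\<bar> + 1"
  shows "vertical_integral (of_int (2 * M)) (mellin_integrand k m a) -
      vertical_integral (- of_int (2 * m) - of_int (2 * M)) (mellin_integrand k m a) =
    residue (mellin_integrand k m a) 0 + residue (mellin_integrand k m a) (- 2 * of_int m) +
    (\<Sum>j\<in>{1 - M..m + M}. residue (mellin_integrand k m a) (of_int (1 - 2 * j)))"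
proof -
  let ?f = "mellin_integrand k m a"
  define P where "P = (\<lambda>j::int. complex_of_int (1 - 2 * j)) ` {1 - M..m + M}"
  have no: "complex_of_int (2 * n) \<notin> P" for n
  proof
    assume "complex_of_int (2 * n) \<in> P"
    then obtain j where "complex_of_int (2 * n) = of_int (1 - 2 * j)" unfolding P_def by blast
    then have "2 * n = 1 - 2 * j" unfolding of_int_eq_iff .
    then show False by presburger
  qed
  define S where "S = insert 0 (insert (- 2 * of_int m) P)"
  have "vertical_integral (of_int (2 * M)) ?f - vertical_integral (- of_int (2 * m) - of_int (2 * M)) ?f =
      (\<Sum>p\<in>S. residue ?f p)"
  proof (rule vertical_integral_shift)
    let ?l = "- of_int (2 * m) - of_int (2 * M) :: real"
    show "?l - 1 / 2 < ?l" "of_int (2 * M) < (of_int (2 * M) + 1 / 2 :: real)" by auto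
    have "- (2 * m) - 2 * M < 2 * M" using assms(3) by linarith
    then show "?l < of_int (2 * M)" by linarith
    show "finite S" by (simp add: S_def P_def)
    show "S \<subseteq> {s. ?l < Re s \<and> Re s < of_int (2 * M)}"
    proof -
      have "?l < Re (of_int n) \<and> Re (of_int n) < of_int (2 * M)" if "- (2 * m) - 2 * M < n" "n < 2 * M" for n
        using that by simp
      from this[of 0] this[of "- 2 * m"] this[of "1 - 2 * j" for j] assms(3) show ?thesis
        unfolding S_def P_def by auto
    qed
    show "?f holomorphic_on {s. ?l - 1 / 2 < Re s \<and> Re s < of_int (2 * M) + 1 / 2} - S"
    proof (rule holomorphic_mellin_integrand[OF assms(1)])
      fix n :: int
      show "of_int (2 * n + 1) \<notin> {s. ?l - 1 / 2 < Re s \<and> Re s < of_int (2 * M) + 1 / 2} - S"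
      proof
        assume n: "of_int (2 * n + 1) \<in> {s. ?l - 1 / 2 < Re s \<and> Re s < of_int (2 * M) + 1 / 2} - S"
        then have "?l - 1 / 2 < of_int (2 * n + 1)" "of_int (2 * n + 1) < (of_int (2 * M) + 1 / 2 :: real)" by auto
        then have "- (2 * m) - 2 * M \<le> 2 * n + 1" "2 * n + 1 \<le> 2 * M" by linarith+
        then have "- n \<in> {1 - M..m + M}" by auto
        moreover have "complex_of_int (2 * n + 1) = of_int (1 - 2 * (- n))" by simp
        ultimately have "of_int (2 * n + 1) \<in> P" unfolding P_def by blast
        with n show False by (simp add: S_def)
      qed
    qed (auto simp: S_def)
    show "vertical_growth (- pi / 2) {?l..of_int (2 * M)} ?f"
      by (rule vertical_growth_mellin_integrand[OF assms(1)])
  qed auto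
  also have "\<dots> = residue ?f 0 + residue ?f (- 2 * of_int m) + (\<Sum>p\<in>P. residue ?f p)"
  proof -
    have "finite P" by (simp add: P_def)
    moreover have "- 2 * of_int m \<notin> P" using no[of "- m"] by simp
    moreover have "0 \<notin> insert (- 2 * of_int m) P" using no[of 0] assms(2) by simp
    ultimately show ?thesis by (simp add: S_def)
  qed
  also have "(\<Sum>p\<in>P. residue ?f p) = (\<Sum>j\<in>{1 - M..m + M}. residue ?f (of_int (1 - 2 * j)))"
    unfolding P_def by (subst sum.reindex) (auto simp: inj_on_def)
  finally show ?thesis .
qed

text \<open>
  The \<open>j\<close>-th term of the finite sum comes from the residue with index \<open>m + 1 - j\<close>. Both sides are products of
  powers of \<open>-1\<close>, \<open>2\<close>, \<open>\<pi>\<close> and \<open>\<alpha>\<close>; writing \<open>m + 1 = I + J\<close> with natural numbers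
  makes all exponents explicit.
\<close>
lemma residue_coefficient_identity:
  fixes \<alpha> \<beta> :: real and m j :: int
  assumes "k \<ge> 1" "\<alpha> > 0" "\<beta> > 0" "\<alpha> * \<beta> = pi\<^sup>2" "0 \<le> j" "j \<le> m + 1"
  shows "(\<alpha> ^ k) powi (- m) * (- (2 / pi) * (- 1) powi (m + 1 - j) * (pi / \<alpha>) powi (int k * (1 - 2 * (m + 1 - j))) *
       zeta_even_value (m + 1 - j) ^ k * zeta_even_value j ^ k / 2 ^ k) =
    (- 1) powi (int k * m + int k + m) * (pi / 2) ^ (k - 1) * 2 powi (2 * int k * m) *
      ((- 1) ^ nat j *
        (bernoulli (nat (2 * m - 2 * j + 2)) ^ k * bernoulli (nat (2 * j)) ^ k /
         (fact (nat (2 * m - 2 * j + 2)) ^ k * fact (nat (2 * j)) ^ k)) *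
        \<alpha> powi (int k * (m + 1 - j)) * \<beta> powi (int k * j))"
proof -
  obtain J where J: "j = int J" using assms(5) by (metis nonneg_int_cases)
  obtain I where I: "m + 1 - j = int I" using assms(6) by (metis nonneg_int_cases diff_ge_0_iff_ge)
  have m: "m = int I + int J - 1" using I J by simp
  have \<beta>: "\<beta> = pi\<^sup>2 / \<alpha>" using assms by (simp add: field_simps)
  define bI bJ fI fJ :: real where "bI = bernoulli (2 * I) ^ k" and "bJ = bernoulli (2 * J) ^ k"
    and "fI = fact (2 * I) ^ k" and "fJ = fact (2 * J) ^ k"
  define A p t where "A = \<alpha> ^ k" and "p = pi ^ k" and "t = (2::real) ^ k"
  have pos: "A > 0" "p > 0" "t > 0" "fI > 0" "fJ > 0"
    using assms by (simp_all add: A_def p_def t_def fI_def fJ_def)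
  have nats: "nat (2 * m - 2 * j + 2) = 2 * I" "nat (2 * j) = 2 * J" "nat j = J"
    using m J by simp_all
  have Z: "zeta_even_value (int n) ^ k =
      ((- 1) ^ (n + 1)) ^ k * bernoulli (2 * n) ^ k * (t ^ n * p ^ n)\<^sup>2 / (t * fact (2 * n) ^ k)" for n
  proof -
    have "((2 * pi) ^ (2 * n)) ^ k = (t ^ n * p ^ n)\<^sup>2"
      by (simp only: t_def p_def power_mult_distrib flip: power_mult) (simp only: mult_ac)
    moreover have n2: "nat (2 * int n) = 2 * n" by simp
    moreover have "(x * b * T / (2 * f)) ^ k = x ^ k * b ^ k * T ^ k / (t * f ^ k)" for x b T f :: real
      by (simp only: power_divide power_mult_distrib t_def)
    moreover have "zeta_even_value (int n) =
        (- 1) ^ (n + 1) * bernoulli (2 * n) * (2 * pi) ^ (2 * n) / (2 * fact (2 * n))"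
      by (simp add: zeta_even_value_def n2)
    ultimately show ?thesis by (simp only:)
  qed
  have 1: "(\<alpha> ^ k) powi (- m) = A / (A ^ I * A ^ J)"
  proof -
    have "- m = 1 - int I - int J" using m by simp
    then show ?thesis using pos by (simp only: A_def[symmetric]) (simp add: power_int_diff)
  qed
  have 2: "(pi / \<alpha>) powi (int k * (1 - 2 * int I)) = (p / A) / (p ^ I / A ^ I)\<^sup>2"
  proof -
    have "(pi / \<alpha>) powi (int k * (1 - 2 * int I)) = (p / A) powi (1 - int (2 * I))"
      by (simp add: power_int_mult p_def A_def power_divide)
    also have "\<dots> = (p / A) powi 1 / (p / A) powi int (2 * I)"
      using pos by (intro power_int_diff) auto
    also have "\<dots> = (p / A) / (p / A) ^ (2 * I)" by (simp only: power_int_of_nat power_int_1_right)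
    finally show ?thesis by (simp add: power_divide power_mult mult.commute[of 2])
  qed
  have 3: "(- 1) powi (int k * m + int k + m) = - ((- 1) ^ (k * (I + J)) * (- 1 :: real) ^ (I + J))"
  proof -
    have "int k * m + int k + m = int (k * (I + J) + (I + J)) - 1" unfolding m by (simp add: algebra_simps)
    moreover have "(- 1) powi (int N - 1) = - ((- 1 :: real) ^ N)" for N
      by (cases "even N") (simp_all add: power_int_minus_left)
    ultimately show ?thesis by (simp only: power_add)
  qed
  have 4: "(pi / 2) ^ (k - 1) = (p / t) * (2 / pi)"
    using assms(1) by (cases k) (simp_all add: p_def t_def power_divide)
  have 5: "2 powi (2 * int k * m) = ((t ^ I * t ^ J) / t)\<^sup>2"
  proof -
    have "2 powi (2 * int k * m) = (t powi m)\<^sup>2"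
      by (simp add: power_int_mult t_def mult.commute[of 2] mult.assoc)
    also have "t powi m = t ^ I * t ^ J / t"
      unfolding m using pos by (simp add: power_int_diff power_int_add)
    finally show ?thesis .
  qed
  have 6: "\<alpha> powi (int k * int I) = A ^ I" by (simp add: power_int_mult A_def)
  have 7: "\<beta> powi (int k * int J) = (p ^ J)\<^sup>2 / A ^ J"
    by (simp add: power_int_mult A_def p_def \<beta> power_divide flip: power_mult) (simp add: mult_ac)
  have sign: "(- 1) ^ I * ((- 1) ^ (I + 1)) ^ k * ((- 1) ^ (J + 1)) ^ k =
      ((- 1) ^ (k * (I + J)) * (- 1) ^ (I + J)) * (- 1 :: real) ^ J"
    by (cases "even I"; cases "even J"; cases "even k") simp_all
  have alg: "A / (AI * AJ) * (- (2 / pi) * s1 * ((p / A) / (pI / AI)\<^sup>2) *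
        (s2 * bI * (tI * pI)\<^sup>2 / (t * fI)) * (s3 * bJ * (tJ * pJ)\<^sup>2 / (t * fJ)) / t) =
      - s4 * ((p / t) * (2 / pi)) * ((tI * tJ) / t)\<^sup>2 * (s5 * (bI * bJ / (fI * fJ)) * AI * (pJ\<^sup>2 / AJ))"
    if s: "s1 * s2 * s3 = s4 * s5" and nz: "AI \<noteq> 0" "AJ \<noteq> 0" "pI \<noteq> 0" for AI AJ pI pJ tI tJ s1 s2 s3 s4 s5 :: real
  proof -
    define X where "X = (2 / pi) * (p / t) * ((tI * tJ) / t)\<^sup>2 * (bI * bJ / (fI * fJ)) * AI * (pJ\<^sup>2 / AJ)"
    have "A / (AI * AJ) * (- (2 / pi) * s1 * ((p / A) / (pI / AI)\<^sup>2) *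
        (s2 * bI * (tI * pI)\<^sup>2 / (t * fI)) * (s3 * bJ * (tJ * pJ)\<^sup>2 / (t * fJ)) / t) = - (s1 * s2 * s3) * X"
      using nz pos by (simp add: X_def field_simps power2_eq_square)
    moreover have "- s4 * ((p / t) * (2 / pi)) * ((tI * tJ) / t)\<^sup>2 * (s5 * (bI * bJ / (fI * fJ)) * AI * (pJ\<^sup>2 / AJ)) =
        - (s4 * s5) * X" by (simp add: X_def mult_ac)
    ultimately show ?thesis by (simp only: s)
  qed
  have nz: "A ^ I \<noteq> 0" "A ^ J \<noteq> 0" "p ^ I \<noteq> 0" using pos by simp_all
  show ?thesis
    using alg[OF sign nz, where tI = "t ^ I" and tJ = "t ^ J" and pJ = "p ^ J"]
    unfolding nats I unfolding J Z 1 2 3 4 5 6 7 power_int_of_nat bI_def bJ_def fI_def fJ_def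
    by (simp only: t_def)
qed

theorem theorem1p1:
  fixes k :: nat and m :: int and \<alpha> \<beta> \<mu> :: real
  assumes "k \<ge> 1" and "m \<noteq> 0"
    and "\<alpha> > 0" and "\<beta> > 0" and "\<alpha> * \<beta> = pi\<^sup>2"
    and "\<mu> < 0"
  shows "of_real ((\<alpha> ^ k) powi (- m)) * bracket \<mu> k m \<alpha> =
         of_real ((- (\<beta> ^ k)) powi (- m)) * bracket \<mu> k m \<beta> +
         of_real ((- 1) powi (int k * m + int k + m) * (pi / 2) ^ (k - 1) *
           2 powi (2 * int k * m) *
           (\<Sum>j\<in>{0..m + 1}. (- 1) ^ nat j *
              (bernoulli (nat (2 * m - 2 * j + 2)) ^ k * bernoulli (nat (2 * j)) ^ k /
               (fact (nat (2 * m - 2 * j + 2)) ^ k * fact (nat (2 * j)) ^ k)) *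
              \<alpha> powi (int k * (m + 1 - j)) * \<beta> powi (int k * j)))"
proof -
  define M where "M = \<bar>m\<bar> + 1"
  define c :: real where "c = of_int (2 * M)"
  define A B where "A = complex_of_real ((\<alpha> ^ k) powi (- m))"
    and "B = complex_of_real ((- (\<beta> ^ k)) powi (- m))"
  let ?F = "mellin_integrand k m"
  define R where "R = (\<lambda>j::int. - (2 / pi) * (- 1) powi j * (pi / \<alpha>) powi (int k * (1 - 2 * j)) *
       zeta_even_value j ^ k * zeta_even_value (m + 1 - j) ^ k / 2 ^ k)"
  have c: "c > 1" "c + 2 * of_int m > 0" "c \<noteq> of_int (2 * n + 1)" for n :: int
  proof -
    have "2 * M > 1" "2 * M + 2 * m > 0" by (auto simp: M_def)
    then have "of_int (2 * M) > (1 :: real)" "of_int (2 * M + 2 * m) > (0 :: real)"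
      by (simp_all only: of_int_0_less_iff of_int_1_less_iff)
    then show "c > 1" "c + 2 * of_int m > 0" by (simp_all add: c_def)
    show "c \<noteq> of_int (2 * n + 1)" unfolding c_def of_int_eq_iff by presburger
  qed
  have bracket: "bracket \<mu> k m a = vertical_integral c (?F a) - residue (?F a) 0" if "a > 0" for a
    using assms that c by (intro bracket_eq_vertical_integral) auto
  have reflect: "A * ?F \<alpha> (- 2 * of_int m - w) = B * ?F \<beta> w" for w
    unfolding A_def B_def using assms(3-5) by (rule mellin_integrand_reflect)
  have "A \<noteq> 0" using assms(3) by (simp add: A_def)
  have left: "A * vertical_integral (- of_int (2 * m) - c) (?F \<alpha>) = B * vertical_integral c (?F \<beta>)"
  proof -
    have "vertical_integral (- of_int (2 * m) - c) (?F \<alpha>) = vertical_integral c (\<lambda>w. ?F \<alpha> (- 2 * of_int m - w))"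
      by (subst vertical_integral_reflect) simp
    then have "A * vertical_integral (- of_int (2 * m) - c) (?F \<alpha>) =
        vertical_integral c (\<lambda>w. A * ?F \<alpha> (- 2 * of_int m - w))"
      by (simp only: vertical_integral_mult_left)
    then show ?thesis by (simp only: reflect vertical_integral_mult_left)
  qed
  have res: "A * residue (?F \<alpha>) (- 2 * of_int m) = - (B * residue (?F \<beta>) 0)"
  proof -
    have "?F \<alpha> (- 2 * of_int m - w) = (B / A) * ?F \<beta> w" for w
      using reflect[of w] \<open>A \<noteq> 0\<close> by (simp add: field_simps)
    then have "residue (?F \<alpha>) (- 2 * of_int m) = - ((B / A) * residue (?F \<beta>) 0)"
      using assms by (intro residue_mellin_integrand_reflect)
    then show ?thesis using \<open>A \<noteq> 0\<close> by simp
  qed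
  \<comment> \<open>For \<open>j < 0\<close> or \<open>j > m + 1\<close> one of the two zeta values is a trivial zero, so these residues vanish.\<close>
  have odd: "residue (?F \<alpha>) (of_int (1 - 2 * j)) = of_real (R j)" for j
    unfolding R_def using assms(3) by (rule residue_mellin_integrand_odd)
  have shift: "vertical_integral c (?F \<alpha>) - vertical_integral (- of_int (2 * m) - c) (?F \<alpha>) =
      residue (?F \<alpha>) 0 + residue (?F \<alpha>) (- 2 * of_int m) + of_real (\<Sum>j\<in>{1 - M..m + M}. R j)"
    using mellin_integrand_shift[OF assms(3,2) M_def, of k] unfolding c_def odd of_real_sum .
  have "A * bracket \<mu> k m \<alpha> = A * ((vertical_integral c (?F \<alpha>) - vertical_integral (- of_int (2 * m) - c) (?F \<alpha>)) +
      vertical_integral (- of_int (2 * m) - c) (?F \<alpha>) - residue (?F \<alpha>) 0)"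
    by (simp add: bracket assms(3))
  also have "\<dots> = A * vertical_integral (- of_int (2 * m) - c) (?F \<alpha>) + A * residue (?F \<alpha>) (- 2 * of_int m) +
      A * of_real (\<Sum>j\<in>{1 - M..m + M}. R j)"
    unfolding shift by (simp add: algebra_simps)
  also have "\<dots> = B * bracket \<mu> k m \<beta> + A * of_real (\<Sum>j\<in>{1 - M..m + M}. R j)"
    unfolding left res by (simp add: bracket assms(4) algebra_simps)
  also have "A * of_real (\<Sum>j\<in>{1 - M..m + M}. R j) =
      of_real (\<Sum>j\<in>{0..m + 1}. (\<alpha> ^ k) powi (- m) * R (m + 1 - j))"
  proof -
    have "(\<Sum>j\<in>{1 - M..m + M}. R j) = (\<Sum>j\<in>{0..m + 1}. R j)"
    proof (rule sum.mono_neutral_right)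
      show "\<forall>j\<in>{1 - M..m + M} - {0..m + 1}. R j = 0"
        using assms(1) by (auto simp: R_def zeta_even_value_def)
    qed (auto simp: M_def)
    also have "\<dots> = (\<Sum>j\<in>{0..m + 1}. R (m + 1 - j))"
      by (rule sum.reindex_bij_witness[of _ "\<lambda>j. m + 1 - j" "\<lambda>j. m + 1 - j"]) auto
    finally show ?thesis unfolding A_def by (simp only: of_real_mult sum_distrib_left[symmetric])
  qed
  also have "(\<Sum>j\<in>{0..m + 1}. (\<alpha> ^ k) powi (- m) * R (m + 1 - j)) =
      (- 1) powi (int k * m + int k + m) * (pi / 2) ^ (k - 1) * 2 powi (2 * int k * m) *
           (\<Sum>j\<in>{0..m + 1}. (- 1) ^ nat j *
              (bernoulli (nat (2 * m - 2 * j + 2)) ^ k * bernoulli (nat (2 * j)) ^ k /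
               (fact (nat (2 * m - 2 * j + 2)) ^ k * fact (nat (2 * j)) ^ k)) *
              \<alpha> powi (int k * (m + 1 - j)) * \<beta> powi (int k * j))"
    unfolding sum_distrib_left
  proof (rule sum.cong[OF refl], goal_cases)
    case (1 j)
    have "m + 1 - (m + 1 - j) = j" by simp
    with residue_coefficient_identity[OF assms(1,3-5), of j m] 1 show ?case
      unfolding R_def by (simp only: atLeastAtMost_iff)
  qed
  finally show ?thesis by (simp only: A_def B_def)
qed

end
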